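(* Let $K$ be a sufficiently large (fixed) positive constant, let $\delta>0$ be suitably small, let $N^{1/2+\delta}\le Q\le N$, and let $Q_0$ be a real number such that $$K\sqrt{N\log N}\le Q\le N\quad\text{and}\quad \frac{N\log N}{Q}\le Q_0\le \frac{Q}{K^2}.$$ Let $\mathfrak{m}=\mathfrak{m}(K,Q_0,Q)$ be the corresponding set of minor arcs. Let $R(N)$ be a non-zero real function of $N$ and $\alpha_N=1+1/R(N)$. Suppose $KQ_0<N^{1/2-\delta/2}$. There exists a large constant $C=C(\delta)>0$ such that if $C\log\log N<|R(N)|\le N^{\delta/12}$ and $N$ is large enough in terms of $\delta$, we have $$\int_{\mathfrak{m}}|\mathcal{S}_{d_{\alpha_N}^{\varpi}}(\theta)|^2\,d\theta\gg_\delta \frac{N}{R(N)^2}\log\left(\frac{\log N}{\log(2N/Q)}\right)+Q,$$ both for $\varpi=\omega$ and for $\varpi=\Omega$.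
   Context: The major arcs $\mathfrak{M}=\mathfrak{M}(K,Q_0,Q)$ consist of those $\theta\in\mathbb{R}/\mathbb{Z}$ for which there are a positive integer $q\le KQ_0$ and a reduced residue class $a$ modulo $q$ (i.e. $(a,q)=1$) with $|\theta-a/q|\le K/(qQ)$. The minor arcs $\mathfrak{m}=\mathfrak{m}(K,Q_0,Q)$ are the complement of $\mathfrak{M}$ in $\mathbb{R}/\mathbb{Z}$. For an arithmetic function $f$, $\mathcal{S}_f(\theta):=\sum_{n\le N}f(n)e(n\theta)$ with $e(t)=e^{2\pi i t}$. $\omega(n)$ and $\Omega(n)$ denote the number of prime divisors of $n$ counted without and with multiplicity, respectively; $\varpi$ denotes either one, and $d_{\alpha_N}^{\varpi}(n):=\alpha_N^{\varpi(n)}$. $A\gg_\delta B$ means $A\ge \kappa B$ for a constant $\kappa>0$ depending on $\delta$ (and possibly on the fixed constant $K$). *)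

theory Defs
  imports "HOL-Analysis.Analysis" "HOL-Computational_Algebra.Primes"
begin

text \<open>
  Subsets of \<open>\<real>/\<int>\<close> are represented by their 1-periodic preimages in \<open>\<real>\<close>. The numerator \<open>a\<close>
  below runs over all integers prime to \<open>q\<close>, so that the distance from \<open>\<theta>\<close> to \<open>a/q\<close> is
  implicitly measured modulo 1.
\<close>

definition major_arcs :: "real \<Rightarrow> real \<Rightarrow> real \<Rightarrow> real set" where
  "major_arcs K Q0 Q =
     {\<theta>. \<exists>(q::nat) (a::int). 0 < q \<and> real q \<le> K * Q0 \<and> coprime a (int q) \<and>
          \<bar>\<theta> - real_of_int a / real q\<bar> \<le> K / (real q * Q)}"

definition minor_arcs :: "real \<Rightarrow> real \<Rightarrow> real \<Rightarrow> real set" where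
  "minor_arcs K Q0 Q = - major_arcs K Q0 Q"

text \<open>Integral over \<open>\<real>/\<int>\<close> of a 1-periodic function restricted to a 1-periodic set.\<close>

definition circle_integral :: "real set \<Rightarrow> (real \<Rightarrow> real) \<Rightarrow> real" where
  "circle_integral A F = (LINT \<theta>:A \<inter> {0..<1}|lborel. F \<theta>)"

definition e :: "real \<Rightarrow> complex" where
  "e t = exp (2 * of_real pi * \<i> * of_real t)"

definition exp_sum :: "(nat \<Rightarrow> complex) \<Rightarrow> nat \<Rightarrow> real \<Rightarrow> complex" where
  "exp_sum f N \<theta> = (\<Sum>n = 1..N. f n * e (real n * \<theta>))"

definition little_omega :: "nat \<Rightarrow> nat" where
  "little_omega n = card (prime_factors n)"

definition big_omega :: "nat \<Rightarrow> nat" where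
  "big_omega n = size (prime_factorization n)"

definition d_alpha :: "(nat \<Rightarrow> nat) \<Rightarrow> real \<Rightarrow> nat \<Rightarrow> complex" where
  "d_alpha w \<alpha> n = of_real (\<alpha> ^ w n)"

end

theory Submission
  imports Defs "HOL-Real_Asymp.Real_Asymp"
begin

text \<open>
  Write \<open>f(n) = \<alpha>^\<varpi>(n)\<close> as the divisor sum of a multiplicative \<open>h\<close>, with \<open>\<bar>h(p)\<bar> = \<rho> = 1/\<bar>R\<bar>\<close>; since
  \<open>\<rho> log log N\<close> is small, \<open>\<Sum> \<bar>h(d)\<bar>/d\<close> over \<open>1 < d \<le> N\<close> is small.

  For the first term, let \<open>p\<close> be a prime with \<open>C N/Q < p \<le> \<surd>N/4\<close>. The points \<open>a/p + \<beta>\<close> with \<open>\<beta>\<close> of exact order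
  \<open>1/N\<close> lie on the minor arcs, and by Cauchy-Schwarz over \<open>a\<close> the integral over them is at least about
  \<open>\<bar>\<Sum> f(n) c\<^sub>p(n) e(n\<beta>)\<bar>\<^sup>2/(pN)\<close>, where \<open>c\<^sub>p\<close> is the Ramanujan sum. Expanding \<open>f\<close>, the divisor \<open>d = p\<close>
  contributes about \<open>\<rho>N\<close> and the other ones, because \<open>c\<^sub>p\<close> has partial sums bounded by \<open>p\<close>, at most
  \<open>0.9 \<rho>N\<close>. Summing over \<open>p\<close> with Mertens' estimate gives the logarithm.

  For the term \<open>Q\<close>, the interval \<open>[2K/Q, 4K/Q]\<close> lies on the minor arcs. There the sum is tested against
  a smooth function; \<open>h(1)\<close> contributes as for the geometric sum \<open>\<Sum> e(n\<theta>)\<close>, which is of size \<open>Q/K\<close>,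
  and the other \<open>h(d)\<close> little.
\<close>

section \<open>Sums over primes\<close>

text \<open>Prime denominators work because the major arc at \<open>a/p\<close> has half-width
  \<open>K/(pQ)\<close>, which drops below \<open>1/N\<close> once \<open>p\<close> exceeds a
  multiple of \<open>K * N / Q\<close>: points at distance about \<open>1/N\<close> from
  \<open>a/p\<close> then fall into the gap. All errors must be compared with
  \<open>\<rho> * N\<close>, not with \<open>N\<close>, and two groups of divisors resist. Composite
  \<open>d\<close> have total weight of order \<open>(\<rho> ln ln N)^2\<close>, which need not be
  small against \<open>\<rho>\<close>, as only \<open>\<rho> ln ln N\<close> is small. The bound by
  \<open>p\<close> disposes of those up to \<open>N powr (1/4)\<close>; on the others the weight
  \<open>ln d / ln N\<close> is bounded below, and the sum of \<open>\<rho> ln q / q\<close> over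
  primes is about \<open>\<rho> ln N\<close>, with no \<open>ln ln N\<close>. Primes
  \<open>q \<noteq> p\<close> carry the same \<open>\<bar>h(q)\<bar> = \<rho>\<close> as
  \<open>p\<close> itself, so \<open>h\<close> gives no gain there. The bound by \<open>p\<close>
  handles them up to \<open>N powr (49/100)\<close>, which is why \<open>p\<close> stays below
  \<open>sqrt N\<close>; the rest costs about \<open>\<rho> * N\<close> times a sum of
  \<open>1/q\<close> that tends to \<open>ln (100/49) < 1\<close>. The main term wins only by a
  numerical margin, hence the explicit constants.\<close>

definition primes_upto :: "real \<Rightarrow> nat set" where
  "primes_upto x = {p. prime p \<and> real p \<le> x}"

lemma finite_primes_upto [simp, intro]: "finite (primes_upto x)"
proof (rule finite_subset)
  show "primes_upto x \<subseteq> {..nat \<lfloor>x\<rfloor>}"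
    by (auto simp: primes_upto_def le_nat_floor)
qed auto

lemma primes_upto_floor: "0 \<le> x \<Longrightarrow> primes_upto x = primes_upto (real (nat \<lfloor>x\<rfloor>))"
  unfolding primes_upto_def of_nat_le_iff by (simp add: le_nat_iff le_floor_iff)

lemma primes_upto_mono: "x \<le> y \<Longrightarrow> primes_upto x \<subseteq> primes_upto y"
  by (auto simp: primes_upto_def)

lemma ln_prime_pos: "prime (p::nat) \<Longrightarrow> 0 < ln (real p)"
  using prime_gt_1_nat[of p] by simp

lemma real_div_gt: "0 < d \<Longrightarrow> real n / real d - 1 < real (n div d)"
  using floor_divide_of_nat_eq[where 'a=real, of n d] by linarith

lemma power_over_fact_le_exp:
  assumes "0 \<le> (x::real)"
  shows "x ^ n / fact n \<le> exp x"
proof -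
  have S: "(\<lambda>n. x ^ n /\<^sub>R fact n) sums exp x" by (rule exp_converges)
  have "(\<Sum>k\<in>{n}. x ^ k /\<^sub>R fact k) \<le> (\<Sum>k. x ^ k /\<^sub>R fact k)"
    using S assms by (intro sum_le_suminf) (auto simp: sums_iff)
  then show ?thesis
    using S by (simp add: sums_iff field_simps)
qed

lemma geometric_sum_from_1_le:
  assumes "0 \<le> (r::real)" "r < 1"
  shows "(\<Sum>k=1..n. r ^ k) \<le> r / (1 - r)"
proof -
  have "(1 - r) * (\<Sum>k=1..n. r ^ k) = r - r ^ Suc n"
  proof (induction n)
    case (Suc n)
    have "(1 - r) * (\<Sum>k=1..Suc n. r ^ k) = (1 - r) * (\<Sum>k=1..n. r ^ k) + (1 - r) * r ^ Suc n"
      by (simp add: distrib_left)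
    also have "\<dots> = r - r ^ Suc n + (1 - r) * r ^ Suc n" by (simp only: Suc)
    also have "\<dots> = r - r ^ Suc (Suc n)" by (simp add: algebra_simps)
    finally show ?case .
  qed auto
  also have "\<dots> \<le> r" using assms by simp
  finally show ?thesis using assms by (simp add: field_simps)
qed

lemma sum_multiples:
  fixes d N :: nat and F :: "nat \<Rightarrow> 'b :: comm_monoid_add"
  assumes "0 < d"
  shows "(\<Sum>n | n \<in> {1..N} \<and> d dvd n. F n) = (\<Sum>m = 1..N div d. F (d * m))"
proof (rule sum.reindex_bij_witness[of _ "\<lambda>m. d * m" "\<lambda>n. n div d"])
  fix n assume "n \<in> {n. n \<in> {1..N} \<and> d dvd n}"
  then show "n div d \<in> {1..N div d}" "d * (n div d) = n" "F (d * (n div d)) = F n"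
    using assms by (auto simp: div_le_mono dvd_imp_le Suc_le_eq div_greater_zero_iff)
next
  fix m assume "m \<in> {1..N div d}"
  then show "d * m div d = m" "d * m \<in> {n. n \<in> {1..N} \<and> d dvd n}"
    using assms by (auto simp: less_eq_div_iff_mult_less_eq mult.commute)
qed

lemma prod_primes_dvd:
  fixes n :: nat
  assumes "finite A" "\<And>p. p \<in> A \<Longrightarrow> prime p \<and> p dvd n"
  shows "\<Prod>A dvd n"
  using assms
proof (induction A rule: finite_induct)
  case (insert p A)
  have "coprime p (\<Prod>A)"
    using insert by (intro prod_coprime_right) (auto intro: primes_coprime)
  then show ?case
    using insert by (auto intro: divides_mult)
qed auto

text \<open>Chebyshev's argument: the primes in \<open>(m, 2m]\<close> divide the central binomial
  coefficient, which is at most \<open>4 ^ m\<close>. The factor 2 in the bound pays for rounding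
  \<open>n/2\<close> up; the induction needs \<open>3 * m \<le> 2 * n\<close>, with equality at
  \<open>n = 3\<close>.\<close>

lemma sum_ln_primes_le: "(\<Sum>p\<in>primes_upto (real n). ln (real p)) \<le> 2 * real n * ln 4"
proof (induction n rule: less_induct)
  case (less n)
  have step: "(\<Sum>p\<in>primes_upto (real (2*m)). ln (real p))
      \<le> (\<Sum>p\<in>primes_upto (real m). ln (real p)) + real m * ln 4" for m
  proof -
    let ?A = "primes_upto (real (2*m)) - primes_upto (real m)"
    have "\<Prod>?A dvd (2*m choose m)"
    proof (rule prod_primes_dvd)
      fix p assume p: "p \<in> ?A"
      then have "prime p" "p \<le> 2*m" "\<not> p \<le> m"
        by (auto simp: primes_upto_def)
      moreover have "p dvd fact m * fact (2*m - m) * (2*m choose m)"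
        using calculation by (subst binomial_fact_lemma) (auto simp: prime_dvd_fact_iff)
      ultimately show "prime p \<and> p dvd (2*m choose m)"
        by (auto simp: prime_dvd_mult_iff prime_dvd_fact_iff)
    qed auto
    then have "\<Prod>?A \<le> (2*m choose m)"
      by (rule dvd_imp_le) simp
    also have "\<dots> \<le> 2 ^ (2*m)"
      by (rule binomial_le_pow2)
    finally have "real (\<Prod>?A) \<le> real (2 ^ (2*m))"
      by (simp only: of_nat_le_iff)
    then have "real (\<Prod>?A) \<le> 2 ^ (2*m)"
      by (simp only: of_nat_power of_nat_numeral)
    moreover have pos: "0 < real (\<Prod>?A)"
      by (auto simp: primes_upto_def intro!: prod_pos prime_gt_0_nat)
    ultimately have "ln (real (\<Prod>?A)) \<le> ln (2 ^ (2*m))"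
      by simp
    also have "\<dots> = real m * ln 4"
      by (simp add: ln_realpow power_mult flip: power2_eq_square)
    finally have "(\<Sum>p\<in>?A. ln (real p)) \<le> real m * ln 4"
      unfolding of_nat_prod
      by (subst (asm) ln_prod; simp) (auto simp: primes_upto_def prime_gt_0_nat)
    moreover have "(\<Sum>p\<in>primes_upto (real (2*m)). ln (real p)) =
        (\<Sum>p\<in>?A. ln (real p)) + (\<Sum>p\<in>primes_upto (real m). ln (real p))"
      by (intro sum.subset_diff primes_upto_mono) auto
    ultimately show ?thesis by simp
  qed
  show ?case
  proof (cases "n \<le> 1")
    case True
    then have "primes_upto (real n) = {}"
      by (auto simp: primes_upto_def dest: prime_gt_1_nat)
    then show ?thesis by simp
  next
    case False
    define m where "m = (n + 1) div 2"
    have m: "m < n" "n \<le> 2*m" "2*m \<le> n + 1"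
      using False by (auto simp: m_def)
    have "(\<Sum>p\<in>primes_upto (real n). ln (real p)) \<le> (\<Sum>p\<in>primes_upto (real (2*m)). ln (real p))"
      using m by (intro sum_mono2 primes_upto_mono finite_primes_upto)
        (auto simp: primes_upto_def less_imp_le[OF ln_prime_pos])
    also have "\<dots> \<le> 2 * real m * ln 4 + real m * ln 4"
      using step[of m] less.IH[OF m(1)] by simp
    also have "\<dots> = (3 * real m) * ln 4" by simp
    also have "\<dots> \<le> (2 * real n) * ln 4"
    proof (intro mult_right_mono)
      show "3 * real m \<le> 2 * real n" using m False by linarith
    qed simp
    finally show ?thesis by simp
  qed
qed

section \<open>Mertens' estimate for the sum of \<open>ln p / p\<close>, by way of the factorization
  of \<open>fact n\<close>\<close>

lemma ln_eq_sum_multiplicity: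
  fixes m :: nat
  assumes "0 < m" "prime_factors m \<subseteq> P" "finite P" "\<And>p. p \<in> P \<Longrightarrow> prime p"
  shows "ln (real m) = (\<Sum>p\<in>P. real (multiplicity p m) * ln (real p))"
proof -
  have "real m = real (\<Prod>p\<in>prime_factors m. p ^ multiplicity p m)"
    using prime_factorization_nat[of m] assms by simp
  also have "ln \<dots> = (\<Sum>p\<in>prime_factors m. ln (real (p ^ multiplicity p m)))"
    unfolding of_nat_prod by (subst ln_prod) (auto dest!: in_prime_factors_imp_prime prime_gt_0_nat)
  also have "\<dots> = (\<Sum>p\<in>prime_factors m. real (multiplicity p m) * ln (real p))"
    by (intro sum.cong) (auto dest!: in_prime_factors_imp_prime prime_gt_0_nat simp: ln_realpow)
  also have "\<dots> = (\<Sum>p\<in>P. real (multiplicity p m) * ln (real p))"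
    using assms by (intro sum.mono_neutral_left) (auto simp: prime_factors_multiplicity)
  finally show ?thesis .
qed

text \<open>Legendre's formula, by counting the pairs \<open>(m, k)\<close> with
  \<open>p ^ k dvd m\<close> in both orders. Stopping at \<open>k = n\<close> loses nothing, since
  \<open>m < p ^ m\<close> forces \<open>multiplicity p m < m\<close>.\<close>

lemma sum_multiplicity_eq:
  assumes p: "prime (p::nat)"
  shows "(\<Sum>m=1..n. multiplicity p m) = (\<Sum>k=1..n. n div p ^ k)"
proof -
  have "(\<Sum>m=1..n. multiplicity p m) = (\<Sum>m=1..n. \<Sum>k=1..n. if p ^ k dvd m then 1 else 0)"
  proof (rule sum.cong)
    fix m assume m: "m \<in> {1..n}"
    have p1: "\<not> is_unit p" using p not_prime_unit by blast
    have "multiplicity p m < m"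
    proof (rule multiplicity_lessI)
      have "m < p ^ m" using prime_gt_1_nat[OF p] by (intro power_gt_expt) simp
      then show "\<not> p ^ m dvd m" using m by (auto dest!: dvd_imp_le)
    qed (use m p1 in auto)
    then have "multiplicity p m \<le> n" using m by simp
    then have "{k\<in>{1..n}. p ^ k dvd m} = {1..multiplicity p m}"
      using m p1 by (auto simp: power_dvd_iff_le_multiplicity)
    then show "multiplicity p m = (\<Sum>k=1..n. if p ^ k dvd m then 1 else 0)"
      by (simp flip: sum.inter_filter)
  qed auto
  also have "\<dots> = (\<Sum>k=1..n. \<Sum>m=1..n. if p ^ k dvd m then 1 else 0)"
    by (rule sum.swap)
  also have "\<dots> = (\<Sum>k=1..n. n div p ^ k)"
  proof (rule sum.cong)
    fix k
    have "(\<Sum>m=1..n. if p ^ k dvd m then 1 else 0) = (\<Sum>m | m \<in> {1..n} \<and> p ^ k dvd m. 1::nat)"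
      by (subst sum.inter_filter[symmetric]) auto
    also have "\<dots> = n div p ^ k"
      using p by (subst sum_multiples) (auto simp: prime_gt_0_nat)
    finally show "(\<Sum>m=1..n. if p ^ k dvd m then 1 else 0) = n div p ^ k" .
  qed auto
  finally show ?thesis .
qed

lemma ln_fact_eq:
  "ln (fact n) = (\<Sum>p\<in>primes_upto (real n). real (\<Sum>k=1..n. n div p ^ k) * ln (real p))"
proof -
  have "ln (fact n) = (\<Sum>m=1..n. ln (real m))"
    unfolding fact_prod of_nat_prod by (subst ln_prod) auto
  also have "\<dots> = (\<Sum>m=1..n. \<Sum>p\<in>primes_upto (real n). real (multiplicity p m) * ln (real p))"
  proof (rule sum.cong)
    fix m assume m: "m \<in> {1..n}"
    have "prime_factors m \<subseteq> primes_upto (real n)"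
    proof
      fix p assume "p \<in> prime_factors m"
      then have "prime p" "p dvd m" by auto
      moreover have "p \<le> m" using calculation m by (intro dvd_imp_le) auto
      ultimately show "p \<in> primes_upto (real n)" using m by (auto simp: primes_upto_def)
    qed
    then show "ln (real m) = (\<Sum>p\<in>primes_upto (real n). real (multiplicity p m) * ln (real p))"
      using m by (intro ln_eq_sum_multiplicity) (auto simp: primes_upto_def)
  qed auto
  also have "\<dots> = (\<Sum>p\<in>primes_upto (real n). real (\<Sum>m=1..n. multiplicity p m) * ln (real p))"
    by (subst sum.swap) (simp add: sum_distrib_right)
  also have "\<dots> = (\<Sum>p\<in>primes_upto (real n). real (\<Sum>k=1..n. n div p ^ k) * ln (real p))"
    by (intro sum.cong refl arg_cong2[where f="(*)"] arg_cong[where f=real] sum_multiplicity_eq)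
      (simp add: primes_upto_def)
  finally show ?thesis .
qed

text \<open>Comparison with \<open>n powr (-3/2)\<close>. The uniformity over finite sets lets one
  constant \<open>S\<close> serve for primes in any range; it bounds what the higher prime powers
  contribute.\<close>

lemma sum_ln_over_square_bounded:
  "\<exists>C\<ge>0. \<forall>A::nat set. finite A \<longrightarrow> (\<Sum>m\<in>A. ln (real m) / (real m)\<^sup>2) \<le> C"
proof -
  have "summable (\<lambda>n::nat. norm (real n powr (-3/2)))"
    by (simp add: summable_real_powr_iff)
  moreover have "(\<lambda>n::nat. ln (real n) / (real n)\<^sup>2) \<in> O(\<lambda>n. real n powr (-3/2))"
    by real_asymp
  ultimately have S: "summable (\<lambda>n::nat. ln (real n) / (real n)\<^sup>2)"
    by (rule summable_comparison_test_bigo)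
  have nn: "0 \<le> ln (real n) / (real n)\<^sup>2" for n
    by (cases "n = 0") auto
  show ?thesis
    using S nn by (intro exI[of _ "\<Sum>n. ln (real n) / (real n)\<^sup>2"]) (auto intro!: suminf_nonneg sum_le_suminf)
qed

lemma ln_half_le_ln_floor: "1 \<le> x \<Longrightarrow> ln x - ln 2 \<le> ln (real (nat \<lfloor>x\<rfloor>))"
proof -
  assume x: "1 \<le> x"
  have "1 \<le> \<lfloor>x\<rfloor>" using x by simp
  then have "x / 2 \<le> real (nat \<lfloor>x\<rfloor>)" using floor_correct[of x] by linarith
  then have "ln (x / 2) \<le> ln (real (nat \<lfloor>x\<rfloor>))" using x by (subst ln_le_cancel_iff) auto
  then show ?thesis using x by (simp add: ln_div)
qed

text \<open>Both bounds compare \<open>n\<close> times the sum with \<open>ln (fact n)\<close>. For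
  the upper one, \<open>n div p > n/p - 1\<close>, and Chebyshev's bound absorbs the subtracted
  logarithms. For the lower one, \<open>fact n\<close> is at least \<open>(n/exp 1) ^ n\<close>, and
  the prime powers with \<open>k \<ge> 2\<close> add only a convergent series.\<close>

lemma mertens_nat:
  "\<exists>C\<ge>1. \<forall>n\<ge>1. \<bar>(\<Sum>p\<in>primes_upto (real n). ln (real p) / real p) - ln (real n)\<bar> \<le> C"
proof -
  obtain S where S: "S \<ge> 0" "\<And>A::nat set. finite A \<Longrightarrow> (\<Sum>m\<in>A. ln (real m) / (real m)\<^sup>2) \<le> S"
    using sum_ln_over_square_bounded by blast
  have "\<bar>(\<Sum>p\<in>primes_upto (real n). ln (real p) / real p) - ln (real n)\<bar> \<le> 1 + 2 * ln 4 + 2 * S"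
    if n: "n \<ge> 1" for n
  proof -
    let ?P = "primes_upto (real n)"
    let ?M = "\<Sum>p\<in>?P. ln (real p) / real p"
    have nn: "0 \<le> ln (real p)" "0 < p" "1 < p" "prime p" if "p \<in> ?P" for p
      using that ln_prime_pos[of p] by (auto simp: primes_upto_def prime_gt_0_nat prime_gt_1_nat)
    have "real n * ?M - 2 * real n * ln 4 \<le> real n * ?M - (\<Sum>p\<in>?P. ln (real p))"
      using sum_ln_primes_le[of n] by simp
    also have "\<dots> = (\<Sum>p\<in>?P. (real n / real p - 1) * ln (real p))"
      by (simp add: sum_distrib_left sum_subtractf algebra_simps)
    also have "\<dots> \<le> (\<Sum>p\<in>?P. real (\<Sum>k=1..n. n div p ^ k) * ln (real p))"
    proof (intro sum_mono mult_right_mono)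
      fix p assume p: "p \<in> ?P"
      have "real n / real p - 1 \<le> real (n div p)"
        using real_div_gt[of p n] nn(2)[OF p] by linarith
      also have "n div p \<le> (\<Sum>k=1..n. n div p ^ k)"
        using n by (intro order.trans[OF _ member_le_sum[of 1]]) auto
      finally show "real n / real p - 1 \<le> real (\<Sum>k=1..n. n div p ^ k)" by simp
    qed (use nn in auto)
    also have "\<dots> = ln (fact n)" by (simp add: ln_fact_eq)
    also have "\<dots> \<le> real n * ln (real n)"
    proof -
      have "(fact n :: real) \<le> real n ^ n" using fact_le_power[where 'a=real, of n] by simp
      then have "ln (fact n :: real) \<le> ln (real n ^ n)" using n by (subst ln_le_cancel_iff) auto
      then show ?thesis using n by (simp add: ln_realpow)
    qed
    finally have "real n * (?M - 2 * ln 4) \<le> real n * ln (real n)" by (simp add: algebra_simps)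
    then have upper: "?M - 2 * ln 4 \<le> ln (real n)" using n by simp
    have "real n * ln (real n) - real n \<le> ln (fact n)"
    proof -
      \<comment> \<open>A single term of the exponential series replaces Stirling's formula.\<close>
      have "real n ^ n / fact n \<le> exp (real n)"
        by (intro power_over_fact_le_exp) simp
      then have "ln (real n ^ n / fact n) \<le> real n"
        using n by (metis divide_pos_pos fact_gt_zero ln_exp ln_mono of_nat_0_less_iff order_less_le_trans zero_less_one zero_less_power)
      then show ?thesis using n by (simp add: ln_div ln_realpow)
    qed
    also have "\<dots> = (\<Sum>p\<in>?P. real (\<Sum>k=1..n. n div p ^ k) * ln (real p))" by (simp add: ln_fact_eq)
    also have "\<dots> \<le> (\<Sum>p\<in>?P. (real n / real p + 2 * real n / (real p)\<^sup>2) * ln (real p))"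
    proof (intro sum_mono mult_right_mono)
      fix p assume p: "p \<in> ?P"
      have p2: "real p \<ge> 2" using nn[OF p] by simp
      have "real (\<Sum>k=1..n. n div p ^ k) \<le> (\<Sum>k=1..n. real n * (1 / real p) ^ k)"
        unfolding of_nat_sum by (intro sum_mono) (metis of_nat_div_le_of_nat of_nat_power power_one_over times_divide_eq_right mult.right_neutral)
      also have "\<dots> = real n * (\<Sum>k=1..n. (1 / real p) ^ k)" by (simp add: sum_distrib_left)
      also have "\<dots> \<le> real n * (1 / real p + 2 / (real p)\<^sup>2)"
      proof (intro mult_left_mono)
        have "(\<Sum>k=1..n. (1 / real p) ^ k) \<le> 1 / (real p - 1)"
          using p2 geometric_sum_from_1_le[of "1 / real p" n] by (simp add: field_simps)
        also have "\<dots> \<le> 1 / real p + 2 / (real p)\<^sup>2"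
          using p2 by (simp add: field_simps power2_eq_square)
        finally show "(\<Sum>k=1..n. (1 / real p) ^ k) \<le> 1 / real p + 2 / (real p)\<^sup>2" .
      qed simp
      finally show "real (\<Sum>k=1..n. n div p ^ k) \<le> real n / real p + 2 * real n / (real p)\<^sup>2"
        by (simp add: algebra_simps)
    qed (use nn in auto)
    also have "\<dots> = real n * (?M + 2 * (\<Sum>p\<in>?P. ln (real p) / (real p)\<^sup>2))"
      by (simp add: sum_distrib_left sum.distrib algebra_simps)
    also have "\<dots> \<le> real n * (?M + 2 * S)"
      by (intro mult_left_mono add_left_mono) (auto intro: S)
    finally have "real n * (ln (real n) - 1) \<le> real n * (?M + 2 * S)" by (simp add: algebra_simps)
    then have "ln (real n) - 1 \<le> ?M + 2 * S" using n by simp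
    moreover have "0 \<le> ln (4::real)" by simp
    ultimately show ?thesis using upper S(1) unfolding abs_le_iff by linarith
  qed
  then show ?thesis using S(1) by (intro exI[of _ "1 + 2 * ln 4 + 2 * S"]) auto
qed

lemma mertens_first:
  "\<exists>C\<ge>1. \<forall>x\<ge>1. \<bar>(\<Sum>p\<in>primes_upto x. ln (real p) / real p) - ln x\<bar> \<le> C"
proof -
  obtain C where C: "C \<ge> 1"
    "\<And>n. n \<ge> 1 \<Longrightarrow> \<bar>(\<Sum>p\<in>primes_upto (real n). ln (real p) / real p) - ln (real n)\<bar> \<le> C"
    using mertens_nat by blast
  have "\<bar>(\<Sum>p\<in>primes_upto x. ln (real p) / real p) - ln x\<bar> \<le> C + ln 2" if x: "x \<ge> 1" for x
  proof -
    define n where "n = nat \<lfloor>x\<rfloor>"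
    have n: "n \<ge> 1" "real n \<le> x" using x by (auto simp: n_def le_nat_iff le_floor_iff)
    have "primes_upto x = primes_upto (real n)"
      using x unfolding n_def by (intro primes_upto_floor) auto
    moreover have "ln (real n) \<le> ln x" using n x by (subst ln_le_cancel_iff) auto
    moreover have "ln x - ln 2 \<le> ln (real n)" using ln_half_le_ln_floor[OF x] by (simp add: n_def)
    ultimately show ?thesis using C(2)[OF n(1)] by (simp only: abs_le_iff) linarith
  qed
  moreover have "0 \<le> ln (2::real)" by simp
  ultimately show ?thesis using C(1) by (intro exI[of _ "C + ln 2"]) (auto intro: add_increasing2)
qed

text \<open>Choosing one constant here lets later hypotheses and thresholds refer to it by name. It
  is taken at least 1 so that a lower bound on \<open>ln N\<close> in terms of it is also an
  absolute one.\<close>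

definition mertens_const :: real where
  "mertens_const = (SOME C. C \<ge> 1 \<and> (\<forall>x\<ge>1. \<bar>(\<Sum>p\<in>primes_upto x. ln (real p) / real p) - ln x\<bar> \<le> C))"

lemma mertens_const_ge_1: "1 \<le> mertens_const"
  and sum_ln_over_primes:
    "1 \<le> x \<Longrightarrow> \<bar>(\<Sum>p\<in>primes_upto x. ln (real p) / real p) - ln x\<bar> \<le> mertens_const"
  using someI_ex[OF mertens_first, folded mertens_const_def] by auto

section \<open>Sums of \<open>1/p\<close> over blocks of primes\<close>

lemma sum_ln_over_primes_block:
  assumes "1 \<le> x" "x \<le> y"
  shows "\<bar>(\<Sum>p\<in>primes_upto y - primes_upto x. ln (real p) / real p) - ln (y / x)\<bar> \<le> 2 * mertens_const"
proof -
  have "(\<Sum>p\<in>primes_upto y. ln (real p) / real p) =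
      (\<Sum>p\<in>primes_upto y - primes_upto x. ln (real p) / real p) + (\<Sum>p\<in>primes_upto x. ln (real p) / real p)"
    using assms by (intro sum.subset_diff primes_upto_mono) auto
  moreover have "ln (y / x) = ln y - ln x" using assms by (simp add: ln_div)
  ultimately show ?thesis
    using sum_ln_over_primes[of x] sum_ln_over_primes[of y] assms by linarith
qed

text \<open>Replacing \<open>ln p\<close> by its value at the end of the block avoids partial
  summation. The loss is a factor up to \<open>ln y / ln x\<close>, so sharp use requires blocks
  that are short on the doubly logarithmic scale.\<close>

lemma sum_inverse_primes_block_le:
  assumes "1 < x" "x \<le> y"
  shows "(\<Sum>p\<in>primes_upto y - primes_upto x. 1 / real p) \<le> (ln (y / x) + 2 * mertens_const) / ln x"
proof -
  have "(\<Sum>p\<in>primes_upto y - primes_upto x. 1 / real p) \<le>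
      (\<Sum>p\<in>primes_upto y - primes_upto x. (ln (real p) / real p) / ln x)"
  proof (rule sum_mono)
    fix p assume "p \<in> primes_upto y - primes_upto x"
    then have "x < real p" by (auto simp: primes_upto_def)
    then have "ln x \<le> ln (real p)" "0 < real p" using assms by auto
    then show "1 / real p \<le> (ln (real p) / real p) / ln x"
      using assms by (simp add: field_simps)
  qed
  also have "\<dots> = (\<Sum>p\<in>primes_upto y - primes_upto x. ln (real p) / real p) / ln x"
    by (simp add: sum_divide_distrib)
  also have "\<dots> \<le> (ln (y / x) + 2 * mertens_const) / ln x"
    using sum_ln_over_primes_block[of x y] assms by (intro divide_right_mono) auto
  finally show ?thesis .
qed

lemma sum_inverse_primes_block_ge:
  assumes "1 \<le> x" "x \<le> y" "1 < y"
  shows "(ln (y / x) - 2 * mertens_const) / ln y \<le> (\<Sum>p\<in>primes_upto y - primes_upto x. 1 / real p)"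
proof -
  have "(ln (y / x) - 2 * mertens_const) / ln y \<le>
      (\<Sum>p\<in>primes_upto y - primes_upto x. ln (real p) / real p) / ln y"
    using sum_ln_over_primes_block[of x y] assms by (intro divide_right_mono) auto
  also have "\<dots> = (\<Sum>p\<in>primes_upto y - primes_upto x. (ln (real p) / real p) / ln y)"
    by (simp add: sum_divide_distrib)
  also have "\<dots> \<le> (\<Sum>p\<in>primes_upto y - primes_upto x. 1 / real p)"
  proof (rule sum_mono)
    fix p assume "p \<in> primes_upto y - primes_upto x"
    then have "x < real p" "real p \<le> y" by (auto simp: primes_upto_def)
    then have "ln (real p) \<le> ln y" "0 < real p" using assms by auto
    then show "(ln (real p) / real p) / ln y \<le> 1 / real p"
      using assms by (simp add: field_simps)
  qed
  finally show ?thesis .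
qed

lemma primes_upto_less_2: "x < 2 \<Longrightarrow> primes_upto x = {}"
proof -
  assume "x < 2"
  have False if "prime p" "real p \<le> x" for p
    using prime_ge_2_nat[OF that(1)] that(2) \<open>x < 2\<close> by linarith
  then show ?thesis by (auto simp: primes_upto_def)
qed

text \<open>Each block \<open>(sqrt x, x]\<close> contributes at most
  \<open>1 + 4 * mertens_const / ln x\<close>, and \<open>ln x \<ge> 2/3\<close> for
  \<open>x \<ge> 2\<close>; after \<open>n\<close> square roots no prime is left.\<close>

lemma sum_inverse_primes_le_iterated_sqrt:
  assumes "0 \<le> x" "x < 2 ^ (2 ^ n)"
  shows "(\<Sum>p\<in>primes_upto x. 1 / real p) \<le> real n * (1 + 6 * mertens_const)"
  using assms
proof (induction n arbitrary: x)
  case 0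
  then show ?case by (simp add: primes_upto_less_2)
next
  case (Suc n)
  show ?case
  proof (cases "x < 2")
    case True
    then show ?thesis using mertens_const_ge_1 by (simp add: primes_upto_less_2)
  next
    case False
    have "sqrt x < sqrt (2 ^ (2 ^ Suc n))" using Suc.prems by simp
    also have "\<dots> = 2 ^ (2 ^ n)" by (simp add: power_mult real_sqrt_power)
    finally have IH: "(\<Sum>p\<in>primes_upto (sqrt x). 1 / real p) \<le> real n * (1 + 6 * mertens_const)"
      using Suc by simp
    have s: "1 < sqrt x" "sqrt x \<le> x" using False by (auto simp: real_le_lsqrt power2_eq_square)
    have "ln 2 \<le> ln x" using False by simp
    then have l: "2/3 \<le> ln x" using ln2_ge_two_thirds by linarith
    have lx: "ln (sqrt x) = ln x / 2" "ln (x / sqrt x) = ln x / 2"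
      using False by (auto simp: ln_sqrt ln_div)
    have "(\<Sum>p\<in>primes_upto x. 1 / real p) =
        (\<Sum>p\<in>primes_upto x - primes_upto (sqrt x). 1 / real p) + (\<Sum>p\<in>primes_upto (sqrt x). 1 / real p)"
      using s by (intro sum.subset_diff primes_upto_mono) auto
    also have "(\<Sum>p\<in>primes_upto x - primes_upto (sqrt x). 1 / real p) \<le> (ln x / 2 + 2 * mertens_const) / (ln x / 2)"
      using sum_inverse_primes_block_le[OF s] lx by simp
    also have "\<dots> = 1 + 4 * mertens_const / ln x" using l by (simp add: field_simps)
    also have "\<dots> \<le> 1 + 6 * mertens_const"
      using l mertens_const_ge_1 by (simp add: field_simps)
    finally show ?thesis using IH by (simp add: algebra_simps)
  qed
qed

lemma sum_inverse_primes_le_lnln: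
  assumes "2 \<le> x"
  shows "(\<Sum>p\<in>primes_upto x. 1 / real p) \<le> (2 * ln (ln x) + 3) * (1 + 6 * mertens_const)"
proof -
  define n where "n = nat \<lceil>log 2 (log 2 x)\<rceil> + 1"
  have "1 \<le> log 2 x" using assms by (simp add: le_log_iff)
  then have "0 \<le> log 2 (log 2 x)" by simp
  then have n: "log 2 (log 2 x) < real n" "real n \<le> log 2 (log 2 x) + 2" by (auto simp: n_def) linarith+
  have "log 2 x < 2 ^ n" using n(1) \<open>1 \<le> log 2 x\<close> by (simp add: log_less_iff powr_realpow)
  then have "x < 2 powr (2 ^ n)" using assms by (simp add: log_less_iff)
  then have "x < 2 ^ (2 ^ n)" by (simp add: powr_realpow[symmetric])
  then have "(\<Sum>p\<in>primes_upto x. 1 / real p) \<le> real n * (1 + 6 * mertens_const)"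
    using assms by (intro sum_inverse_primes_le_iterated_sqrt) auto
  also have "real n \<le> 2 * ln (ln x) + 3"
  proof -
    have l2: "2/3 \<le> ln (2::real)" "ln (2::real) \<le> 1" using ln2_ge_two_thirds ln_le_minus_one[of 2] by auto
    have lx: "ln 2 \<le> ln x" using assms by simp
    have "log 2 (log 2 x) = (ln (ln x) - ln (ln 2)) / ln 2"
      using l2 lx by (simp add: log_def ln_div)
    moreover have "- ln (ln 2) \<le> (1/2::real)"
    proof -
      have "ln (1 / ln 2) \<le> 1 / ln 2 - (1::real)" using l2 by (intro ln_le_minus_one) auto
      also have "\<dots> \<le> 1/2" using l2 by (simp add: field_simps)
      finally show ?thesis using l2 by (simp add: ln_div)
    qed
    ultimately have "log 2 (log 2 x) * ln 2 \<le> ln (ln x) + 1/2" using l2 by simp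
    moreover have "log 2 (log 2 x) * (2/3) \<le> log 2 (log 2 x) * ln 2"
      using l2 \<open>0 \<le> log 2 (log 2 x)\<close> by (intro mult_left_mono) auto
    \<comment> \<open>Near \<open>x = 2\<close> this iterated logarithm is negative. The steps above
      give \<open>n \<le> 3/2 * ln (ln x) + 11/4\<close>, and this lower bound is just what allows
      rounding up to \<open>2 * ln (ln x) + 3\<close>.\<close>
    moreover have "ln (ln x) \<ge> - 1/2"
    proof -
      have "ln (ln 2) \<le> ln (ln x)" using lx l2 by simp
      then show ?thesis using \<open>- ln (ln 2) \<le> (1/2::real)\<close> by simp
    qed
    ultimately show ?thesis using n(2) by linarith
  qed
  finally show ?thesis using mertens_const_ge_1 by (simp add: mult_right_mono)
qed

section \<open>Multiplicative weights\<close>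

text \<open>Multiplicative functions whose value at \<open>q ^ k\<close> depends on \<open>k\<close>
  alone. This covers the Moebius transforms of \<alpha> to the power of either prime counting
  function.\<close>

definition mult_fun :: "(nat \<Rightarrow> real) \<Rightarrow> nat \<Rightarrow> real" where
  "mult_fun \<eta> n = (\<Prod>q\<in>prime_factors n. \<eta> (multiplicity q n))"

lemma mult_fun_1 [simp]: "mult_fun \<eta> 1 = 1" "mult_fun \<eta> (Suc 0) = 1"
  by (auto simp: mult_fun_def)

lemma prime_power_mult_factors:
  fixes q m k :: nat
  assumes q: "prime q" and m: "0 < m" "\<not> q dvd m" and k: "0 < k"
  shows "prime_factors (q ^ k * m) = insert q (prime_factors m)" "q \<notin> prime_factors m"
    and "multiplicity q (q ^ k * m) = k"
    and "r \<in> prime_factors m \<Longrightarrow> multiplicity r (q ^ k * m) = multiplicity r m"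
proof -
  have q0: "q \<noteq> 0" using q by auto
  show "prime_factors (q ^ k * m) = insert q (prime_factors m)"
    using q m k q0 by (subst prime_factors_product) (auto simp: prime_factorization_prime_power)
  show "q \<notin> prime_factors m" using m by auto
  show "multiplicity q (q ^ k * m) = k"
    using q m q0 by (subst prime_elem_multiplicity_mult_distrib) (auto simp: not_dvd_imp_multiplicity_0)
  show "multiplicity r (q ^ k * m) = multiplicity r m" if r: "r \<in> prime_factors m"
  proof -
    have "prime r" "r \<noteq> q" using r m by auto
    then have "\<not> r dvd q ^ k" using q by (metis prime_dvd_power primes_dvd_imp_eq)
    then show ?thesis using \<open>prime r\<close> m q0
      by (subst prime_elem_multiplicity_mult_distrib) (auto simp: not_dvd_imp_multiplicity_0)
  qed
qed

lemma prod_prime_power_mult: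
  fixes q m k :: nat and F :: "nat \<Rightarrow> real"
  assumes "prime q" "0 < m" "\<not> q dvd m" "0 < k"
  shows "(\<Prod>r\<in>prime_factors (q ^ k * m). F (multiplicity r (q ^ k * m))) =
    F k * (\<Prod>r\<in>prime_factors m. F (multiplicity r m))"
  using prime_power_mult_factors[OF assms] by (simp cong: prod.cong)

lemma mult_fun_prime_power_mult:
  fixes q m k :: nat
  assumes "prime q" "0 < m" "\<not> q dvd m" "0 < k"
  shows "mult_fun \<eta> (q ^ k * m) = \<eta> k * mult_fun \<eta> m"
  using prod_prime_power_mult[OF assms] by (simp add: mult_fun_def)

lemma mult_fun_prime_power: "prime q \<Longrightarrow> 0 < k \<Longrightarrow> mult_fun \<eta> (q ^ k) = \<eta> k"
  using mult_fun_prime_power_mult[of q 1 k \<eta>] by (simp add: prime_nat_iff)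

lemma prime_power_split:
  fixes n q :: nat
  assumes "prime q" "0 < n"
  obtains m where "n = q ^ multiplicity q n * m" "\<not> q dvd m" "0 < m"
proof -
  have "n \<noteq> 0" "\<not> is_unit q" using assms not_prime_unit by auto
  from multiplicity_decompose'[OF this] obtain m where "n = q ^ multiplicity q n * m" "\<not> q dvd m"
    by blast
  moreover have "0 < m" using calculation assms by (cases m) auto
  ultimately show thesis using that by blast
qed

text \<open>The divisor sum of a multiplicative function factors over primes. The induction removes
  the full power \<open>q ^ k\<close> of one prime, so that divisors of \<open>n\<close> correspond
  to pairs of an exponent \<open>j \<le> k\<close> and a divisor of the cofactor.\<close>

lemma sum_divisors_mult_fun:
  fixes n :: nat
  assumes "0 < n"
  shows "(\<Sum>d | d dvd n. mult_fun \<eta> d) = (\<Prod>q\<in>prime_factors n. 1 + (\<Sum>j=1..multiplicity q n. \<eta> j))"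
  using assms
proof (induction n rule: less_induct)
  case (less n)
  show ?case
  proof (cases "n = 1")
    case True
    then show ?thesis by simp
  next
    case False
    then obtain q where q: "prime q" "q dvd n" using prime_factor_nat by blast
    define k where "k = multiplicity q n"
    obtain m where m: "n = q ^ k * m" "\<not> q dvd m" "0 < m"
      using prime_power_split[OF q(1) less.prems] k_def by metis
    have q1: "1 < q" using q prime_gt_1_nat by blast
    have k: "0 < k" using q less.prems by (auto simp: k_def prime_multiplicity_gt_zero_iff)
    have "m < n" using one_less_power[OF q1 k] m by simp
    have "(\<Sum>d | d dvd n. mult_fun \<eta> d) = (\<Sum>(j, d)\<in>{0..k} \<times> {d. d dvd m}. mult_fun \<eta> (q ^ j * d))"
    proof (rule sum.reindex_bij_witness[of _ "\<lambda>(j, d). q ^ j * d"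
          "\<lambda>d. (multiplicity q d, d div q ^ multiplicity q d)"])
      fix d assume "d \<in> {d. d dvd n}"
      then have d: "d dvd n" "0 < d" using less.prems by (auto intro: dvd_pos_nat)
      obtain x where x: "d = q ^ multiplicity q d * x" "\<not> q dvd x" "0 < x"
        using prime_power_split[OF q(1) d(2)] by blast
      have dx: "d div q ^ multiplicity q d = x"
        using x q1 by (metis nonzero_mult_div_cancel_left power_eq_0_iff not_one_less_zero)
      then show "(case (multiplicity q d, d div q ^ multiplicity q d) of (j, d) \<Rightarrow> q ^ j * d) = d"
        using x by simp
      have "multiplicity q d \<le> k"
        using d less.prems unfolding k_def by (intro dvd_imp_multiplicity_le) auto
      moreover have "x dvd m"
      proof -
        have "x dvd q ^ k * m" using d x m by (metis dvd_mult_right)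
        moreover have "coprime x (q ^ k)" using x q by (simp add: prime_imp_coprime coprime_commute)
        ultimately show ?thesis by (simp add: coprime_dvd_mult_right_iff)
      qed
      ultimately show "(multiplicity q d, d div q ^ multiplicity q d) \<in> {0..k} \<times> {d. d dvd m}"
        using dx by simp
      show "(case (multiplicity q d, d div q ^ multiplicity q d) of (j, d) \<Rightarrow> mult_fun \<eta> (q ^ j * d)) = mult_fun \<eta> d"
        using dx x by simp
    next
      fix jd assume "jd \<in> {0..k} \<times> {d. d dvd m}"
      then obtain j d where jd: "jd = (j, d)" "j \<le> k" "d dvd m" by auto
      have "q ^ j * d dvd n" unfolding m(1) using jd by (intro mult_dvd_mono le_imp_power_dvd) auto
      then show "(case jd of (j, d) \<Rightarrow> q ^ j * d) \<in> {d. d dvd n}" using jd by simp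
      have d: "\<not> q dvd d" "0 < d" using jd m dvd_trans dvd_pos_nat by blast+
      have "multiplicity q (q ^ j * d) = j"
        using q d q1 by (subst prime_elem_multiplicity_mult_distrib) (auto simp: not_dvd_imp_multiplicity_0)
      then show "(multiplicity q (case jd of (j, d) \<Rightarrow> q ^ j * d), (case jd of (j, d) \<Rightarrow> q ^ j * d)
          div q ^ multiplicity q (case jd of (j, d) \<Rightarrow> q ^ j * d)) = jd"
        using jd q1 by simp
    qed
    also have "\<dots> = (\<Sum>j=0..k. \<Sum>d | d dvd m. mult_fun \<eta> (q ^ j * d))"
      by (simp add: sum.cartesian_product)
    also have "\<dots> = (\<Sum>d | d dvd m. mult_fun \<eta> d) + (\<Sum>j=1..k. \<Sum>d | d dvd m. mult_fun \<eta> (q ^ j * d))"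
      by (subst sum.atLeast_Suc_atMost) auto
    also have "(\<Sum>j=1..k. \<Sum>d | d dvd m. mult_fun \<eta> (q ^ j * d)) = (\<Sum>j=1..k. \<eta> j * (\<Sum>d | d dvd m. mult_fun \<eta> d))"
      unfolding sum_distrib_left
    proof (intro sum.cong refl)
      fix j d assume "j \<in> {1..k}" "d \<in> {d. d dvd m}"
      then show "mult_fun \<eta> (q ^ j * d) = \<eta> j * mult_fun \<eta> d"
        using m q by (intro mult_fun_prime_power_mult) (auto intro: dvd_trans dvd_pos_nat)
    qed
    also have "(\<Sum>d | d dvd m. mult_fun \<eta> d) + (\<Sum>j=1..k. \<eta> j * (\<Sum>d | d dvd m. mult_fun \<eta> d)) =
        (1 + (\<Sum>j=1..k. \<eta> j)) * (\<Sum>d | d dvd m. mult_fun \<eta> d)"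
      by (simp add: distrib_right sum_distrib_right)
    also have "\<dots> = (\<Prod>q\<in>prime_factors n. 1 + (\<Sum>j=1..multiplicity q n. \<eta> j))"
      unfolding less.IH[OF \<open>m < n\<close> m(3)] unfolding m(1)
      using prod_prime_power_mult[OF q(1) m(3,2) k, of "\<lambda>i. 1 + (\<Sum>j=1..i. \<eta> j)"] by simp
    finally show ?thesis .
  qed
qed

text \<open>Moebius inversion at prime powers: the differences of the sequence 1, \<alpha>,
  \<alpha>, \<alpha>, ...\<close>

definition eta_little_omega :: "real \<Rightarrow> nat \<Rightarrow> real" where
  "eta_little_omega \<alpha> k = (if k = 1 then \<alpha> - 1 else 0)"

text \<open>The differences of the geometric sequence of powers of \<alpha>.\<close>

definition eta_big_omega :: "real \<Rightarrow> nat \<Rightarrow> real" where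
  "eta_big_omega \<alpha> k = (\<alpha> - 1) * \<alpha> ^ (k - 1)"

lemma power_little_omega_eq:
  assumes "0 < n"
  shows "\<alpha> ^ little_omega n = (\<Sum>d | d dvd n. mult_fun (eta_little_omega \<alpha>) d)"
proof -
  have "(\<Sum>j=1..k. eta_little_omega \<alpha> j) = \<alpha> - 1" if "1 \<le> k" for k
    using that by (simp add: eta_little_omega_def sum.delta)
  then show ?thesis
    using assms unfolding sum_divisors_mult_fun[OF assms] little_omega_def prod_constant[symmetric]
    by (intro prod.cong) (auto simp: prime_factors_multiplicity)
qed

lemma power_big_omega_eq:
  assumes "0 < n"
  shows "\<alpha> ^ big_omega n = (\<Sum>d | d dvd n. mult_fun (eta_big_omega \<alpha>) d)"
proof -
  have *: "1 + (\<Sum>j=1..k. eta_big_omega \<alpha> j) = \<alpha> ^ k" for k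
    by (induction k) (auto simp: eta_big_omega_def algebra_simps)
  have "big_omega n = (\<Sum>q\<in>prime_factors n. multiplicity q n)"
    unfolding big_omega_def size_multiset_overloaded_eq
    by (intro sum.cong refl count_prime_factorization_prime) auto
  then show ?thesis
    using assms by (simp only: sum_divisors_mult_fun * power_sum)
qed

text \<open>What the two cases share. The growth condition reflects
  \<open>\<bar>\<alpha>\<bar> \<le> 1 + \<rho>\<close>; with \<open>\<rho> \<le> 1/10\<close> the
  ratio \<open>(1 + \<rho>)/q\<close> stays at most 11/20, even for \<open>q = 2\<close>. The value
  at 1 is an equality because \<open>h\<close> at a prime also furnishes the main term of a lower
  bound.\<close>

locale prime_weights =
  fixes \<eta> :: "nat \<Rightarrow> real" and \<rho> :: real
  assumes rho_pos: "0 < \<rho>" and rho_le: "\<rho> \<le> 1/10"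
    and eta_le: "\<And>k. 1 \<le> k \<Longrightarrow> \<bar>\<eta> k\<bar> \<le> \<rho> * (1 + \<rho>) ^ (k - 1)"
    and eta_1: "\<bar>\<eta> 1\<bar> = \<rho>"

lemma prime_weights_omega:
  assumes "0 < \<bar>\<alpha> - 1\<bar>" "\<bar>\<alpha> - 1\<bar> \<le> 1/10" "w \<in> {little_omega, big_omega}"
  obtains \<eta> where "prime_weights \<eta> \<bar>\<alpha> - 1\<bar>" "\<And>n. 0 < n \<Longrightarrow> \<alpha> ^ w n = (\<Sum>d | d dvd n. mult_fun \<eta> d)"
proof (cases "w = little_omega")
  case True
  have "prime_weights (eta_little_omega \<alpha>) \<bar>\<alpha> - 1\<bar>"
    using assms by unfold_locales (auto simp: eta_little_omega_def)
  then show ?thesis using that power_little_omega_eq True by blast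
next
  case False
  have "\<bar>\<alpha>\<bar> \<le> 1 + \<bar>\<alpha> - 1\<bar>" by linarith
  then have "\<bar>\<alpha>\<bar> ^ k \<le> (1 + \<bar>\<alpha> - 1\<bar>) ^ k" for k by (intro power_mono) auto
  note * = this[unfolded power_abs[symmetric]]
  have "prime_weights (eta_big_omega \<alpha>) \<bar>\<alpha> - 1\<bar>"
    using assms * by unfold_locales (auto simp: eta_big_omega_def abs_mult power_abs intro!: mult_left_mono)
  then show ?thesis using that power_big_omega_eq False assms by blast
qed

section \<open>The total weight \<open>Z N\<close> and its parts\<close>

context prime_weights
begin

abbreviation h :: "nat \<Rightarrow> real" where "h \<equiv> mult_fun \<eta>"

definition g :: "nat \<Rightarrow> real" where "g d = \<bar>h d\<bar> / real d"

definition Z :: "nat \<Rightarrow> real" where "Z N = (\<Sum>d=1..N. g d)"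

lemma g_nonneg: "0 \<le> g d" by (simp add: g_def)

lemma g_1 [simp]: "g (Suc 0) = 1" by (simp add: g_def)

lemma g_prime_power_mult:
  "prime q \<Longrightarrow> 0 < m \<Longrightarrow> \<not> q dvd m \<Longrightarrow> 0 < k \<Longrightarrow> g (q ^ k * m) = g (q ^ k) * g m"
  by (simp add: g_def mult_fun_prime_power_mult mult_fun_prime_power abs_mult)

lemma g_prime: "prime q \<Longrightarrow> g q = \<rho> / real q"
  using mult_fun_prime_power[of q 1 \<eta>] eta_1 by (simp add: g_def)

lemma Z_nonneg: "0 \<le> Z N" by (simp add: Z_def sum_nonneg g_nonneg)

lemma Z_eq: "1 \<le> N \<Longrightarrow> Z N = 1 + (\<Sum>d=2..N. g d)"
  unfolding Z_def by (subst sum.atLeast_Suc_atMost) (auto simp: numeral_2_eq_2)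

lemma Z_ge_1: "1 \<le> N \<Longrightarrow> 1 \<le> Z N"
  by (simp add: Z_eq sum_nonneg g_nonneg)

text \<open>The factor \<open>k\<close> is there for later weights
  \<open>ln (q ^ k) = k * ln q\<close>. It is absorbed through
  \<open>k \<le> 2 * (3/2) ^ (k - 2)\<close>, which leaves a geometric series of ratio at most 33/40
  with sum at most 40/7; finally \<open>2 * (11/10)^2 * 40/7 \<le> 14\<close>.\<close>

lemma sum_prime_powers_le:
  assumes q: "prime q"
  shows "(\<Sum>k=2..N. g (q ^ k) * real k) \<le> 14 * \<rho> / (real q)\<^sup>2"
proof -
  define r where "r = 11 / (10 * real q)"
  have q2: "2 \<le> real q" using prime_ge_2_nat[OF q] by simp
  have r: "0 < r" "r \<le> 11/20" using q2 by (auto simp: r_def field_simps)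
  have k_le: "real (k + 2) \<le> 2 * (3/2) ^ k" for k
  proof (induction k)
    case (Suc k)
    have "1 \<le> (3/2 :: real) ^ k" by simp
    with Suc show ?case by simp
  qed auto
  have summand: "g (q ^ k) * real k \<le> \<rho> * (2 * r\<^sup>2 * (33/40) ^ (k - 2))" if k: "k \<in> {2..N}" for k
  proof -
    obtain j where j: "k = j + 2" using k by (metis add.commute atLeastAtMost_iff le_Suc_ex)
    have "(1 + \<rho>) ^ (k - 1) \<le> (11/10) ^ (k - 1)" using rho_pos rho_le by (intro power_mono) auto
    also have "\<dots> \<le> (11/10) ^ k" by (intro power_increasing) auto
    finally have "\<bar>\<eta> k\<bar> \<le> \<rho> * (11/10) ^ k"
      using eta_le[of k] k rho_pos by (smt (verit) mult_left_mono atLeastAtMost_iff one_le_numeral order.trans)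
    then have "g (q ^ k) \<le> \<rho> * (11/10) ^ k / real q ^ k"
      using k q by (simp add: g_def mult_fun_prime_power divide_right_mono)
    also have "\<dots> = \<rho> * r ^ k" by (simp add: r_def power_divide power_mult_distrib)
    finally have "g (q ^ k) * real k \<le> \<rho> * r ^ k * real k" by (simp add: mult_right_mono)
    also have "\<dots> \<le> \<rho> * r ^ k * (2 * (3/2) ^ j)"
      using k_le[of j] j r rho_pos by (intro mult_left_mono) auto
    also have "\<dots> = \<rho> * (2 * r\<^sup>2 * (3/2 * r) ^ j)"
      unfolding j by (simp add: power_add power_mult_distrib power_divide power2_eq_square)
    also have "\<dots> \<le> \<rho> * (2 * r\<^sup>2 * (33/40) ^ j)"
      using r rho_pos by (intro mult_left_mono power_mono) auto
    finally show ?thesis using j by simp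
  qed
  have "(\<Sum>k=2..N. g (q ^ k) * real k) \<le> (\<Sum>k=2..N. \<rho> * (2 * r\<^sup>2 * (33/40) ^ (k - 2)))"
    by (rule sum_mono[OF summand])
  also have "\<dots> = \<rho> * (2 * r\<^sup>2) * (\<Sum>k=2..N. (33/40) ^ (k - 2))"
    by (simp add: sum_distrib_left mult.assoc)
  also have "(\<Sum>k=2..N. (33/40::real) ^ (k - 2)) = (\<Sum>k\<in>{..<N - 1}. (33/40) ^ k)"
    by (rule sum.reindex_bij_witness[of _ "\<lambda>k. k + 2" "\<lambda>k. k - 2"]) auto
  also have "\<dots> \<le> 40/7"
    by (subst sum_gp_strict) (auto simp: field_simps)
  finally have "(\<Sum>k=2..N. g (q ^ k) * real k) \<le> \<rho> * (2 * r\<^sup>2) * (40/7)"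
    using rho_pos by (simp add: mult_left_mono)
  also have "\<dots> \<le> 14 * \<rho> / (real q)\<^sup>2"
    using q2 rho_pos by (simp add: r_def field_simps power2_eq_square)
  finally show ?thesis .
qed

text \<open>Writing \<open>d = q ^ k * m\<close> with \<open>q\<close> prime to \<open>m\<close>
  embeds the range into pairs \<open>(k, m)\<close>. The condition \<open>d \<noteq> q\<close>
  removes exactly the pair (1, 1), which is why the term with \<open>k = 1\<close> carries the small
  factor \<open>Z N - 1\<close> instead of \<open>Z N\<close>.\<close>

lemma sum_multiples_le:
  fixes \<phi> :: "nat \<Rightarrow> real"
  assumes q: "prime q" and \<phi>: "\<And>k. 0 \<le> \<phi> k" and N: "1 \<le> N"
  shows "(\<Sum>d | d \<in> {1..N} \<and> q dvd d \<and> d \<noteq> q. g d * \<phi> (multiplicity q d))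
    \<le> g q * \<phi> 1 * (Z N - 1) + Z N * (\<Sum>k=2..N. g (q ^ k) * \<phi> k)"
proof -
  let ?S = "{d. d \<in> {1..N} \<and> q dvd d \<and> d \<noteq> q}"
  let ?T = "{1::nat} \<times> {2..N} \<union> {2..N} \<times> {1..N}"
  define \<iota> where "\<iota> d = (multiplicity q d, d div q ^ multiplicity q d)" for d
  define G where "G = (\<lambda>(k, m). g (q ^ k) * g m * \<phi> k)"
  have q1: "1 < q" using q prime_gt_1_nat by blast
  have *: "\<iota> d \<in> ?T \<and> d = q ^ fst (\<iota> d) * snd (\<iota> d) \<and> g d * \<phi> (multiplicity q d) = G (\<iota> d)" if d: "d \<in> ?S" for d
  proof -
    have d0: "0 < d" "d \<le> N" "q dvd d" using d by auto
    define k where "k = multiplicity q d"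
    obtain m where m: "d = q ^ k * m" "\<not> q dvd m" "0 < m"
      using prime_power_split[OF q d0(1)] k_def by metis
    have k: "0 < k" using q d0 by (auto simp: k_def prime_multiplicity_gt_zero_iff)
    have dm: "d div q ^ k = m" using m q1 by simp
    have "q ^ k \<le> d" "m \<le> d" using m q1 by auto
    moreover have "k < q ^ k" using q1 by (intro power_gt_expt) simp
    ultimately have "k \<le> N" "m \<le> N" using d0 by linarith+
    moreover have "m \<noteq> 1" if "k = 1" using d m that by auto
    ultimately have "(k, m) \<in> ?T" using k m by (cases "k = 1") auto
    moreover have "\<iota> d = (k, m)" by (simp add: \<iota>_def dm flip: k_def)
    moreover have "g d * \<phi> (multiplicity q d) = G (k, m)"
      unfolding G_def k_def[symmetric] by (subst m(1)) (simp add: g_prime_power_mult m k q)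
    ultimately show ?thesis using m(1) by simp
  qed
  have inj: "inj_on \<iota> ?S" by (rule inj_onI) (metis *)
  have "(\<Sum>d\<in>?S. g d * \<phi> (multiplicity q d)) = (\<Sum>d\<in>?S. G (\<iota> d))"
    by (rule sum.cong) (use * in auto)
  also have "\<dots> = sum G (\<iota> ` ?S)" using inj by (simp add: sum.reindex)
  also have "\<dots> \<le> sum G ?T"
  proof (rule sum_mono2)
    show "\<iota> ` ?S \<subseteq> ?T" using * by blast
  qed (auto simp: G_def intro!: mult_nonneg_nonneg g_nonneg \<phi>)
  also have "\<dots> = sum G ({1} \<times> {2..N}) + sum G ({2..N} \<times> {1..N})"
    by (intro sum.union_disjoint) auto
  also have "sum G ({1} \<times> {2..N}) = g q * \<phi> 1 * (Z N - 1)"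
    using N by (simp add: Z_eq G_def sum.cartesian_product[symmetric] sum_distrib_left algebra_simps)
  also have "sum G ({2..N} \<times> {1..N}) = Z N * (\<Sum>k=2..N. g (q ^ k) * \<phi> k)"
    by (simp add: Z_def G_def sum.cartesian_product[symmetric] sum_distrib_left sum_distrib_right algebra_simps)
  finally show ?thesis .
qed

lemma sum_proper_multiples_le:
  assumes q: "prime q" and N: "1 \<le> N"
  shows "(\<Sum>d | d \<in> {1..N} \<and> q dvd d \<and> d \<noteq> q. g d) \<le> \<rho> / real q * (Z N - 1) + Z N * (14 * \<rho> / (real q)\<^sup>2)"
proof -
  have "(\<Sum>k=2..N. g (q ^ k)) \<le> (\<Sum>k=2..N. g (q ^ k) * real k)"
    by (intro sum_mono mult_le_cancel_left1[THEN iffD2]) (auto simp: g_nonneg not_less)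
  also have "\<dots> \<le> 14 * \<rho> / (real q)\<^sup>2" by (rule sum_prime_powers_le[OF q])
  finally have "Z N * (\<Sum>k=2..N. g (q ^ k)) \<le> Z N * (14 * \<rho> / (real q)\<^sup>2)"
    by (intro mult_left_mono Z_nonneg)
  then show ?thesis
    using sum_multiples_le[OF q, of "\<lambda>_. 1" N] N q by (simp add: g_prime)
qed

text \<open>Every \<open>d \<ge> 2\<close> is a multiple of some prime. Per prime the multiples cost
  \<open>\<rho>/q + 14 * \<rho>/q^2\<close> times \<open>Z N\<close>, and \<open>q \<ge> 2\<close>
  turns this into \<open>8 * \<rho>/q\<close>. The occurrence of \<open>Z N\<close> on the right is
  harmless once its coefficient is small.\<close>

lemma Z_minus_1_le:
  assumes N: "1 \<le> N"
  shows "Z N - 1 \<le> 8 * \<rho> * (\<Sum>q\<in>primes_upto (real N). 1 / real q) * Z N"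
proof -
  let ?P = "primes_upto (real N)"
  have per_prime: "(\<Sum>d | d \<in> {1..N} \<and> q dvd d. g d) \<le> 8 * \<rho> * (1 / real q) * Z N" if q: "q \<in> ?P" for q
  proof -
    have q': "prime q" "q \<le> N" "1 \<le> q" using q by (auto simp: primes_upto_def dest: prime_gt_0_nat)
    have q2: "2 \<le> real q" using prime_ge_2_nat[OF q'(1)] by simp
    have "{d. d \<in> {1..N} \<and> q dvd d} = insert q {d. d \<in> {1..N} \<and> q dvd d \<and> d \<noteq> q}" using q' by auto
    then have "(\<Sum>d | d \<in> {1..N} \<and> q dvd d. g d) = g q + (\<Sum>d | d \<in> {1..N} \<and> q dvd d \<and> d \<noteq> q. g d)" by simp
    also have "\<dots> \<le> \<rho> / real q + (\<rho> / real q * (Z N - 1) + Z N * (14 * \<rho> / (real q)\<^sup>2))"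
      using sum_proper_multiples_le[OF q'(1) N] q' by (simp add: g_prime)
    also have "\<dots> = Z N * (\<rho> / real q + 14 * \<rho> / (real q)\<^sup>2)" by (simp add: algebra_simps)
    also have "\<dots> \<le> Z N * (\<rho> / real q + 7 * \<rho> / real q)"
      using q2 rho_pos by (intro mult_left_mono add_left_mono Z_nonneg) (simp add: field_simps power2_eq_square)
    finally show ?thesis by (simp add: algebra_simps)
  qed
  have "Z N - 1 = (\<Sum>d=2..N. g d)" using N by (simp add: Z_eq)
  also have "\<dots> \<le> (\<Sum>d=2..N. \<Sum>q\<in>?P. if q dvd d then g d else 0)"
  proof (rule sum_mono)
    fix d assume d: "d \<in> {2..N}"
    then obtain q where q: "prime q" "q dvd d" using prime_factor_nat[of d] by auto
    then have "q \<le> N" using d by (auto dest!: dvd_imp_le)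
    then show "g d \<le> (\<Sum>q\<in>?P. if q dvd d then g d else 0)"
      using q member_le_sum[of q ?P "\<lambda>q. if q dvd d then g d else 0"] by (auto simp: g_nonneg primes_upto_def)
  qed
  also have "\<dots> = (\<Sum>q\<in>?P. \<Sum>d=2..N. if q dvd d then g d else 0)" by (rule sum.swap)
  also have "\<dots> \<le> (\<Sum>q\<in>?P. \<Sum>d | d \<in> {1..N} \<and> q dvd d. g d)"
    by (intro sum_mono) (auto simp flip: sum.inter_filter intro!: sum_mono2 g_nonneg)
  also have "\<dots> \<le> (\<Sum>q\<in>?P. 8 * \<rho> * (1 / real q) * Z N)" by (rule sum_mono[OF per_prime])
  finally show ?thesis by (simp add: sum_distrib_left sum_distrib_right)
qed

text \<open>Rankin-style: the weight \<open>ln d / ln D \<ge> 1\<close> is distributed over the prime powers dividing \<open>d\<close>.\<close>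

lemma sum_composite_le:
  assumes N: "1 \<le> N" and D: "1 < D"
    and S: "\<And>A::nat set. finite A \<Longrightarrow> (\<Sum>m\<in>A. ln (real m) / (real m)\<^sup>2) \<le> S"
  shows "(\<Sum>d | d \<in> {1..N} \<and> \<not> prime d \<and> D < real d. g d)
    \<le> (\<rho> * (Z N - 1) * (ln (real N) + mertens_const) + 14 * \<rho> * Z N * S) / ln D"
proof -
  let ?P = "primes_upto (real N)"
  have lnD: "0 < ln D" using D by simp
  have "ln D * (\<Sum>d | d \<in> {1..N} \<and> \<not> prime d \<and> D < real d. g d) =
      (\<Sum>d | d \<in> {1..N} \<and> \<not> prime d \<and> D < real d. g d * ln D)"
    by (simp add: sum_distrib_left mult.commute)
  also have "\<dots> \<le> (\<Sum>d | d \<in> {1..N} \<and> \<not> prime d \<and> D < real d. g d * ln (real d))"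
    using D by (intro sum_mono mult_left_mono g_nonneg) auto
  also have "\<dots> \<le> (\<Sum>d | d \<in> {1..N} \<and> \<not> prime d. g d * ln (real d))"
    using D by (intro sum_mono2) (auto intro!: mult_nonneg_nonneg g_nonneg)
  also have "\<dots> = (\<Sum>d | d \<in> {1..N} \<and> \<not> prime d. \<Sum>q\<in>?P. g d * (real (multiplicity q d) * ln (real q)))"
  proof (rule sum.cong)
    fix d assume d: "d \<in> {d. d \<in> {1..N} \<and> \<not> prime d}"
    have "prime_factors d \<subseteq> ?P" using d by (auto simp: primes_upto_def dest!: dvd_imp_le)
    then have "ln (real d) = (\<Sum>q\<in>?P. real (multiplicity q d) * ln (real q))"
      using d by (intro ln_eq_sum_multiplicity) (auto simp: primes_upto_def)
    then show "g d * ln (real d) = (\<Sum>q\<in>?P. g d * (real (multiplicity q d) * ln (real q)))"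
      by (simp add: sum_distrib_left)
  qed auto
  also have "\<dots> = (\<Sum>q\<in>?P. \<Sum>d | d \<in> {1..N} \<and> \<not> prime d. g d * (real (multiplicity q d) * ln (real q)))"
    by (rule sum.swap)
  also have "\<dots> \<le> (\<Sum>q\<in>?P. \<rho> * (Z N - 1) * (ln (real q) / real q) + 14 * \<rho> * Z N * (ln (real q) / (real q)\<^sup>2))"
  proof (rule sum_mono)
    fix q assume "q \<in> ?P"
    then have q: "prime q" by (auto simp: primes_upto_def)
    have lq: "0 < ln (real q)" using ln_prime_pos[OF q] .
    let ?f = "\<lambda>d. g d * (real (multiplicity q d) * ln (real q))"
    have "(\<Sum>d | d \<in> {1..N} \<and> \<not> prime d. ?f d) = (\<Sum>d | d \<in> {1..N} \<and> \<not> prime d \<and> q dvd d. ?f d)"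
      by (intro sum.mono_neutral_right) (auto simp: not_dvd_imp_multiplicity_0)
    \<comment> \<open>A multiple of \<open>q\<close> that is not prime differs from
      \<open>q\<close>. This is how compositeness yields the extra factor
      \<open>Z N - 1\<close>.\<close>
    also have "\<dots> \<le> (\<Sum>d | d \<in> {1..N} \<and> q dvd d \<and> d \<noteq> q. ?f d)"
      using q lq by (intro sum_mono2) (auto intro!: mult_nonneg_nonneg g_nonneg)
    also have "\<dots> \<le> g q * (real 1 * ln (real q)) * (Z N - 1) + Z N * (\<Sum>k=2..N. g (q ^ k) * (real k * ln (real q)))"
      using lq by (intro sum_multiples_le q N) auto
    also have "(\<Sum>k=2..N. g (q ^ k) * (real k * ln (real q))) = ln (real q) * (\<Sum>k=2..N. g (q ^ k) * real k)"
      by (simp add: sum_distrib_left algebra_simps)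
    also have "g q * (real 1 * ln (real q)) * (Z N - 1) + Z N * \<dots>
      \<le> g q * (real 1 * ln (real q)) * (Z N - 1) + Z N * (ln (real q) * (14 * \<rho> / (real q)\<^sup>2))"
      using lq by (intro add_left_mono mult_left_mono Z_nonneg sum_prime_powers_le q) auto
    finally show "(\<Sum>d | d \<in> {1..N} \<and> \<not> prime d. ?f d)
        \<le> \<rho> * (Z N - 1) * (ln (real q) / real q) + 14 * \<rho> * Z N * (ln (real q) / (real q)\<^sup>2)"
      using q by (simp add: g_prime right_diff_distrib diff_divide_distrib mult.commute mult.left_commute)
  qed
  also have "\<dots> = \<rho> * (Z N - 1) * (\<Sum>q\<in>?P. ln (real q) / real q) + 14 * \<rho> * Z N * (\<Sum>q\<in>?P. ln (real q) / (real q)\<^sup>2)"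
    by (simp add: sum.distrib sum_distrib_left)
  also have "\<dots> \<le> \<rho> * (Z N - 1) * (ln (real N) + mertens_const) + 14 * \<rho> * Z N * S"
  proof (intro add_mono mult_left_mono)
    show "(\<Sum>q\<in>?P. ln (real q) / real q) \<le> ln (real N) + mertens_const"
      using sum_ln_over_primes[of "real N"] N by simp
  qed (use S rho_pos Z_ge_1[OF N] in \<open>auto intro!: mult_nonneg_nonneg\<close>)
  finally show ?thesis using lnD by (simp add: field_simps)
qed

end

section \<open>Twisting by Ramanujan sums\<close>

lemma e_eq_cis: "e x = cis (2 * pi * x)"
  by (simp add: e_def cis_conv_exp mult_ac)

lemma e_add: "e (x + y) = e x * e y"
  by (simp add: e_eq_cis cis_mult distrib_left)

lemma norm_e [simp]: "cmod (e x) = 1"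
  by (simp add: e_eq_cis)

lemma e_0 [simp]: "e 0 = 1"
  by (simp add: e_eq_cis)

lemma e_power: "e x ^ n = e (real n * x)"
  by (induction n) (auto simp: e_add distrib_right)

lemma norm_e_minus_1_le: "cmod (e x - 1) \<le> 2 * pi * \<bar>x\<bar>"
proof -
  have "cmod (e x - 1) = 2 * \<bar>sin (2 * pi * x / 2)\<bar>"
    unfolding e_eq_cis cis_conv_exp by (metis dist_exp_i_1)
  also have "\<dots> \<le> 2 * \<bar>2 * pi * x / 2\<bar>"
    by (intro mult_left_mono abs_sin_x_le_abs_x) auto
  finally show ?thesis by (simp add: abs_mult)
qed

lemma norm_e_diff_le: "cmod (e x - e y) \<le> 2 * pi * \<bar>x - y\<bar>"
proof -
  have "e x - e y = e y * (e (x - y) - 1)"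
    by (simp add: algebra_simps flip: e_add)
  then show ?thesis using norm_e_minus_1_le[of "x - y"] by (simp add: norm_mult)
qed

text \<open>The Ramanujan sum \<open>c\<^sub>p(n)\<close>, for prime \<open>p\<close>.\<close>

definition ramanujan :: "nat \<Rightarrow> nat \<Rightarrow> real" where
  "ramanujan p n = (if p dvd n then real p - 1 else - 1)"

lemma abs_ramanujan_le: "2 \<le> p \<Longrightarrow> \<bar>ramanujan p n\<bar> \<le> real p"
  by (auto simp: ramanujan_def)

lemma ramanujan_mult: "prime p \<Longrightarrow> \<not> p dvd d \<Longrightarrow> ramanujan p (d * m) = ramanujan p m"
  by (auto simp: ramanujan_def prime_dvd_mult_iff)

text \<open>A full period sums to zero; what remains is minus \<open>n mod p\<close>.\<close>

lemma abs_sum_ramanujan_le: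
  assumes "0 < p"
  shows "\<bar>\<Sum>m=1..n. ramanujan p m\<bar> \<le> real p"
proof -
  have "(\<Sum>m=1..n. ramanujan p m) = (\<Sum>m=1..n. if p dvd m then real p else 0) - real n"
    by (induction n) (auto simp: ramanujan_def)
  also have "(\<Sum>m=1..n. if p dvd m then real p else 0) = (\<Sum>m | m \<in> {1..n} \<and> p dvd m. real p)"
    by (subst sum.inter_filter[symmetric]) auto
  also have "\<dots> = real p * real (n div p)"
    using assms by (subst sum_multiples) auto
  also have "\<dots> - real n = - real (n mod p)"
  proof -
    have "real n = real p * real (n div p) + real (n mod p)"
      by (metis mult_div_mod_eq of_nat_add of_nat_mult)
    then show ?thesis by simp
  qed
  finally show ?thesis using mod_less_divisor[OF assms, of n] by simp
qed

section \<open>The contribution of a single divisor to the twisted sum\<close>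

lemma abel_sum:
  fixes a z :: "nat \<Rightarrow> complex"
  shows "(\<Sum>m=1..n. a m * z m) = (\<Sum>m=1..n. a m) * z n - (\<Sum>j=1..<n. (\<Sum>m=1..j. a m) * (z (Suc j) - z j))"
proof (induction n)
  case (Suc n)
  then show ?case by (cases n) (auto simp: algebra_simps)
qed auto

lemma norm_abel_sum_le:
  fixes a z :: "nat \<Rightarrow> complex"
  assumes A: "\<And>j. cmod (\<Sum>m=1..j. a m) \<le> A" and z: "\<And>j. cmod (z j) \<le> 1"
    and v: "\<And>j. cmod (z (Suc j) - z j) \<le> v"
  shows "cmod (\<Sum>m=1..n. a m * z m) \<le> A * (1 + real n * v)"
proof -
  have A0: "0 \<le> A" using A[of 0] by simp
  have v0: "0 \<le> v" using v[of 0] norm_ge_zero order.trans by blast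
  have "cmod (\<Sum>m=1..n. a m * z m) \<le> cmod ((\<Sum>m=1..n. a m) * z n)
      + cmod (\<Sum>j=1..<n. (\<Sum>m=1..j. a m) * (z (Suc j) - z j))"
    unfolding abel_sum by (rule norm_triangle_ineq4)
  also have "\<dots> \<le> A * 1 + (\<Sum>j=1..<n. A * v)"
    unfolding norm_mult
  proof (intro add_mono order.trans[OF norm_sum] sum_mono)
    show "cmod (\<Sum>m=1..n. a m) * cmod (z n) \<le> A * 1" by (intro mult_mono A z A0) auto
    show "cmod ((\<Sum>m=1..j. a m) * (z (Suc j) - z j)) \<le> A * v" for j
      unfolding norm_mult by (intro mult_mono A v A0) auto
  qed
  also have "\<dots> = A * (1 + real (n - 1) * v)" by (simp add: algebra_simps)
  also have "\<dots> \<le> A * (1 + real n * v)"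
    using A0 v0 by (intro mult_left_mono add_left_mono mult_right_mono) auto
  finally show ?thesis .
qed

text \<open>The part of the twisted sum over the multiples \<open>n = d * m\<close> of
  \<open>d\<close>, to be weighted with \<open>h d\<close>.\<close>

definition twist :: "nat \<Rightarrow> nat \<Rightarrow> real \<Rightarrow> nat \<Rightarrow> complex" where
  "twist p N \<beta> d = (\<Sum>m=1..N div d. of_real (ramanujan p (d * m)) * e (real (d * m) * \<beta>))"

lemma div_mult_le_real: "real (N div d) * real d \<le> real N"
  by (metis of_nat_le_iff of_nat_mult div_times_less_eq_dividend)

lemma two_pi_over_1000: "2 * pi / 1000 \<le> 1/100"
  using pi_less_4 by simp

text \<open>For \<open>d\<close> prime to \<open>p\<close> the twist by \<open>d\<close> drops out
  of the Ramanujan sum, so partial sums are bounded by \<open>p\<close>. The phase varies by at most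
  \<open>2 * pi * \<beta> * N \<le> 1/100\<close> over the whole range, so partial summation costs
  next to nothing.\<close>

lemma norm_twist_le_prime:
  assumes p: "prime p" "\<not> p dvd d" and \<beta>: "0 \<le> \<beta>" "\<beta> * real N \<le> 1/1000"
  shows "cmod (twist p N \<beta> d) \<le> 101/100 * real p"
proof -
  have "cmod (twist p N \<beta> d) = cmod (\<Sum>m=1..N div d. of_real (ramanujan p m) * e (real (d * m) * \<beta>))"
    using p by (simp add: twist_def ramanujan_mult)
  also have "\<dots> \<le> real p * (1 + real (N div d) * (2 * pi * (real d * \<beta>)))"
  proof (rule norm_abel_sum_le)
    fix j
    show "cmod (\<Sum>m=1..j. of_real (ramanujan p m)) \<le> real p"
      using abs_sum_ramanujan_le[of p j] p by (simp add: prime_gt_0_nat flip: of_real_sum)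
    have "real (d * Suc j) * \<beta> - real (d * j) * \<beta> = real d * \<beta>" by (simp add: algebra_simps)
    then show "cmod (e (real (d * Suc j) * \<beta>) - e (real (d * j) * \<beta>)) \<le> 2 * pi * (real d * \<beta>)"
      using norm_e_diff_le[of "real (d * Suc j) * \<beta>" "real (d * j) * \<beta>"] \<beta> by simp
  qed auto
  also have "\<dots> = real p * (1 + 2 * pi * (real (N div d) * real d * \<beta>))" by (simp add: algebra_simps)
  also have "\<dots> \<le> real p * (1 + 2 * pi * (1/1000))"
  proof (intro mult_left_mono add_left_mono)
    have "real (N div d) * real d * \<beta> \<le> real N * \<beta>"
      using \<beta> by (intro mult_right_mono div_mult_le_real)
    then show "real (N div d) * real d * \<beta> \<le> 1/1000" using \<beta> by (simp add: mult.commute)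
  qed auto
  also have "\<dots> \<le> real p * (101/100)" using two_pi_over_1000 by (intro mult_left_mono) auto
  finally show ?thesis by simp
qed

text \<open>If \<open>N div d < p\<close>, no \<open>m\<close> in the range is divisible by
  \<open>p\<close> and all summands have modulus 1, so even the trivial bound has no factor
  \<open>p\<close>. Otherwise \<open>p \<le> N/d\<close>, and the bound by \<open>p\<close>
  suffices.\<close>

lemma norm_twist_le_quotient:
  assumes p: "prime p" "\<not> p dvd d" and \<beta>: "0 \<le> \<beta>" "\<beta> * real N \<le> 1/1000" and d: "0 < d"
  shows "cmod (twist p N \<beta> d) \<le> 101/100 * (real N / real d)"
proof (cases "N div d < p")
  case True
  have "cmod (twist p N \<beta> d) \<le> (\<Sum>m=1..N div d. cmod (of_real (ramanujan p (d * m)) * e (real (d * m) * \<beta>)))"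
    unfolding twist_def by (rule norm_sum)
  also have "\<dots> = (\<Sum>m=1..N div d. 1)"
  proof (rule sum.cong)
    fix m assume "m \<in> {1..N div d}"
    then have "\<not> p dvd m" using True by (auto dest!: dvd_imp_le)
    then show "cmod (of_real (ramanujan p (d * m)) * e (real (d * m) * \<beta>)) = 1"
      using p by (simp add: norm_mult ramanujan_mult) (simp add: ramanujan_def)
  qed auto
  also have "\<dots> = real (N div d)" by simp
  also have "\<dots> \<le> real N / real d" by (rule of_nat_div_le_of_nat)
  also have "real N / real d \<le> 101/100 * (real N / real d)"
    using mult_right_mono[of 1 "101/100" "real N / real d"] by simp
  finally show ?thesis .
next
  case False
  have "cmod (twist p N \<beta> d) \<le> 101/100 * real p" by (rule norm_twist_le_prime) fact+
  also have "\<dots> \<le> 101/100 * real (N div d)" using False by simp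
  also have "\<dots> \<le> 101/100 * (real N / real d)" by (intro mult_left_mono of_nat_div_le_of_nat) auto
  finally show ?thesis .
qed

lemma norm_twist_le_multiple:
  assumes p: "prime p"
  shows "cmod (twist p N \<beta> d) \<le> real p * real N / real d"
proof -
  have "cmod (twist p N \<beta> d) \<le> (\<Sum>m=1..N div d. real p)"
    unfolding twist_def using prime_ge_2_nat[OF p]
    by (intro order.trans[OF norm_sum] sum_mono) (simp add: norm_mult abs_ramanujan_le)
  also have "\<dots> = real p * real (N div d)" by simp
  also have "\<dots> \<le> real p * (real N / real d)" by (intro mult_left_mono of_nat_div_le_of_nat) auto
  finally show ?thesis by simp
qed

text \<open>The main term: every \<open>m\<close> gets the full weight \<open>p - 1\<close>, and all
  phases are within 1/100 of 1. The size conditions on \<open>p\<close> limit the loss from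
  \<open>p - 1\<close> and from rounding in \<open>N div p\<close> to one part in a thousand
  each.\<close>

lemma norm_twist_prime_ge:
  assumes p: "prime p" "1000 \<le> p" "1000 * real p \<le> real N" and \<beta>: "0 \<le> \<beta>" "\<beta> * real N \<le> 1/1000"
  shows "98/100 * real N \<le> cmod (twist p N \<beta> p)"
proof -
  have p0: "0 < p" using p prime_gt_0_nat by blast
  let ?E = "\<Sum>m=1..N div p. e (real (p * m) * \<beta>)"
  have "twist p N \<beta> p = of_real (real p - 1) * ?E"
    by (simp add: twist_def ramanujan_def sum_distrib_left)
  then have "cmod (twist p N \<beta> p) = (real p - 1) * cmod ?E"
    using p by (simp only: norm_mult norm_of_real)
  moreover have "99/100 * real (N div p) \<le> cmod ?E"
  proof -
    have "99/100 * real (N div p) = (\<Sum>m=1..N div p. 99/100)" by simp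
    also have "\<dots> \<le> (\<Sum>m=1..N div p. Re (e (real (p * m) * \<beta>)))"
    proof (rule sum_mono)
      fix m assume m: "m \<in> {1..N div p}"
      have "real (p * m) \<le> real (p * (N div p))" using m by (intro of_nat_mono mult_left_mono) auto
      also have "\<dots> \<le> real N" using div_mult_le_real[of N p] by (simp add: mult.commute)
      finally have "real (p * m) * \<beta> \<le> real N * \<beta>" using \<beta> by (intro mult_right_mono) auto
      then have "2 * pi * \<bar>real (p * m) * \<beta>\<bar> \<le> 2 * pi * (1/1000)"
        using \<beta> by (intro mult_left_mono) (auto simp: mult.commute)
      then have "cmod (e (real (p * m) * \<beta>) - 1) \<le> 1/100"
        using norm_e_minus_1_le[of "real (p * m) * \<beta>"] two_pi_over_1000 by linarith
      moreover have "\<bar>Re (e (real (p * m) * \<beta>) - 1)\<bar> \<le> cmod (e (real (p * m) * \<beta>) - 1)"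
        by (rule abs_Re_le_cmod)
      ultimately show "99/100 \<le> Re (e (real (p * m) * \<beta>))" by simp
    qed
    also have "\<dots> = Re ?E" by simp
    also have "\<dots> \<le> cmod ?E" by (rule complex_Re_le_cmod)
    finally show ?thesis .
  qed
  ultimately have "(real p - 1) * (99/100 * real (N div p)) \<le> cmod (twist p N \<beta> p)"
    using p by (simp add: mult_left_mono)
  moreover have "(999/1000 * real p) * (99/100 * (999/1000 * (real N / real p)))
      \<le> (real p - 1) * (99/100 * real (N div p))"
  proof (intro mult_mono)
    show "999/1000 * (real N / real p) \<le> real (N div p)"
    proof -
      have "1000 \<le> real N / real p" using p p0 by (simp add: field_simps)
      then show ?thesis using real_div_gt[OF p0, of N] by linarith
    qed
  qed (use p in auto)
  moreover have "(999/1000 * real p) * (99/100 * (999/1000 * (real N / real p))) = 999/1000 * 99/100 * 999/1000 * real N"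
    using p0 by simp
  ultimately show ?thesis by simp
qed

text \<open>\<open>F\<close> is left arbitrary since two choices occur: the Ramanujan twist near
  \<open>a/p\<close> and an integral transform near zero.\<close>

lemma sum_divisor_sum_eq:
  fixes F :: "nat \<Rightarrow> complex" and h :: "nat \<Rightarrow> real"
  shows "(\<Sum>n=1..N. of_real (\<Sum>d | d dvd n. h d) * F n) = (\<Sum>d=1..N. of_real (h d) * (\<Sum>m=1..N div d. F (d * m)))"
proof -
  have "(\<Sum>n=1..N. of_real (\<Sum>d | d dvd n. h d) * F n) = (\<Sum>n=1..N. \<Sum>d=1..N. if d dvd n then of_real (h d) * F n else 0)"
  proof (rule sum.cong)
    fix n assume n: "n \<in> {1..N}"
    have "{d. d dvd n} = {d\<in>{1..N}. d dvd n}"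
      using n by (auto dest: dvd_imp_le intro: dvd_pos_nat simp: Suc_le_eq)
    then show "of_real (\<Sum>d | d dvd n. h d) * F n = (\<Sum>d=1..N. if d dvd n then of_real (h d) * F n else 0)"
      by (simp only: of_real_sum sum_distrib_right flip: sum.inter_filter[OF finite_atLeastAtMost])
  qed auto
  also have "\<dots> = (\<Sum>d=1..N. \<Sum>n=1..N. if d dvd n then of_real (h d) * F n else 0)" by (rule sum.swap)
  also have "\<dots> = (\<Sum>d=1..N. of_real (h d) * (\<Sum>m=1..N div d. F (d * m)))"
  proof (rule sum.cong)
    fix d assume d: "d \<in> {1..N}"
    have "(\<Sum>n=1..N. if d dvd n then of_real (h d) * F n else 0) = (\<Sum>n | n \<in> {1..N} \<and> d dvd n. of_real (h d) * F n)"
      by (subst sum.inter_filter[symmetric]) auto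
    also have "\<dots> = (\<Sum>m=1..N div d. of_real (h d) * F (d * m))"
      using d by (intro sum_multiples) auto
    finally show "(\<Sum>n=1..N. if d dvd n then of_real (h d) * F n else 0) = of_real (h d) * (\<Sum>m=1..N div d. F (d * m))"
      by (simp add: sum_distrib_left)
  qed auto
  finally show ?thesis .
qed

lemma sum_Un_le:
  fixes y :: "nat \<Rightarrow> real"
  assumes "finite A" "finite B" "\<And>x. 0 \<le> y x"
  shows "sum y (A \<union> B) \<le> sum y A + sum y B"
proof -
  have "sum y (A \<union> B) + sum y (A \<inter> B) = sum y A + sum y B"
    using assms by (intro sum.union_inter) auto
  moreover have "0 \<le> sum y (A \<inter> B)" using assms by (intro sum_nonneg) auto
  ultimately show ?thesis by linarith
qed

context prime_weights
begin

lemma abs_h_eq: "0 < d \<Longrightarrow> \<bar>h d\<bar> = g d * real d"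
  by (simp add: g_def)

lemma abs_h_prime: "prime q \<Longrightarrow> \<bar>h q\<bar> = \<rho>"
  using mult_fun_prime_power[of q 1 \<eta>] eta_1 by simp

text \<open>The divisors \<open>d \<noteq> p\<close> fall into five classes, one per error term:
  multiples of \<open>p\<close>, where there is no cancellation; \<open>d \<le> D\<close>; composite
  \<open>d > D\<close>; primes up to \<open>E\<close>; primes beyond \<open>E\<close>. The second
  and fourth use the bound by \<open>p\<close> for each \<open>d\<close>, the third and fifth the
  bound by \<open>N/d\<close>.\<close>

lemma twisted_sum_ge_aux:
  assumes p: "prime p" "1000 \<le> p" "1000 * real p \<le> real N" and \<beta>: "0 \<le> \<beta>" "\<beta> * real N \<le> 1/1000"
    and D: "1 < D" and E: "1 \<le> E" "E \<le> real N"
    and S: "\<And>A::nat set. finite A \<Longrightarrow> (\<Sum>m\<in>A. ln (real m) / (real m)\<^sup>2) \<le> S"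
  shows "\<rho> * (98/100 * real N)
     - real p * real N * (\<rho> / real p * (Z N - 1) + Z N * (14 * \<rho> / (real p)\<^sup>2))
     - 101/100 * real p * D * Z N
     - 101/100 * real N * ((\<rho> * (Z N - 1) * (ln (real N) + mertens_const) + 14 * \<rho> * Z N * S) / ln D)
     - 101/100 * real p * \<rho> * E
     - 101/100 * real N * \<rho> * (\<Sum>q\<in>primes_upto (real N) - primes_upto E. 1 / real q)
    \<le> cmod (\<Sum>n=1..N. of_real (\<Sum>d | d dvd n. h d) * (of_real (ramanujan p n) * e (real n * \<beta>)))"
    (is "?main - ?b1 - ?b2 - ?b3 - ?b4 - ?b5 \<le> _")
proof -
  have N1: "1 \<le> N" "p \<le> N" and p0: "0 < p" using p by auto
  define y where "y d = \<bar>h d\<bar> * cmod (twist p N \<beta> d)" for d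
  have y0: "0 \<le> y d" for d by (simp add: y_def)
  let ?S1 = "{d. d \<in> {1..N} \<and> p dvd d \<and> d \<noteq> p}"
  let ?S2 = "{d. d \<in> {1..N} \<and> \<not> p dvd d \<and> real d \<le> D}"
  let ?S3 = "{d. d \<in> {1..N} \<and> \<not> p dvd d \<and> \<not> prime d \<and> D < real d}"
  let ?S4 = "{d. d \<in> {1..N} \<and> \<not> p dvd d \<and> prime d \<and> real d \<le> E}"
  let ?S5 = "{d. d \<in> {1..N} \<and> \<not> p dvd d \<and> prime d \<and> E < real d}"
  have b1: "sum y ?S1 \<le> ?b1"
  proof -
    have "sum y ?S1 \<le> (\<Sum>d\<in>?S1. real p * real N * g d)"
    proof (rule sum_mono)
      fix d assume d: "d \<in> ?S1"
      have "y d \<le> \<bar>h d\<bar> * (real p * real N / real d)"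
        unfolding y_def using norm_twist_le_multiple[OF p(1)] by (intro mult_left_mono) auto
      then show "y d \<le> real p * real N * g d" by (simp add: g_def algebra_simps)
    qed
    also have "\<dots> = real p * real N * sum g ?S1" by (simp add: sum_distrib_left)
    also have "\<dots> \<le> ?b1" by (intro mult_left_mono sum_proper_multiples_le p N1) auto
    finally show ?thesis .
  qed
  have b2: "sum y ?S2 \<le> ?b2"
  proof -
    have "sum y ?S2 \<le> (\<Sum>d\<in>?S2. 101/100 * real p * D * g d)"
    proof (rule sum_mono)
      fix d assume d: "d \<in> ?S2"
      have "y d \<le> (g d * D) * (101/100 * real p)"
        unfolding y_def using norm_twist_le_prime[OF p(1) _ \<beta>, of d] d D
        by (intro mult_mono) (auto simp: abs_h_eq g_nonneg intro!: mult_left_mono)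
      then show "y d \<le> 101/100 * real p * D * g d" by (simp add: algebra_simps)
    qed
    also have "\<dots> = 101/100 * real p * D * sum g ?S2" by (simp add: sum_distrib_left)
    also have "\<dots> \<le> ?b2"
      unfolding Z_def using D by (intro mult_left_mono sum_mono2) (auto simp: g_nonneg)
    finally show ?thesis .
  qed
  have b3: "sum y ?S3 \<le> ?b3"
  proof -
    have "sum y ?S3 \<le> (\<Sum>d\<in>?S3. 101/100 * real N * g d)"
    proof (rule sum_mono)
      fix d assume d: "d \<in> ?S3"
      have "y d \<le> \<bar>h d\<bar> * (101/100 * (real N / real d))"
        unfolding y_def using norm_twist_le_quotient[OF p(1) _ \<beta>, of d] d by (intro mult_left_mono) auto
      then show "y d \<le> 101/100 * real N * g d" by (simp add: g_def algebra_simps)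
    qed
    also have "\<dots> = 101/100 * real N * sum g ?S3" by (simp add: sum_distrib_left)
    also have "\<dots> \<le> 101/100 * real N * sum g {d. d \<in> {1..N} \<and> \<not> prime d \<and> D < real d}"
      by (intro mult_left_mono sum_mono2) (auto simp: g_nonneg)
    also have "\<dots> \<le> ?b3" by (intro mult_left_mono sum_composite_le N1 D S) auto
    finally show ?thesis .
  qed
  have b4: "sum y ?S4 \<le> ?b4"
  proof -
    have "sum y ?S4 \<le> (\<Sum>d\<in>?S4. \<rho> * (101/100 * real p))"
    proof (rule sum_mono)
      fix d assume d: "d \<in> ?S4"
      show "y d \<le> \<rho> * (101/100 * real p)"
        unfolding y_def using norm_twist_le_prime[OF p(1) _ \<beta>, of d] d rho_pos
        by (intro mult_mono) (auto simp: abs_h_prime)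
    qed
    also have "\<dots> = real (card ?S4) * (\<rho> * (101/100 * real p))" by simp
    also have "\<dots> \<le> E * (\<rho> * (101/100 * real p))"
    proof (intro mult_right_mono)
      have "card ?S4 \<le> card {1..nat \<lfloor>E\<rfloor>}" by (intro card_mono) (auto simp: le_nat_floor)
      also have "\<dots> \<le> nat \<lfloor>E\<rfloor>" by simp
      finally show "real (card ?S4) \<le> E" using E by linarith
    qed (use rho_pos in auto)
    finally show ?thesis by (simp add: algebra_simps)
  qed
  have b5: "sum y ?S5 \<le> ?b5"
  proof -
    have "sum y ?S5 \<le> (\<Sum>d\<in>?S5. 101/100 * real N * \<rho> * (1 / real d))"
    proof (rule sum_mono)
      fix d assume d: "d \<in> ?S5"
      have "y d \<le> \<rho> * (101/100 * (real N / real d))"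
        unfolding y_def using norm_twist_le_quotient[OF p(1) _ \<beta>, of d] d rho_pos
        by (intro mult_mono) (auto simp: abs_h_prime)
      then show "y d \<le> 101/100 * real N * \<rho> * (1 / real d)" by (simp add: algebra_simps)
    qed
    also have "\<dots> = 101/100 * real N * \<rho> * (\<Sum>d\<in>?S5. 1 / real d)" by (simp add: sum_distrib_left)
    also have "\<dots> \<le> ?b5"
      using rho_pos by (intro mult_left_mono sum_mono2) (auto simp: primes_upto_def intro!: finite_Diff finite_primes_upto[unfolded primes_upto_def])
    finally show ?thesis .
  qed
  \<comment> \<open>The classes overlap, as a prime up to \<open>D\<close> belongs to the second and
    also to the fourth or fifth. Since the terms are nonnegative, a covering is enough.\<close>
  have "sum y ({1..N} - {p}) \<le> sum y (?S1 \<union> (?S2 \<union> (?S3 \<union> (?S4 \<union> ?S5))))"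
  proof (rule sum_mono2)
    show "{1..N} - {p} \<subseteq> ?S1 \<union> (?S2 \<union> (?S3 \<union> (?S4 \<union> ?S5)))"
    proof
      fix d assume "d \<in> {1..N} - {p}"
      then show "d \<in> ?S1 \<union> (?S2 \<union> (?S3 \<union> (?S4 \<union> ?S5)))"
        by (cases "p dvd d"; cases "prime d"; cases "real d \<le> D"; cases "real d \<le> E") simp_all
    qed
  qed (simp_all add: y0)
  also have "\<dots> \<le> sum y ?S1 + (sum y ?S2 + (sum y ?S3 + (sum y ?S4 + sum y ?S5)))"
  proof -
    have fin: "finite {d. d \<in> {1..N} \<and> P d}" for P by simp
    note U = sum_Un_le[where y = y, OF _ _ y0]
    have "sum y (?S4 \<union> ?S5) \<le> sum y ?S4 + sum y ?S5" by (intro U fin)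
    moreover have "sum y (?S3 \<union> (?S4 \<union> ?S5)) \<le> sum y ?S3 + sum y (?S4 \<union> ?S5)" by (intro U fin finite_UnI)
    moreover have "sum y (?S2 \<union> (?S3 \<union> (?S4 \<union> ?S5))) \<le> sum y ?S2 + sum y (?S3 \<union> (?S4 \<union> ?S5))"
      by (intro U fin finite_UnI)
    moreover have "sum y (?S1 \<union> (?S2 \<union> (?S3 \<union> (?S4 \<union> ?S5)))) \<le> sum y ?S1 + sum y (?S2 \<union> (?S3 \<union> (?S4 \<union> ?S5)))"
      by (intro U fin finite_UnI)
    ultimately show ?thesis by linarith
  qed
  finally have err: "sum y ({1..N} - {p}) \<le> ?b1 + ?b2 + ?b3 + ?b4 + ?b5"
    using b1 b2 b3 b4 b5 by linarith
  have "(\<Sum>n=1..N. of_real (\<Sum>d | d dvd n. h d) * (of_real (ramanujan p n) * e (real n * \<beta>))) =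
      (\<Sum>d=1..N. of_real (h d) * twist p N \<beta> d)"
    unfolding twist_def by (rule sum_divisor_sum_eq)
  also have "\<dots> = of_real (h p) * twist p N \<beta> p + (\<Sum>d\<in>{1..N} - {p}. of_real (h d) * twist p N \<beta> d)"
    using N1 p0 by (intro sum.remove) auto
  finally have "cmod (\<Sum>n=1..N. of_real (\<Sum>d | d dvd n. h d) * (of_real (ramanujan p n) * e (real n * \<beta>)))
      \<ge> cmod (of_real (h p) * twist p N \<beta> p) - cmod (\<Sum>d\<in>{1..N} - {p}. of_real (h d) * twist p N \<beta> d)"
    by (simp add: norm_diff_ineq)
  moreover have "cmod (\<Sum>d\<in>{1..N} - {p}. of_real (h d) * twist p N \<beta> d) \<le> sum y ({1..N} - {p})"
    by (intro order.trans[OF norm_sum]) (simp add: norm_mult y_def)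
  moreover have "?main \<le> cmod (of_real (h p) * twist p N \<beta> p)"
    unfolding norm_mult norm_of_real abs_h_prime[OF p(1)] using rho_pos
    by (intro mult_left_mono norm_twist_prime_ge p \<beta>) auto
  ultimately show ?thesis using err by linarith
qed

end

lemma sqrt_mult_powr: "0 < x \<Longrightarrow> sqrt x * x powr s = x * x powr (s - 1/2)"
  using powr_diff[of x s "1/2"] by (simp only: powr_half_sqrt) (simp add: field_simps)

context prime_weights
begin

text \<open>The only error term that is not small compared with \<open>\<rho>N\<close> is that of the primes
  \<open>q > N powr (49/100)\<close>. Splitting them at \<open>N powr (3/4)\<close> shows that \<open>\<Sum> 1/q\<close> is below \<open>0.865\<close>.\<close>

lemma twisted_sum_ge:
  assumes p: "prime p" "10000 \<le> p" "real p \<le> sqrt (real N) / 4" and \<beta>: "0 \<le> \<beta>" "\<beta> * real N \<le> 1/1000"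
    and S: "\<And>A::nat set. finite A \<Longrightarrow> (\<Sum>m\<in>A. ln (real m) / (real m)\<^sup>2) \<le> S"
    and Z: "Z N - 1 \<le> 1/500" and L: "10000 * mertens_const \<le> ln (real N)" "10000 * S \<le> ln (real N)"
    and N1: "real N powr (-1/4) \<le> \<rho> / 1000" and N2: "real N powr (-1/100) \<le> 1/1000"
  shows "\<rho> * real N / 20
    \<le> cmod (\<Sum>n=1..N. of_real (\<Sum>d | d dvd n. h d) * (of_real (ramanujan p n) * e (real n * \<beta>)))"
proof -
  let ?x = "real N" and ?l = "ln (real N)"
  \<comment> \<open>\<open>D\<close> has to be a power of \<open>N\<close> to keep
    \<open>ln N / ln D\<close> bounded, while \<open>p * D\<close> must be small against
    \<open>\<rho> * N\<close>. \<open>E\<close> is taken just short of \<open>sqrt N\<close>: then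
    \<open>p * E\<close> is at most \<open>N powr (99/100) / 4\<close>, and the primes left over are
    as few as possible.\<close>
  define D where "D = ?x powr (1/4)"
  define E where "E = ?x powr (49/100)"
  define E2 where "E2 = ?x powr (3/4)"
  have S0: "0 \<le> S" using S[of "{}"] by simp
  have l: "10000 \<le> ?l" using L mertens_const_ge_1 by linarith
  have x1: "1 < ?x"
  proof (rule ccontr)
    assume "\<not> 1 < ?x"
    then have "?l \<le> 0" by (cases "N = 0") auto
    then show False using l by simp
  qed
  have p0: "0 < real p" using p by simp
  have sq: "4 * real p \<le> sqrt ?x" "sqrt ?x * sqrt ?x = ?x" using p x1 by auto
  have "40000 \<le> sqrt ?x" using sq p by linarith
  then have "4 * real p * 40000 \<le> sqrt ?x * sqrt ?x" using sq p0 by (intro mult_mono) auto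
  then have px: "1000 * real p \<le> ?x" using sq p0 by simp
  have lD: "ln D = ?l / 4" and lE: "ln E = 49/100 * ?l" and lE2: "ln E2 = 3/4 * ?l"
    using x1 by (simp_all add: D_def E_def E2_def ln_powr)
  have D1: "1 < D" using x1 by (simp add: D_def gr_one_powr)
  have E: "1 < E" "E \<le> E2" "E2 \<le> ?x" "1 < E2"
    using x1 powr_mono[of "3/4" 1 ?x] by (auto simp: E_def E2_def gr_one_powr intro!: powr_mono)
  have ZN: "1 \<le> Z N" "Z N \<le> 501/500" using Z Z_ge_1[of N] x1 by auto
  have rx: "0 < \<rho> * ?x" using rho_pos x1 by simp
  have c1: "real p * ?x * (\<rho> / real p * (Z N - 1) + Z N * (14 * \<rho> / (real p)\<^sup>2)) \<le> 35/10000 * (\<rho> * ?x)"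
  proof -
    have "real p * ?x * (\<rho> / real p * (Z N - 1) + Z N * (14 * \<rho> / (real p)\<^sup>2)) = (\<rho> * ?x) * ((Z N - 1) + 14 * Z N / real p)"
      using p0 by (simp add: field_simps power2_eq_square)
    also have "\<dots> \<le> (\<rho> * ?x) * (35/10000)"
    proof (intro mult_left_mono)
      have "14 * Z N / real p \<le> 14 * (501/500) / 10000" using p ZN by (intro frac_le) auto
      then show "(Z N - 1) + 14 * Z N / real p \<le> 35/10000" using Z by simp
    qed (use rx in simp)
    finally show ?thesis by simp
  qed
  have c2: "101/100 * real p * D * Z N \<le> 3/10000 * (\<rho> * ?x)"
  proof -
    have "101/100 * real p * D * Z N \<le> 101/100 * (sqrt ?x / 4) * D * (501/500)"
      using p ZN D1 by (intro mult_mono) auto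
    also have "\<dots> \<le> 3/10 * (sqrt ?x * D)" using D1 by simp
    also have "sqrt ?x * D = ?x * ?x powr (-1/4)"
      using sqrt_mult_powr[of ?x "1/4"] x1 by (simp add: D_def)
    also have "\<dots> \<le> ?x * (\<rho> / 1000)" using N1 by (intro mult_left_mono) auto
    finally show ?thesis by (simp add: mult.commute)
  qed
  have c3: "101/100 * ?x * ((\<rho> * (Z N - 1) * (?l + mertens_const) + 14 * \<rho> * Z N * S) / ln D) \<le> 14/1000 * (\<rho> * ?x)"
  proof -
    have "(Z N - 1) * (?l + mertens_const) \<le> 1/500 * (10001/10000 * ?l)"
      using Z ZN L l mertens_const_ge_1 by (intro mult_mono) auto
    moreover have "14 * Z N * S \<le> 14 * (501/500) * (?l / 10000)"
      using ZN L S0 by (intro mult_mono) auto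
    moreover define W where "W = (Z N - 1) * (?l + mertens_const) + 14 * Z N * S"
    moreover define B where "B = \<rho> * ?x"
    ultimately have W: "W \<le> 3404/1000000 * ?l" using l by linarith
    have B: "0 < B" using rx by (simp add: B_def)
    have "W / (?l / 4) \<le> 3404/1000000 * ?l / (?l / 4)" using W l by (intro divide_right_mono) auto
    also have "\<dots> = 13616/1000000" using l by simp
    finally have "101/100 * B * (W / (?l / 4)) \<le> 101/100 * B * (13616/1000000)"
      using B by (intro mult_left_mono) auto
    also have "\<dots> \<le> 14/1000 * B" using B by simp
    also have "101/100 * B * (W / (?l / 4)) = 101/100 * ?x * ((\<rho> * (Z N - 1) * (?l + mertens_const) + 14 * \<rho> * Z N * S) / ln D)"
      unfolding lD W_def B_def by (simp add: algebra_simps)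
    finally show ?thesis by (simp add: B_def)
  qed
  have c4: "101/100 * real p * \<rho> * E \<le> 3/10000 * (\<rho> * ?x)"
  proof -
    have "101/100 * real p * \<rho> * E \<le> 101/100 * (sqrt ?x / 4) * \<rho> * E"
      using p rho_pos E by (intro mult_mono) auto
    also have "\<dots> = 101/400 * \<rho> * (sqrt ?x * E)" by simp
    also have "sqrt ?x * E = ?x * ?x powr (-1/100)"
      using sqrt_mult_powr[of ?x "49/100"] x1 by (simp add: E_def)
    also have "101/400 * \<rho> * (?x * ?x powr (-1/100)) \<le> 101/400 * \<rho> * (?x * (1/1000))"
      using N2 rho_pos by (intro mult_left_mono) auto
    finally show ?thesis using rx by simp
  qed
  have c5: "101/100 * ?x * \<rho> * (\<Sum>q\<in>primes_upto ?x - primes_upto E. 1 / real q) \<le> 874/1000 * (\<rho> * ?x)"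
  proof -
    \<comment> \<open>A single block would give about 51/49, which exceeds the main term; two blocks
      give about 1/3 + 26/49.\<close>
    have split: "primes_upto ?x - primes_upto E = (primes_upto ?x - primes_upto E2) \<union> (primes_upto E2 - primes_upto E)"
      using primes_upto_mono[OF E(2)] primes_upto_mono[OF E(3)] by blast
    have "(\<Sum>q\<in>primes_upto ?x - primes_upto E. 1 / real q) =
        (\<Sum>q\<in>primes_upto ?x - primes_upto E2. 1 / real q) + (\<Sum>q\<in>primes_upto E2 - primes_upto E. 1 / real q)"
      unfolding split by (intro sum.union_disjoint) auto
    also have "\<dots> \<le> (ln (?x / E2) + 2 * mertens_const) / ln E2 + (ln (E2 / E) + 2 * mertens_const) / ln E"
      using E by (intro add_mono sum_inverse_primes_block_le) auto
    also have "\<dots> \<le> (2502/10000 * ?l) / (3/4 * ?l) + (2602/10000 * ?l) / (49/100 * ?l)"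
    proof (intro add_mono)
      have "ln (?x / E2) = ?l / 4" "ln (E2 / E) = 26/100 * ?l"
        using x1 E lE lE2 by (simp_all add: ln_div)
      then show "(ln (?x / E2) + 2 * mertens_const) / ln E2 \<le> (2502/10000 * ?l) / (3/4 * ?l)"
        "(ln (E2 / E) + 2 * mertens_const) / ln E \<le> (2602/10000 * ?l) / (49/100 * ?l)"
        unfolding lE lE2 using L l by (intro divide_right_mono; linarith)+
    qed
    also have "\<dots> \<le> 865/1000" using l by simp
    finally have "101/100 * (\<rho> * ?x) * (\<Sum>q\<in>primes_upto ?x - primes_upto E. 1 / real q) \<le> 101/100 * (\<rho> * ?x) * (865/1000)"
      using rx by (intro mult_left_mono) auto
    then show ?thesis using rx by (simp add: mult_ac)
  qed
  \<comment> \<open>The balance is about 0.088, so 1/20 is safe.\<close>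
  have "\<rho> * (98/100 * ?x) - 35/10000 * (\<rho> * ?x) - 3/10000 * (\<rho> * ?x) - 14/1000 * (\<rho> * ?x) - 3/10000 * (\<rho> * ?x) - 874/1000 * (\<rho> * ?x)
      \<ge> \<rho> * ?x / 20" using rx by simp
  moreover have "E \<le> ?x" using E by linarith
  ultimately show ?thesis
    using twisted_sum_ge_aux[OF p(1) _ px \<beta> D1 less_imp_le[OF E(1)] _ S] p(2) c1 c2 c3 c4 c5 by linarith
qed

end

section \<open>Minor arcs near fractions with prime denominator\<close>

lemma e_of_int [simp]: "e (of_int k) = 1"
  by (simp add: e_eq_cis cis_multiple_2pi)

lemma e_eq_1_iff: "e x = 1 \<longleftrightarrow> x \<in> \<int>"
proof
  assume "e x = 1"
  then have "exp (\<i> * complex_of_real (2 * pi * x)) = 1" by (simp add: e_eq_cis cis_conv_exp)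
  then obtain k :: int where k: "2 * pi * x = of_int (2 * k) * pi"
    by (auto simp: exp_eq_1)
  then have "x = of_int k" by simp
  then show "x \<in> \<int>" by simp
qed (auto elim!: Ints_cases)

text \<open>The geometric sum over all residues modulo \<open>p\<close>, less the term
  \<open>a = 0\<close>; for prime \<open>p\<close> the rest are exactly the reduced
  residues.\<close>

lemma sum_e_residues:
  assumes p: "prime p"
  shows "(\<Sum>a=1..<p. e (real n * (real a / real p))) = of_real (ramanujan p n)"
proof -
  have p0: "0 < p" using p prime_gt_0_nat by blast
  define z where "z = e (real n / real p)"
  have pow: "e (real n * (real a / real p)) = z ^ a" for a
    by (simp add: z_def e_power mult.commute)
  have zp: "z ^ p = 1"
    using e_of_int[of "int n"] p0 by (simp add: z_def e_power)
  have "real n / real p \<in> \<int> \<longleftrightarrow> p dvd n"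
  proof
    assume "real n / real p \<in> \<int>"
    then obtain k :: int where k: "real n / real p = of_int k" by (auto elim: Ints_cases)
    then have "of_int (int n) = (of_int (k * int p) :: real)" using p0 by (simp add: field_simps)
    then have "int n = k * int p" by (simp only: of_int_eq_iff)
    then have "int p dvd int n" by simp
    then show "p dvd n" by simp
  next
    assume "p dvd n"
    then show "real n / real p \<in> \<int>" using p0 by (auto elim!: dvdE)
  qed
  then have z1: "z = 1 \<longleftrightarrow> p dvd n" by (simp add: z_def e_eq_1_iff)
  have "(\<Sum>a=1..<p. z ^ a) = (\<Sum>a<p. z ^ a) - 1"
    using p0 by (simp add: sum.atLeast_Suc_lessThan lessThan_atLeast0)
  also have "(\<Sum>a<p. z ^ a) = (if p dvd n then of_nat p else 0)"
    using z1 zp by (auto simp: geometric_sum)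
  finally show ?thesis unfolding pow by (auto simp: ramanujan_def)
qed

lemma sum_exp_sum_residues_ge:
  assumes p: "prime p"
  shows "(cmod (\<Sum>n=1..N. f n * (of_real (ramanujan p n) * e (real n * \<beta>))))\<^sup>2 / real p
    \<le> (\<Sum>a=1..<p. (cmod (exp_sum f N (real a / real p + \<beta>)))\<^sup>2)"
proof -
  have p0: "0 < p" using p prime_gt_0_nat by blast
  have "(\<Sum>n=1..N. f n * (of_real (ramanujan p n) * e (real n * \<beta>))) =
      (\<Sum>n=1..N. \<Sum>a=1..<p. f n * e (real n * (real a / real p + \<beta>)))"
    by (simp add: sum_e_residues[OF p, symmetric] sum_distrib_left sum_distrib_right distrib_left e_add)
  also have "\<dots> = (\<Sum>a=1..<p. exp_sum f N (real a / real p + \<beta>))"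
    unfolding exp_sum_def by (rule sum.swap)
  finally have "cmod (\<Sum>n=1..N. f n * (of_real (ramanujan p n) * e (real n * \<beta>))) \<le>
      (\<Sum>a=1..<p. cmod (exp_sum f N (real a / real p + \<beta>)))"
    by (simp only:) (rule norm_sum)
  then have "(cmod (\<Sum>n=1..N. f n * (of_real (ramanujan p n) * e (real n * \<beta>))))\<^sup>2 \<le>
      (\<Sum>a=1..<p. cmod (exp_sum f N (real a / real p + \<beta>)))\<^sup>2"
    by (intro power_mono) auto
  also have "\<dots> \<le> (\<Sum>a=1..<p. (cmod (exp_sum f N (real a / real p + \<beta>)))\<^sup>2) * real (card {1..<p})"
    by (rule sum_squared_le_sum_of_squares)
  also have "\<dots> \<le> (\<Sum>a=1..<p. (cmod (exp_sum f N (real a / real p + \<beta>)))\<^sup>2) * real p"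
    by (intro mult_left_mono sum_nonneg) auto
  finally show ?thesis using p0 by (simp add: field_simps)
qed

section \<open>Measurability of the minor arcs and reduction to integrals over intervals\<close>

lemma continuous_on_e [continuous_intros]:
  "continuous_on A f \<Longrightarrow> continuous_on A (\<lambda>x. e (f x))"
  unfolding e_def by (intro continuous_intros)

lemma continuous_on_exp_sum: "continuous_on A (exp_sum f N)"
  unfolding exp_sum_def by (intro continuous_intros)

text \<open>A countable union of closed balls, from which measurability follows.\<close>

lemma major_arcs_eq_UN:
  "major_arcs K Q0 Q = (\<Union>q\<in>{q::nat. 0 < q \<and> real q \<le> K * Q0}. \<Union>a\<in>{a::int. coprime a (int q)}.
     cball (of_int a / real q) (K / (real q * Q)))"
  unfolding major_arcs_def by (auto simp: dist_real_def abs_minus_commute) blast+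

lemma minor_arcs_borel [measurable]: "minor_arcs K Q0 Q \<in> sets borel"
  unfolding minor_arcs_def major_arcs_eq_UN
  by (intro borel_comp sets.countable_UN'' countableI_type borel_closed closed_cball)

text \<open>Positivity of the integrand permits discarding the rest of the minor arcs. The summands
  are gauge integrals, so the calculus for \<open>integral\<close> is available from here
  on.\<close>

lemma circle_integral_ge_sum:
  fixes l u :: "'j \<Rightarrow> real"
  assumes F: "continuous_on UNIV F" "\<And>\<theta>. 0 \<le> F \<theta>"
    and J: "finite J" "\<And>j. j \<in> J \<Longrightarrow> {l j..u j} \<subseteq> minor_arcs K Q0 Q \<inter> {0..<1}"
    and disj: "disjoint_family_on (\<lambda>j. {l j..u j}) J"
  shows "(\<Sum>j\<in>J. integral {l j..u j} F) \<le> circle_integral (minor_arcs K Q0 Q) F"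
proof -
  let ?A = "minor_arcs K Q0 Q \<inter> {0..<1}"
  have int_box: "set_integrable lborel {a..b} F" for a b :: real
    by (rule borel_integrable_atLeastAtMost') (rule continuous_on_subset[OF F(1)], simp)
  have intA: "set_integrable lborel ?A F"
    by (rule set_integrable_subset[OF int_box[of 0 1]]) auto
  let ?U = "\<Union>j\<in>J. {l j..u j}"
  have UA: "x \<in> ?A" if "x \<in> ?U" for x using J(2) that by blast
  then have "?U \<subseteq> {0..1}" by fastforce
  then have intU: "set_integrable lborel ?U F"
    using J(1) by (intro set_integrable_subset[OF int_box[of 0 1]]) auto
  have "(\<Sum>j\<in>J. integral {l j..u j} F) = (\<Sum>j\<in>J. LINT \<theta>:{l j..u j}|lborel. F \<theta>)"
    by (intro sum.cong refl set_borel_integral_eq_integral(2)[symmetric] int_box)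
  also have "\<dots> = (LINT \<theta>:?U|lborel. F \<theta>)"
    using J disj by (intro set_integral_finite_Union[symmetric] int_box) auto
  also have "\<dots> \<le> (LINT \<theta>:?A|lborel. F \<theta>)"
    unfolding set_lebesgue_integral_def
  proof (rule integral_mono)
    show "integrable lborel (\<lambda>x. indicator ?U x *\<^sub>R F x)" using intU by (simp add: set_integrable_def)
    show "integrable lborel (\<lambda>x. indicator ?A x *\<^sub>R F x)" using intA by (simp add: set_integrable_def)
    show "indicator ?U x *\<^sub>R F x \<le> indicator ?A x *\<^sub>R F x" for x
      using UA[of x] F(2)[of x] by (cases "x \<in> ?U") (simp_all add: indicator_def)
  qed
  finally show ?thesis by (simp add: circle_integral_def)
qed

lemma fraction_dist_ge:
  fixes a a' :: int and p q :: nat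
  assumes "0 < p" "0 < q" "a * int q \<noteq> a' * int p"
  shows "1 / (real p * real q) \<le> \<bar>of_int a / real p - of_int a' / real q\<bar>"
proof -
  have "1 \<le> \<bar>a * int q - a' * int p\<bar>" using assms(3) by linarith
  then have "1 \<le> \<bar>of_int (a * int q - a' * int p) :: real\<bar>" by linarith
  also have "\<bar>of_int (a * int q - a' * int p) :: real\<bar> = \<bar>of_int a / real p - of_int a' / real q\<bar> * (real p * real q)"
  proof -
    have "of_int (a * int q - a' * int p) = (of_int a / real p - of_int a' / real q) * (real p * real q)"
      using assms(1,2) by (simp add: field_simps)
    then show ?thesis by (simp only: abs_mult abs_of_nat)
  qed
  finally show ?thesis using assms by (simp add: field_simps)
qed

text \<open>The points near \<open>a/p\<close> at distance about \<open>1/N\<close>, for primes \<open>p\<close> between \<open>N/Q\<close> and \<open>sqrt N\<close>: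
  too far from \<open>a/p\<close> for the major arc at \<open>a/p\<close>, and too close to it for any other one.\<close>

lemma prime_arc_minor:
  assumes p: "prime p" "4 * real p \<le> sqrt (real N)" "2000 * K * real N / Q < real p"
    and a: "0 < a" "a < p" and K: "0 < K" "0 < Q" "K * sqrt (real N) \<le> Q" "K * Q0 \<le> sqrt (real N)"
    and \<beta>: "1 / (2000 * real N) \<le> \<beta>" "\<beta> \<le> 1 / (1000 * real N)"
  shows "real a / real p + \<beta> \<in> minor_arcs K Q0 Q"
proof -
  have p0: "0 < real p" using p prime_gt_0_nat by auto
  have s0: "0 < sqrt (real N)" using p p0 by linarith
  then have N0: "0 < real N" by simp
  have ss: "sqrt (real N) * sqrt (real N) = real N" by simp
  have \<beta>0: "0 < \<beta>" using \<beta> N0 by (smt (verit) divide_pos_pos)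
  have False if q: "0 < q" "real q \<le> K * Q0" "coprime b (int q)"
    and *: "\<bar>real a / real p + \<beta> - of_int b / real q\<bar> \<le> K / (real q * Q)" for q :: nat and b :: int
  proof (cases "int a * int q = b * int p")
    case False
    \<comment> \<open>Different fractions are \<open>1/(p * q)\<close> apart. After multiplication
      by \<open>p * q\<close>, the width of the major arc contributes at most 1/4 because
      \<open>4 * p \<le> sqrt N \<le> Q/K\<close>, and \<beta> contributes at most 1/4000 because
      \<open>q \<le> sqrt N\<close>.\<close>
    have "1 / (real p * real q) \<le> \<bar>of_int (int a) / real p - of_int b / real q\<bar>"
      using False p0 q by (intro fraction_dist_ge) auto
    also have "\<dots> \<le> K / (real q * Q) + \<beta>" using * \<beta>0 by simp
    finally have "1 / (real p * real q) * (real p * real q) \<le> (K / (real q * Q) + \<beta>) * (real p * real q)"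
      by (intro mult_right_mono) auto
    moreover have "(K / (real q * Q) + \<beta>) * (real p * real q) = K * real p / Q + \<beta> * (real p * real q)"
      using q by (simp add: distrib_right)
    moreover have "1 / (real p * real q) * (real p * real q) = 1" using p0 q by simp
    ultimately have "1 \<le> K * real p / Q + \<beta> * (real p * real q)" by simp
    moreover have "K * real p / Q \<le> 1/4"
    proof -
      have "K * (4 * real p) \<le> K * sqrt (real N)" using p K by (intro mult_left_mono) auto
      also have "\<dots> \<le> Q" by fact
      finally show ?thesis using K by (simp add: field_simps)
    qed
    moreover have "\<beta> * (real p * real q) \<le> 1/4"
    proof -
      have "\<beta> * (real p * real q) \<le> 1 / (1000 * real N) * ((sqrt (real N) / 4) * sqrt (real N))"
        using \<beta> \<beta>0 p q K N0 by (intro mult_mono) auto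
      also have "\<dots> = 1/4000" using N0 ss by (simp add: field_simps)
      finally show ?thesis by simp
    qed
    ultimately show False by simp
  next
    case True
    \<comment> \<open>Both fractions are in lowest terms, so \<open>q = p\<close> and \<beta> alone
      is the distance. The factor 2000 in the lower bound for \<open>p\<close> is the one in the
      lower bound for \<beta>.\<close>
    have "\<not> p dvd a" using a by (auto dest!: dvd_imp_le)
    then have "coprime p a" using p by (simp add: prime_imp_coprime)
    moreover have "int p dvd int a * int q" using True by simp
    then have "p dvd a * q" by (metis int_dvd_int_iff of_nat_mult)
    ultimately have "p dvd q" by (simp add: coprime_dvd_mult_right_iff)
    moreover have "int q dvd b * int p" using True by (metis dvd_triv_right)
    then have "int q dvd int p" using q(3) by (simp add: coprime_commute coprime_dvd_mult_right_iff)
    then have "q dvd p" by simp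
    ultimately have "q = p" by (simp add: dvd_antisym)
    then have "real a / real p = of_int b / real q" using True p0
      by (simp add: field_simps)
    then have "\<bar>of_int b / real q + \<beta> - of_int b / real q\<bar> \<le> K / (real q * Q)" using * by (simp only:)
    then have "\<bar>\<beta>\<bar> \<le> K / (real q * Q)" by simp
    then have "\<beta> \<le> K / (real p * Q)" using \<open>q = p\<close> by simp
    then have "1 / (2000 * real N) \<le> K / (real p * Q)" using \<beta> by linarith
    then have "real p \<le> 2000 * K * real N / Q" using p0 K N0 by (simp add: field_simps)
    then show False using p by simp
  qed
  then show ?thesis unfolding minor_arcs_def major_arcs_def by blast
qed

text \<open>Distinct fractions with denominators up to \<open>sqrt N / 4\<close> are at least
  \<open>16/N\<close> apart, while the shifts are at most \<open>1/(1000 * N)\<close>.\<close>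

lemma prime_arcs_disjoint:
  fixes p p' a a' :: nat
  assumes p: "prime p" "prime p'" and a: "0 < a" "a < p" "0 < a'" "a' < p'"
    and s: "4 * real p \<le> sqrt (real N)" "4 * real p' \<le> sqrt (real N)"
    and \<beta>: "0 \<le> \<beta>" "\<beta> \<le> 1 / (1000 * real N)" "0 \<le> \<beta>'" "\<beta>' \<le> 1 / (1000 * real N)"
    and eq: "real a / real p + \<beta> = real a' / real p' + \<beta>'"
  shows "p = p' \<and> a = a'"
proof (rule ccontr)
  assume ne: "\<not> (p = p' \<and> a = a')"
  have p0: "0 < p" "0 < p'" using p prime_gt_0_nat by auto
  have "int a * int p' \<noteq> int a' * int p"
  proof
    assume "int a * int p' = int a' * int p"
    then have eq': "a * p' = a' * p" by (metis of_nat_eq_iff of_nat_mult)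
    have "\<not> p dvd a" using a by (auto dest!: dvd_imp_le)
    moreover have "p dvd a * p'" using eq' by simp
    ultimately have "p dvd p'" using p by (simp add: prime_dvd_mult_iff)
    then have "p = p'" using p by (simp add: primes_dvd_imp_eq)
    then show False using eq' ne p0 by simp
  qed
  then have "1 / (real p * real p') \<le> \<bar>of_int (int a) / real p - of_int (int a') / real p'\<bar>"
    using p0 by (intro fraction_dist_ge) auto
  also have "\<dots> \<le> 1 / (1000 * real N)" using eq \<beta> by (simp add: abs_le_iff)
  finally have "1 / (real p * real p') \<le> 1 / (1000 * real N)" .
  moreover have "4 * real p * (4 * real p') \<le> sqrt (real N) * sqrt (real N)" using s by (intro mult_mono) auto
  moreover have "0 < real N" using s p0 by (cases "N = 0") auto
  moreover have "0 < real p * real p'" using p0 by simp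
  ultimately show False by (simp add: field_simps)
qed

text \<open>For each prime the shift runs over \<open>[b, 2b]\<close> with
  \<open>b = 1/(2000 * N)\<close>. Its \<open>p - 1\<close> arcs together carry at least
  \<open>A^2/p\<close> for every shift, hence \<open>b * A^2/p\<close> after integration.\<close>

lemma integral_prime_arcs_ge:
  assumes P: "finite P" "\<And>p. p \<in> P \<Longrightarrow> prime p \<and> 4 * real p \<le> sqrt (real N) \<and> 2000 * K * real N / Q < real p"
    and K: "0 < K" "0 < Q" "K * sqrt (real N) \<le> Q" "K * Q0 \<le> sqrt (real N)" and N: "0 < N" and A: "0 \<le> A"
    and lower: "\<And>p \<beta>. p \<in> P \<Longrightarrow> 0 \<le> \<beta> \<Longrightarrow> \<beta> * real N \<le> 1/1000 \<Longrightarrow>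
      A \<le> cmod (\<Sum>n=1..N. f n * (of_real (ramanujan p n) * e (real n * \<beta>)))"
  shows "A\<^sup>2 / (2000 * real N) * (\<Sum>p\<in>P. 1 / real p)
    \<le> circle_integral (minor_arcs K Q0 Q) (\<lambda>\<theta>. (cmod (exp_sum f N \<theta>))\<^sup>2)"
proof -
  let ?F = "\<lambda>\<theta>. (cmod (exp_sum f N \<theta>))\<^sup>2"
  define b where "b = 1 / (2000 * real N)"
  have b: "0 < b" "2 * b = 1 / (1000 * real N)" using N by (auto simp: b_def)
  have contF: "continuous_on X ?F" for X by (intro continuous_intros continuous_on_exp_sum)
  define J where "J = (SIGMA p:P. {1..<p})"
  define l where "l = (\<lambda>(p, a). real a / real p + b)"
  define u where "u = (\<lambda>(p, a). real a / real p + 2 * b)"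
  have "A\<^sup>2 / (2000 * real N) * (\<Sum>p\<in>P. 1 / real p) = (\<Sum>p\<in>P. (A\<^sup>2 / real p) * b)"
    unfolding sum_distrib_left b_def by (intro sum.cong) (simp_all add: mult.commute)
  also have "\<dots> \<le> (\<Sum>p\<in>P. \<Sum>a=1..<p. integral {l (p, a)..u (p, a)} ?F)"
  proof (rule sum_mono)
    fix p assume p: "p \<in> P"
    have "(A\<^sup>2 / real p) * b = integral {b..2*b} (\<lambda>_. A\<^sup>2 / real p)" using b by simp
    also have "\<dots> \<le> integral {b..2*b} (\<lambda>\<beta>. \<Sum>a=1..<p. ?F (real a / real p + \<beta>))"
    proof (rule integral_le)
      show "(\<lambda>_. A\<^sup>2 / real p) integrable_on {b..2*b}" by (rule integrable_const_ivl)
      show "(\<lambda>\<beta>. \<Sum>a=1..<p. ?F (real a / real p + \<beta>)) integrable_on {b..2*b}"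
        by (intro integrable_continuous_real continuous_intros continuous_on_compose2[OF continuous_on_exp_sum[of UNIV]]) auto
      fix \<beta> assume \<beta>: "\<beta> \<in> {b..2*b}"
      have "\<beta> * real N \<le> 2 * b * real N" using \<beta> by (intro mult_right_mono) auto
      then have "\<beta> * real N \<le> 1/1000" using b N by simp
      then have "A\<^sup>2 \<le> (cmod (\<Sum>n=1..N. f n * (of_real (ramanujan p n) * e (real n * \<beta>))))\<^sup>2"
        using lower[OF p, of \<beta>] \<beta> b A by (intro power_mono) auto
      then have "A\<^sup>2 / real p \<le> (cmod (\<Sum>n=1..N. f n * (of_real (ramanujan p n) * e (real n * \<beta>))))\<^sup>2 / real p"
        by (intro divide_right_mono) auto
      also have "\<dots> \<le> (\<Sum>a=1..<p. ?F (real a / real p + \<beta>))" using P p by (intro sum_exp_sum_residues_ge) auto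
      finally show "A\<^sup>2 / real p \<le> (\<Sum>a=1..<p. ?F (real a / real p + \<beta>))" .
    qed
    also have "\<dots> = (\<Sum>a=1..<p. integral {b..2*b} (\<lambda>\<beta>. ?F (real a / real p + \<beta>)))"
      by (intro integral_sum integrable_continuous_real continuous_intros
          continuous_on_compose2[OF continuous_on_exp_sum[of UNIV]]) auto
    also have "\<dots> = (\<Sum>a=1..<p. integral {l (p, a)..u (p, a)} ?F)"
    proof (rule sum.cong)
      fix a
      have "integral {b..2*b} (?F \<circ> (\<lambda>\<beta>. \<beta> + real a / real p)) = integral {b + real a / real p..2*b + real a / real p} ?F"
        by (intro integral_shift contF)
      then show "integral {b..2*b} (\<lambda>\<beta>. ?F (real a / real p + \<beta>)) = integral {l (p, a)..u (p, a)} ?F"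
        by (simp add: l_def u_def o_def add.commute)
    qed auto
    finally show "(A\<^sup>2 / real p) * b \<le> (\<Sum>a=1..<p. integral {l (p, a)..u (p, a)} ?F)" .
  qed
  also have "\<dots> = (\<Sum>j\<in>J. integral {l j..u j} ?F)"
    unfolding J_def using P by (subst sum.Sigma) auto
  also have "\<dots> \<le> circle_integral (minor_arcs K Q0 Q) ?F"
  proof (rule circle_integral_ge_sum)
    show "continuous_on UNIV ?F" by (rule contF)
    show "0 \<le> ?F \<theta>" for \<theta> by simp
    show "finite J" unfolding J_def using P by auto
    fix j assume "j \<in> J"
    then obtain p a where j: "j = (p, a)" "p \<in> P" "1 \<le> a" "a < p" by (auto simp: J_def)
    note Pp = P(2)[OF j(2)]
    show "{l j..u j} \<subseteq> minor_arcs K Q0 Q \<inter> {0..<1}"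
    proof
      fix \<theta> assume \<theta>: "\<theta> \<in> {l j..u j}"
      define \<beta> where "\<beta> = \<theta> - real a / real p"
      have \<beta>: "b \<le> \<beta>" "\<beta> \<le> 2 * b" using \<theta> by (auto simp: l_def u_def j \<beta>_def)
      have "real a / real p + \<beta> \<in> minor_arcs K Q0 Q"
        using Pp j K \<beta> b by (intro prime_arc_minor[of p N]) (auto simp: b_def)
      then have "\<theta> \<in> minor_arcs K Q0 Q" by (simp add: \<beta>_def)
      moreover have "0 \<le> \<theta>" using \<beta> b by (simp add: \<beta>_def) (smt (verit) divide_nonneg_nonneg of_nat_0_le_iff)
      moreover have "\<theta> < 1"
      proof -
        have p0: "0 < real p" using j by simp
        have "real a \<le> real p - 1" using j by linarith
        then have "real a / real p \<le> (real p - 1) / real p" using p0 by (intro divide_right_mono) auto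
        then have "real a / real p \<le> 1 - 1 / real p" using p0 by (simp add: diff_divide_distrib)
        moreover have "2 * b < 1 / real p"
        proof -
          have "4 * real p \<le> sqrt (real N)" using Pp by simp
          also have "sqrt (real N) \<le> real N" using N by (simp add: real_le_lsqrt power2_eq_square)
          finally have "real p < 1000 * real N" using p0 by simp
          then have "1 / (1000 * real N) < 1 / real p"
            using p0 by (intro divide_strict_left_mono) auto
          then show ?thesis using b by simp
        qed
        ultimately show ?thesis using \<beta> by (simp add: \<beta>_def)
      qed
      ultimately show "\<theta> \<in> minor_arcs K Q0 Q \<inter> {0..<1}" by simp
    qed
  next
    show "disjoint_family_on (\<lambda>j. {l j..u j}) J"
      unfolding disjoint_family_on_def
    proof (intro ballI impI, rule ccontr)
      fix i j assume ij: "i \<in> J" "j \<in> J" "i \<noteq> j" and "{l i..u i} \<inter> {l j..u j} \<noteq> {}"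
      then obtain \<theta> where \<theta>: "\<theta> \<in> {l i..u i}" "\<theta> \<in> {l j..u j}" by blast
      obtain p a where i: "i = (p, a)" "p \<in> P" "1 \<le> a" "a < p" using ij by (auto simp: J_def)
      obtain p' a' where j: "j = (p', a')" "p' \<in> P" "1 \<le> a'" "a' < p'" using ij by (auto simp: J_def)
      note * = i j
      have "p = p' \<and> a = a'"
        using P(2)[OF *(2)] P(2)[OF *(6)] * \<theta> b
        by (intro prime_arcs_disjoint[of p p' a a' N "\<theta> - real a / real p" "\<theta> - real a' / real p'"])
          (auto simp: l_def u_def)
      then show False using ij * by simp
    qed
  qed
  finally show ?thesis .
qed

section \<open>The minor arc near zero\<close>

lemma has_vector_derivative_cis:
  "((\<lambda>t. cis (\<omega> * t)) has_vector_derivative (\<i> * of_real \<omega> * cis (\<omega> * t))) (at t within A)"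
proof -
  have "((\<lambda>z. exp (\<i> * of_real \<omega> * z)) has_field_derivative (\<i> * of_real \<omega> * exp (\<i> * of_real \<omega> * of_real t))) (at (of_real t))"
    by (auto intro!: derivative_eq_intros)
  from has_vector_derivative_real_field[OF this, of A] show ?thesis
    by (simp add: cis_conv_exp mult.assoc)
qed

text \<open>Two integrations by parts. As \<open>f\<close> vanishes at both ends, the boundary terms
  of order \<open>1/\<omega>\<close> disappear and the bound is of order
  \<open>1/\<omega>^2\<close>.\<close>

lemma norm_oscillatory_integral_le:
  fixes f f' f'' :: "real \<Rightarrow> complex"
  assumes ac: "a \<le> c" and \<omega>: "\<omega> \<noteq> 0"
    and f: "\<And>t. t \<in> {a..c} \<Longrightarrow> (f has_vector_derivative f' t) (at t within {a..c})"
    and f': "\<And>t. t \<in> {a..c} \<Longrightarrow> (f' has_vector_derivative f'' t) (at t within {a..c})"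
    and cont: "continuous_on {a..c} f''"
    and ends: "f a = 0" "f c = 0" "cmod (f' a) \<le> M1" "cmod (f' c) \<le> M1"
    and M2: "\<And>t. t \<in> {a..c} \<Longrightarrow> cmod (f'' t) \<le> M2"
  shows "cmod (integral {a..c} (\<lambda>t. f t * cis (\<omega> * t))) \<le> (2 * M1 + M2 * (c - a)) / \<omega>\<^sup>2"
proof -
  let ?w = "complex_of_real \<omega>"
  let ?c = "\<lambda>t. cis (\<omega> * t)"
  \<comment> \<open>An explicit antiderivative of the integrand up to the remainder with
    \<open>f''\<close>; in its derivative the two terms with \<open>f'\<close> cancel.\<close>
  define G where "G t = - \<i> / ?w * (f t * ?c t) + (f' t * ?c t) / ?w\<^sup>2" for t
  have contf: "continuous_on {a..c} f"
    using f by (meson continuous_on_eq_continuous_within has_vector_derivative_continuous)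
  have G: "(G has_vector_derivative (f t * ?c t + f'' t * ?c t / ?w\<^sup>2)) (at t within {a..c})" if t: "t \<in> {a..c}" for t
  proof -
    define k where "k t = ?c t" for t
    have k: "(k has_vector_derivative (\<i> * ?w * k t)) (at t within {a..c})"
      unfolding k_def by (rule has_vector_derivative_cis)
    have "((\<lambda>t. (- \<i> / ?w) * (f t * k t) + (1 / ?w\<^sup>2) * (f' t * k t)) has_vector_derivative
        (- \<i> / ?w) * (f t * (\<i> * ?w * k t) + f' t * k t) + (1 / ?w\<^sup>2) * (f' t * (\<i> * ?w * k t) + f'' t * k t)) (at t within {a..c})"
      by (intro has_vector_derivative_add has_vector_derivative_mult_right has_vector_derivative_mult k f[OF t] f'[OF t])
    also have "(- \<i> / ?w) * (f t * (\<i> * ?w * k t) + f' t * k t) + (1 / ?w\<^sup>2) * (f' t * (\<i> * ?w * k t) + f'' t * k t) =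
        f t * k t + f'' t * k t / ?w\<^sup>2"
      using \<omega> by (simp add: field_simps power2_eq_square)
    also have "(\<lambda>t. (- \<i> / ?w) * (f t * k t) + (1 / ?w\<^sup>2) * (f' t * k t)) = G"
      by (simp add: G_def k_def fun_eq_iff)
    finally show ?thesis by (simp only: k_def)
  qed
  have "((\<lambda>t. f t * ?c t + f'' t * ?c t / ?w\<^sup>2) has_integral (G c - G a)) {a..c}"
    by (rule fundamental_theorem_of_calculus[OF ac G])
  then have I0: "integral {a..c} (\<lambda>t. f t * ?c t + f'' t * ?c t / ?w\<^sup>2) = G c - G a" by (rule integral_unique)
  have I1: "(\<lambda>t. f t * ?c t) integrable_on {a..c}"
    by (intro integrable_continuous_real continuous_intros contf)
  have I2: "(\<lambda>t. f'' t * ?c t / ?w\<^sup>2) integrable_on {a..c}"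
    using \<omega> by (intro integrable_continuous_real continuous_intros cont) auto
  have eq: "integral {a..c} (\<lambda>t. f t * ?c t) = G c - G a - integral {a..c} (\<lambda>t. f'' t * ?c t / ?w\<^sup>2)"
    using trans[OF integral_add[OF I1 I2, symmetric] I0] by (simp only: eq_diff_eq)
  have n2: "cmod (integral {a..c} (\<lambda>t. f'' t * ?c t / ?w\<^sup>2)) \<le> M2 / \<omega>\<^sup>2 * (c - a)"
  proof (rule integral_bound[OF ac])
    show "continuous_on {a..c} (\<lambda>t. f'' t * ?c t / ?w\<^sup>2)" using \<omega> by (intro continuous_intros cont) auto
    show "cmod (f'' t * ?c t / ?w\<^sup>2) \<le> M2 / \<omega>\<^sup>2" if "t \<in> {a..c}" for t
      using M2[OF that] by (simp add: norm_mult norm_divide norm_power divide_right_mono)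
  qed
  have "cmod (G c) \<le> M1 / \<omega>\<^sup>2" "cmod (G a) \<le> M1 / \<omega>\<^sup>2"
    using ends by (auto simp: G_def norm_mult norm_divide norm_power divide_right_mono)
  then have "cmod (integral {a..c} (\<lambda>t. f t * ?c t)) \<le> M1 / \<omega>\<^sup>2 + M1 / \<omega>\<^sup>2 + M2 / \<omega>\<^sup>2 * (c - a)"
    unfolding eq using n2 norm_triangle_ineq4[of "G c - G a" "integral {a..c} (\<lambda>t. f'' t * ?c t / ?w\<^sup>2)"]
      norm_triangle_ineq4[of "G c" "G a"] by linarith
  then show ?thesis by (simp add: add_divide_distrib)
qed

text \<open>The simplest weight vanishing at both ends of \<open>[b, 2b]\<close>. Its transform then
  decays like \<open>1/x^2\<close>, which makes sums over integers converge absolutely.\<close>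

definition bump :: "real \<Rightarrow> real \<Rightarrow> real" where
  "bump b t = (t - b) * (2 * b - t)"

lemma bump_nonneg: "t \<in> {b..2*b} \<Longrightarrow> 0 \<le> bump b t"
  by (simp add: bump_def)

lemma bump_le: "bump b t \<le> b\<^sup>2 / 4"
proof -
  have "0 \<le> (t - 3 / 2 * b)\<^sup>2" by simp
  then show ?thesis by (simp add: bump_def power2_eq_square algebra_simps)
qed

lemma has_integral_bump: "0 \<le> b \<Longrightarrow> (bump b has_integral (b ^ 3 / 6)) {b..2*b}"
proof -
  assume b: "0 \<le> b"
  define F where "F t = - (t ^ 3) / 3 + 3 * b * t\<^sup>2 / 2 - 2 * b\<^sup>2 * t" for t :: real
  have "(bump b has_integral (F (2 * b) - F b)) {b..2*b}"
  proof (rule fundamental_theorem_of_calculus)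
    show "(F has_vector_derivative bump b t) (at t within {b..2*b})" for t
      unfolding F_def bump_def has_real_derivative_iff_has_vector_derivative[symmetric]
      by (auto intro!: derivative_eq_intros simp: power2_eq_square algebra_simps)
  qed (use b in simp)
  also have "F (2 * b) - F b = b ^ 3 / 6"
    by (simp add: F_def power2_eq_square power3_eq_cube)
  finally show ?thesis .
qed

lemma continuous_on_bump [continuous_intros]:
  "continuous_on A f \<Longrightarrow> continuous_on A (\<lambda>t. bump b (f t))"
  unfolding bump_def by (intro continuous_intros)

lemma has_vector_derivative_bump:
  "((\<lambda>t. complex_of_real (bump b t)) has_vector_derivative of_real (3 * b - 2 * t)) (at t within A)"
  unfolding bump_def by (intro has_vector_derivative_of_real) (auto intro!: derivative_eq_intros)

lemma has_vector_derivative_bump_deriv: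
  "((\<lambda>t. complex_of_real (3 * b - 2 * t)) has_vector_derivative - 2) (at t within A)"
proof -
  have "((\<lambda>t. 3 * b - 2 * t) has_real_derivative - 2) (at t within A)"
    by (auto intro!: derivative_eq_intros)
  then show ?thesis
    using has_vector_derivative_of_real[of "\<lambda>t. 3 * b - 2 * t" "- 2"] by simp
qed

definition bump_transform :: "real \<Rightarrow> real \<Rightarrow> complex" where
  "bump_transform b x = integral {b..2*b} (\<lambda>t. of_real (bump b t) * e (x * t))"

lemma e_mult_eq_cis: "e (x * t) = cis (2 * pi * x * t)"
  by (simp add: e_eq_cis mult.assoc)

text \<open>Needed at \<open>x = N + 1\<close>, the far end of the telescoping sum.\<close>

lemma norm_bump_transform_le:
  assumes b: "0 < b" and x: "x \<noteq> 0"
  shows "cmod (bump_transform b x) \<le> b / (9 * x\<^sup>2)"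
proof -
  have "cmod (bump_transform b x) \<le> (2 * b + 2 * (2 * b - b)) / (2 * pi * x)\<^sup>2"
    unfolding bump_transform_def e_mult_eq_cis
  proof (rule norm_oscillatory_integral_le[where f' = "\<lambda>t. of_real (3 * b - 2 * t)" and f'' = "\<lambda>t. - 2"])
    show "((\<lambda>t. complex_of_real (bump b t)) has_vector_derivative of_real (3 * b - 2 * t)) (at t within {b..2*b})" for t
      by (rule has_vector_derivative_bump)
    show "((\<lambda>t. complex_of_real (3 * b - 2 * t)) has_vector_derivative - 2) (at t within {b..2*b})" for t
      by (rule has_vector_derivative_bump_deriv)
    show "cmod (complex_of_real (3 * b - 2 * b)) \<le> b" "cmod (complex_of_real (3 * b - 2 * (2 * b))) \<le> b"
      using b by (simp_all only: norm_of_real)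
  qed (use b x in \<open>auto simp: bump_def\<close>)
  also have "\<dots> = b / (pi\<^sup>2 * x\<^sup>2)" by (simp add: power_mult_distrib)
  also have "\<dots> \<le> b / (9 * x\<^sup>2)"
  proof (intro divide_left_mono mult_right_mono)
    have "3\<^sup>2 \<le> pi\<^sup>2" using pi_gt3 by (intro power_mono) auto
    then show "9 \<le> pi\<^sup>2" by simp
  qed (use b x in auto)
  finally show ?thesis .
qed

text \<open>The factor \<open>1 - e t\<close> makes the sum over consecutive integers \<open>x\<close> telescope.\<close>

definition bump_diff_transform :: "real \<Rightarrow> real \<Rightarrow> complex" where
  "bump_diff_transform b x = integral {b..2*b} (\<lambda>t. of_real (bump b t) * (1 - e t) * e (x * t))"

lemma bump_diff_transform_eq: "bump_diff_transform b x = bump_transform b x - bump_transform b (x + 1)"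
proof -
  have "bump_transform b x - bump_transform b (x + 1) =
      integral {b..2*b} (\<lambda>t. of_real (bump b t) * e (x * t) - of_real (bump b t) * e ((x + 1) * t))"
    unfolding bump_transform_def
    by (intro integral_diff[symmetric] integrable_continuous_real continuous_intros)
  then show ?thesis
    by (simp add: bump_diff_transform_def algebra_simps e_add)
qed

lemma norm_1_minus_e_le:
  assumes "0 < b" "t \<in> {b..2*b}"
  shows "cmod (1 - e t) \<le> 4 * pi * b"
proof -
  have "cmod (1 - e t) \<le> 2 * pi * \<bar>t\<bar>" using norm_e_minus_1_le[of t] by (simp add: norm_minus_commute)
  also have "\<dots> \<le> 2 * pi * (2 * b)" using assms by (intro mult_left_mono) auto
  finally show ?thesis by simp
qed

lemma norm_bump_diff_le:
  assumes "0 < b" "t \<in> {b..2*b}"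
  shows "cmod (of_real (bump b t) * (1 - e t)) \<le> 4 * b ^ 3"
proof -
  have "cmod (of_real (bump b t) * (1 - e t)) \<le> b\<^sup>2 / 4 * (4 * pi * b)"
    unfolding norm_mult using assms bump_nonneg[of t b] bump_le[of b t]
    by (intro mult_mono norm_1_minus_e_le) auto
  also have "\<dots> = pi * b ^ 3" by (simp add: power2_eq_square power3_eq_cube)
  also have "\<dots> \<le> 4 * b ^ 3" using pi_less_4 assms by (intro mult_right_mono) auto
  finally show ?thesis .
qed

lemma has_vector_derivative_e: "(e has_vector_derivative (2 * pi * \<i> * e t)) (at t within A)"
  using has_vector_derivative_cis[of "2 * pi" t A] by (simp add: e_eq_cis[abs_def] mult_ac)

text \<open>Against the plain transform the factor \<open>1 - e t\<close>, of size about
  \<open>b\<close>, gains a factor \<open>b\<close>. The second derivative has three parts, of size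
  at most \<open>8 * pi * b\<close>, \<open>4 * pi * b\<close> and, thanks to
  \<open>b \<le> 1/100\<close>, \<open>pi * b\<close>.\<close>

lemma norm_bump_diff_transform_le_decay:
  assumes b: "0 < b" "b \<le> 1/100" and x: "x \<noteq> 0"
  shows "cmod (bump_diff_transform b x) \<le> 2 * b\<^sup>2 / x\<^sup>2"
proof -
  let ?u = "\<lambda>t. complex_of_real (bump b t)"
  let ?v = "\<lambda>t. complex_of_real (3 * b - 2 * t)"
  let ?p = "2 * complex_of_real pi * \<i>"
  note du = has_vector_derivative_bump[of b] and dv = has_vector_derivative_bump_deriv[of b]
  have "cmod (bump_diff_transform b x) \<le> (2 * (4 * pi * b\<^sup>2) + 13 * pi * b * (2 * b - b)) / (2 * pi * x)\<^sup>2"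
    unfolding bump_diff_transform_def e_mult_eq_cis
  proof (rule norm_oscillatory_integral_le[where f' = "\<lambda>t. ?v t * (1 - e t) - ?u t * (?p * e t)"
        and f'' = "\<lambda>t. - 2 * (1 - e t) - 2 * (?v t * (?p * e t)) - ?u t * (?p * (?p * e t))"])
    fix t assume t: "t \<in> {b..2*b}"
    show "((\<lambda>t. ?u t * (1 - e t)) has_vector_derivative ?v t * (1 - e t) - ?u t * (?p * e t)) (at t within {b..2*b})"
      by (rule has_vector_derivative_eq_rhs, rule has_vector_derivative_mult[OF du
          has_vector_derivative_diff[OF has_vector_derivative_const has_vector_derivative_e]], simp add: algebra_simps)
    show "((\<lambda>t. ?v t * (1 - e t) - ?u t * (?p * e t)) has_vector_derivative
        - 2 * (1 - e t) - 2 * (?v t * (?p * e t)) - ?u t * (?p * (?p * e t))) (at t within {b..2*b})"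
      by (rule has_vector_derivative_eq_rhs, rule has_vector_derivative_diff[OF has_vector_derivative_mult[OF dv
          has_vector_derivative_diff[OF has_vector_derivative_const has_vector_derivative_e]]
          has_vector_derivative_mult[OF du has_vector_derivative_mult_right[OF has_vector_derivative_e]]],
        simp add: algebra_simps)
    have v: "cmod (?v t) \<le> b" using t by (simp only: norm_of_real) (simp add: abs_le_iff)
    have "cmod (?u t) \<le> b\<^sup>2 / 4" using bump_nonneg[OF t] bump_le[of b t] by simp
    then have "cmod (?u t) * (2 * pi * (2 * pi)) \<le> b\<^sup>2 / 4 * (2 * pi * (2 * pi))"
      by (intro mult_right_mono) auto
    also have "\<dots> = pi * b * (pi * b)" by (simp add: power2_eq_square)
    also have "\<dots> \<le> pi * b * 1"
      using b pi_less_4 mult_mono[of pi 4 b "1/100"] by (intro mult_left_mono) auto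
    finally have u: "cmod (?u t * (?p * (?p * e t))) \<le> pi * b" by (simp add: norm_mult)
    have "cmod (- 2 * (1 - e t) - 2 * (?v t * (?p * e t)) - ?u t * (?p * (?p * e t)))
        \<le> cmod (- 2 * (1 - e t)) + cmod (2 * (?v t * (?p * e t))) + cmod (?u t * (?p * (?p * e t)))"
      by (intro order.trans[OF norm_triangle_ineq4] add_right_mono norm_triangle_ineq4)
    also have "\<dots> \<le> 8 * pi * b + 4 * pi * b + pi * b"
    proof (intro add_mono u)
      show "cmod (- 2 * (1 - e t)) \<le> 8 * pi * b" using norm_1_minus_e_le[OF b(1) t] by (simp only: norm_mult) simp
      have "cmod (2 * (?v t * (?p * e t))) = 4 * pi * cmod (?v t)" by (simp only: norm_mult) simp
      also have "\<dots> \<le> 4 * pi * b" using v by (intro mult_left_mono) auto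
      finally show "cmod (2 * (?v t * (?p * e t))) \<le> 4 * pi * b" .
    qed
    finally show "cmod (- 2 * (1 - e t) - 2 * (?v t * (?p * e t)) - ?u t * (?p * (?p * e t))) \<le> 13 * pi * b" by simp
  next
    have "b * cmod (1 - e t) \<le> b * (4 * pi * b)" if "t \<in> {b..2*b}" for t
      using norm_1_minus_e_le[OF b(1) that] b by (intro mult_left_mono) auto
    from this[of b] this[of "2 * b"]
    show "cmod (?v b * (1 - e b) - ?u b * (?p * e b)) \<le> 4 * pi * b\<^sup>2"
      "cmod (?v (2*b) * (1 - e (2*b)) - ?u (2*b) * (?p * e (2*b))) \<le> 4 * pi * b\<^sup>2"
      using b by (auto simp: bump_def norm_mult power2_eq_square mult_ac)
  qed (use b x in \<open>auto simp: bump_def intro!: continuous_intros\<close>)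
  also have "\<dots> = 21 * b\<^sup>2 / (4 * pi * x\<^sup>2)" by (simp add: power_mult_distrib field_simps power2_eq_square)
  also have "\<dots> \<le> 21 * b\<^sup>2 / (4 * 3 * x\<^sup>2)"
    using pi_gt3 x by (intro divide_left_mono mult_right_mono mult_left_mono) auto
  also have "\<dots> \<le> 2 * b\<^sup>2 / x\<^sup>2" using x by (simp add: field_simps)
  finally show ?thesis .
qed

lemma norm_bump_diff_transform_le_trivial:
  assumes b: "0 < b"
  shows "cmod (bump_diff_transform b x) \<le> 4 * b ^ 4"
proof -
  have "cmod (bump_diff_transform b x) \<le> 4 * b ^ 3 * (2 * b - b)"
    unfolding bump_diff_transform_def
  proof (rule integral_bound)
    show "cmod (of_real (bump b t) * (1 - e t) * e (x * t)) \<le> 4 * b ^ 3" if "t \<in> {b..2*b}" for t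
      using norm_bump_diff_le[OF b that] by (simp only: norm_mult[of _ "e (x * t)"] norm_e mult_1_right)
  qed (use b in \<open>auto intro!: continuous_intros\<close>)
  then show ?thesis by (simp add: power_numeral_reduce)
qed

text \<open>The trivial bound serves for \<open>x \<le> 1/b\<close> and the decay beyond. Merging
  them into one expression prepares a sum over multiples of \<open>d\<close> that can be compared
  with a telescoping one.\<close>

lemma norm_bump_diff_transform_le:
  assumes b: "0 < b" "b \<le> 1/100" and x: "0 < x"
  shows "cmod (bump_diff_transform b x) \<le> 16 * b ^ 4 / (1 + b * x)\<^sup>2"
proof (cases "b * x \<le> 1")
  case True
  have "(1 + b * x)\<^sup>2 \<le> 2\<^sup>2" using True b x by (intro power_mono) auto
  then have "4 * b ^ 4 * (1 + b * x)\<^sup>2 \<le> 4 * b ^ 4 * 4" by (intro mult_left_mono) auto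
  moreover have "0 < 1 + b * x" using b x by (intro add_pos_pos) auto
  then have "0 < (1 + b * x)\<^sup>2" by simp
  ultimately have "4 * b ^ 4 \<le> 16 * b ^ 4 / (1 + b * x)\<^sup>2" by (simp add: field_simps)
  then show ?thesis using norm_bump_diff_transform_le_trivial[OF b(1), of x] by linarith
next
  case False
  have "(1 + b * x)\<^sup>2 \<le> (2 * (b * x))\<^sup>2" using False b x by (intro power_mono) auto
  then have "2 * b\<^sup>2 * (1 + b * x)\<^sup>2 \<le> 2 * b\<^sup>2 * (2 * (b * x))\<^sup>2" by (intro mult_left_mono) auto
  also have "\<dots> = 8 * (b ^ 4 * x\<^sup>2)" by (simp add: power_mult_distrib power_numeral_reduce)
  also have "\<dots> \<le> 16 * b ^ 4 * x\<^sup>2" by simp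
  finally have "2 * b\<^sup>2 / x\<^sup>2 \<le> 16 * b ^ 4 / (1 + b * x)\<^sup>2"
    using x b False by (simp add: field_simps)
  then show ?thesis using norm_bump_diff_transform_le_decay[OF b, of x] x by linarith
qed

text \<open>Replacing one factor of each square by its predecessor makes the sum telescope. Starting
  at \<open>m = 1\<close> matters: no summand 1 appears, so the bound keeps the form
  \<open>1/y\<close> for large \<open>y\<close> too.\<close>

lemma sum_inverse_square_le:
  assumes y: "0 < (y::real)"
  shows "(\<Sum>m=1..M. 1 / (1 + y * real m)\<^sup>2) \<le> 1 / y"
proof -
  have "(\<Sum>m=1..M. 1 / (1 + y * real m)\<^sup>2) \<le> 1 / y - 1 / (y * (1 + y * real M))"
  proof (induction M)
    case (Suc M)
    define A where "A = 1 + y * real M"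
    define B where "B = 1 + y * real (Suc M)"
    have AB: "0 < A" "B = A + y" using y by (auto simp: A_def B_def add_pos_nonneg distrib_left)
    have "1 / B\<^sup>2 \<le> 1 / (A * B)"
      using AB y by (intro divide_left_mono) (auto simp: power2_eq_square intro!: mult_right_mono)
    also have "\<dots> = (B - A) / (y * (A * B))" using AB y by simp
    also have "\<dots> = 1 / (y * A) - 1 / (y * B)"
    proof -
      have "0 < B" using AB y by linarith
      then show ?thesis using AB(1) y by (simp add: diff_divide_distrib)
    qed
    finally show ?case using Suc by (simp add: A_def B_def)
  qed simp
  also have "\<dots> \<le> 1 / y" using y by simp
  finally show ?thesis .
qed

text \<open>The factor \<open>1/d\<close>, valid for all \<open>d\<close> and not only for
  \<open>d \<le> 1/b\<close>, is what turns \<open>\<bar>h d\<bar>\<close> into the weight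
  \<open>g d\<close>.\<close>

lemma sum_norm_bump_diff_transform_le:
  assumes b: "0 < b" "b \<le> 1/100" and d: "0 < d"
  shows "(\<Sum>m=1..M. cmod (bump_diff_transform b (real (d * m)))) \<le> 16 * b ^ 3 / real d"
proof -
  have "(\<Sum>m=1..M. cmod (bump_diff_transform b (real (d * m)))) \<le> (\<Sum>m=1..M. 16 * b ^ 4 * (1 / (1 + (b * real d) * real m)\<^sup>2))"
    using b d by (intro sum_mono order.trans[OF norm_bump_diff_transform_le[OF b]]) (auto simp: mult.assoc)
  also have "\<dots> = 16 * b ^ 4 * (\<Sum>m=1..M. 1 / (1 + (b * real d) * real m)\<^sup>2)" by (simp only: sum_distrib_left)
  also have "\<dots> \<le> 16 * b ^ 4 * (1 / (b * real d))" using b d by (intro mult_left_mono sum_inverse_square_le) auto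
  also have "\<dots> = 16 * b ^ 3 / real d" using b by (simp add: power_numeral_reduce)
  finally show ?thesis .
qed

lemma Re_bump_transform_1_ge:
  assumes b: "0 < b" "b \<le> 1/100"
  shows "b ^ 3 / 12 \<le> Re (bump_transform b 1)"
proof -
  have int: "(\<lambda>t. of_real (bump b t) * e (1 * t)) integrable_on {b..2*b}"
    by (intro integrable_continuous_real continuous_intros)
  have "b ^ 3 / 12 = integral {b..2*b} (\<lambda>t. bump b t * (1/2))"
    using integral_unique[OF has_integral_mult_left[OF has_integral_bump[of b], of "1/2"]] b by simp
  also have "\<dots> \<le> integral {b..2*b} (\<lambda>t. Re (of_real (bump b t) * e (1 * t)))"
  proof (rule integral_le)
    show "(\<lambda>t. bump b t * (1/2)) integrable_on {b..2*b}" by (intro integrable_continuous_real continuous_intros)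
    show "(\<lambda>t. Re (of_real (bump b t) * e (1 * t))) integrable_on {b..2*b}"
      by (intro integrable_continuous_real continuous_intros)
    fix t assume t: "t \<in> {b..2*b}"
    have "cmod (1 - e t) \<le> 4 * pi * b" by (rule norm_1_minus_e_le) (use b t in auto)
    also have "\<dots> \<le> 4 * 4 * (1/100)" using pi_less_4 b by (intro mult_mono) auto
    finally have "cmod (1 - e t) \<le> 1/2" by simp
    then have "1/2 \<le> Re (e t)" using complex_Re_le_cmod[of "1 - e t"] by simp
    then show "bump b t * (1/2) \<le> Re (of_real (bump b t) * e (1 * t))"
      using mult_left_mono[of "1/2" "Re (e t)" "bump b t"] bump_nonneg[OF t] by simp
  qed
  also have "\<dots> = Re (bump_transform b 1)"
    unfolding bump_transform_def using integral_linear[OF int bounded_linear_Re] by (simp only: o_def)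
  finally show ?thesis .
qed

section \<open>Lower bounds for the integral over the arc near zero\<close>

context prime_weights
begin

text \<open>The divisor 1 gives a telescoping sum of size at least \<open>b^3/12 - b^3/36\<close>,
  where \<open>2 \<le> b * N\<close> makes the far end small. The other divisors cost at most
  \<open>16 * b^3 * (Z N - 1)\<close>, again below \<open>b^3/36\<close>.\<close>

lemma bump_pairing_ge:
  assumes b: "0 < b" "b \<le> 1/100" "2 \<le> b * real N" and Z: "Z N - 1 \<le> 1/1000"
  shows "b ^ 3 / 36 \<le> cmod (\<Sum>n=1..N. of_real (\<Sum>d | d dvd n. h d) * bump_diff_transform b (real n))"
proof -
  have N: "1 \<le> N" using b(3) by (cases "N = 0") auto
  have b3: "0 < b ^ 3" using b by simp
  let ?Y = "\<lambda>d. \<Sum>m=1..N div d. bump_diff_transform b (real (d * m))"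
  have "(\<Sum>n=1..N. of_real (\<Sum>d | d dvd n. h d) * bump_diff_transform b (real n)) = (\<Sum>d=1..N. of_real (h d) * ?Y d)"
    by (rule sum_divisor_sum_eq)
  also have "\<dots> = ?Y 1 + (\<Sum>d=2..N. of_real (h d) * ?Y d)"
    using N by (subst sum.atLeast_Suc_atMost) (auto simp: numeral_2_eq_2)
  finally have eq: "(\<Sum>n=1..N. of_real (\<Sum>d | d dvd n. h d) * bump_diff_transform b (real n)) = \<dots>" .
  have "?Y 1 = bump_transform b 1 - bump_transform b (real (N + 1))"
  proof -
    have "(\<Sum>m=1..M. bump_diff_transform b (real m)) = bump_transform b 1 - bump_transform b (real (M + 1))" for M
      by (induction M) (auto simp: bump_diff_transform_eq algebra_simps)
    then show ?thesis by simp
  qed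
  moreover have "cmod (bump_transform b (real (N + 1))) \<le> b ^ 3 / 36"
  proof -
    have "cmod (bump_transform b (real (N + 1))) \<le> b / (9 * (real (N + 1))\<^sup>2)"
      using b by (intro norm_bump_transform_le) auto
    also have "\<dots> \<le> b / (9 * (2 / b)\<^sup>2)"
    proof (intro divide_left_mono mult_left_mono power_mono)
      have "2 / b \<le> real N" using b by (simp add: field_simps)
      then show "2 / b \<le> real (N + 1)" by simp
    qed (use b in auto)
    also have "\<dots> = b ^ 3 / 36" using b by (simp add: power_divide power2_eq_square power3_eq_cube)
    finally show ?thesis .
  qed
  moreover have "cmod (bump_transform b 1) \<ge> b ^ 3 / 12"
    using Re_bump_transform_1_ge[OF b(1,2)] complex_Re_le_cmod[of "bump_transform b 1"] by linarith
  ultimately have main: "b ^ 3 / 12 - b ^ 3 / 36 \<le> cmod (?Y 1)"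
    using norm_triangle_ineq2[of "bump_transform b 1" "bump_transform b (real (N + 1))"] by simp
  have "cmod (\<Sum>d=2..N. of_real (h d) * ?Y d) \<le> (\<Sum>d=2..N. 16 * b ^ 3 * g d)"
  proof (intro order.trans[OF norm_sum] sum_mono)
    fix d assume d: "d \<in> {2..N}"
    have "cmod (?Y d) \<le> 16 * b ^ 3 / real d"
      using d b by (intro order.trans[OF norm_sum] sum_norm_bump_diff_transform_le) auto
    then have "\<bar>h d\<bar> * cmod (?Y d) \<le> \<bar>h d\<bar> * (16 * b ^ 3 / real d)" by (intro mult_left_mono) auto
    then show "cmod (of_real (h d) * ?Y d) \<le> 16 * b ^ 3 * g d" by (simp add: norm_mult g_def mult_ac)
  qed
  also have "\<dots> = 16 * b ^ 3 * (Z N - 1)" using N by (simp add: Z_eq sum_distrib_left)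
  also have "\<dots> \<le> 16 * b ^ 3 * (1/1000)" using Z b3 by (intro mult_left_mono) auto
  also have "\<dots> \<le> b ^ 3 / 36" using b3 by simp
  finally have "cmod (\<Sum>d=2..N. of_real (h d) * ?Y d) \<le> b ^ 3 / 36" .
  then show ?thesis
    unfolding eq using main norm_diff_ineq[of "?Y 1" "\<Sum>d=2..N. of_real (h d) * ?Y d"] by linarith
qed

text \<open>Cauchy-Schwarz in the form \<open>4 b^3 s \<le> 288 b^4 s^2 + b^2/72\<close>.\<close>

lemma integral_near_zero_ge:
  assumes b: "0 < b" "b \<le> 1/100" "2 \<le> b * real N" and Z: "Z N - 1 \<le> 1/1000"
    and f: "\<And>n. 0 < n \<Longrightarrow> f n = of_real (\<Sum>d | d dvd n. h d)"
  shows "1 / (20736 * b) \<le> integral {b..2*b} (\<lambda>\<theta>. (cmod (exp_sum f N \<theta>))\<^sup>2)"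
proof -
  let ?S = "exp_sum f N"
  let ?I = "integral {b..2*b} (\<lambda>\<theta>. (cmod (?S \<theta>))\<^sup>2)"
  have b3: "0 < b ^ 3" using b by simp
  have cont: "continuous_on {b..2*b} (\<lambda>t. of_real (bump b t) * (1 - e t) * ?S t)"
    by (intro continuous_intros continuous_on_exp_sum)
  have "(\<Sum>n=1..N. of_real (\<Sum>d | d dvd n. h d) * bump_diff_transform b (real n)) =
      (\<Sum>n=1..N. integral {b..2*b} (\<lambda>t. f n * (of_real (bump b t) * (1 - e t) * e (real n * t))))"
    by (intro sum.cong refl) (simp add: bump_diff_transform_def f)
  also have "\<dots> = integral {b..2*b} (\<lambda>t. \<Sum>n=1..N. f n * (of_real (bump b t) * (1 - e t) * e (real n * t)))"
    by (intro integral_sum[symmetric] integrable_continuous_real continuous_intros) auto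
  also have "\<dots> = integral {b..2*b} (\<lambda>t. of_real (bump b t) * (1 - e t) * ?S t)"
    by (intro integral_cong) (simp add: exp_sum_def sum_distrib_left mult_ac)
  finally have "b ^ 3 / 36 \<le> cmod (integral {b..2*b} (\<lambda>t. of_real (bump b t) * (1 - e t) * ?S t))"
    using bump_pairing_ge[OF b Z] by simp
  \<comment> \<open>The weights are balanced so that the constant term integrates to
    \<open>b^3/72\<close>, half of the lower bound.\<close>
  also have "\<dots> \<le> integral {b..2*b} (\<lambda>t. 288 * b ^ 4 * (cmod (?S t))\<^sup>2 + b\<^sup>2 / 72)"
  proof (rule integral_norm_bound_integral)
    show "(\<lambda>t. of_real (bump b t) * (1 - e t) * ?S t) integrable_on {b..2*b}"
      by (rule integrable_continuous_real[OF cont])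
    show "(\<lambda>t. 288 * b ^ 4 * (cmod (?S t))\<^sup>2 + b\<^sup>2 / 72) integrable_on {b..2*b}"
      by (intro integrable_continuous_real continuous_intros continuous_on_exp_sum)
    fix t assume t: "t \<in> {b..2*b}"
    have "cmod (of_real (bump b t) * (1 - e t) * ?S t) \<le> 4 * b ^ 3 * cmod (?S t)"
      unfolding norm_mult[of _ "?S t"] by (intro mult_right_mono norm_bump_diff_le b t) auto
    also have "\<dots> \<le> 288 * b ^ 4 * (cmod (?S t))\<^sup>2 + b\<^sup>2 / 72"
    proof -
      have "0 \<le> (144 * b\<^sup>2 * cmod (?S t) - b)\<^sup>2" by simp
      then show ?thesis by (simp add: power2_eq_square power_numeral_reduce algebra_simps)
    qed
    finally show "cmod (of_real (bump b t) * (1 - e t) * ?S t) \<le> 288 * b ^ 4 * (cmod (?S t))\<^sup>2 + b\<^sup>2 / 72" .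
  qed
  also have "\<dots> = 288 * b ^ 4 * ?I + b ^ 3 / 72"
  proof -
    have "(\<lambda>t. 288 * b ^ 4 * (cmod (?S t))\<^sup>2) integrable_on {b..2*b}" "(\<lambda>t. b\<^sup>2 / 72) integrable_on {b..2*b}"
      by (intro integrable_continuous_real continuous_intros continuous_on_exp_sum)+
    then show ?thesis using b by (simp add: integral_add power2_eq_square power3_eq_cube)
  qed
  finally have "b ^ 3 / 72 \<le> 288 * b ^ 4 * ?I" by simp
  then have "b ^ 3 * 1 \<le> b ^ 3 * (20736 * b * ?I)" by (simp add: power_numeral_reduce)
  then have "1 \<le> 20736 * b * ?I" using b3 by simp
  then show ?thesis using b by (simp add: field_simps)
qed

end

text \<open>Arcs at fractions \<open>a/q \<le> 0\<close> reach at most \<open>K/Q\<close>. A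
  positive fraction is at least \<open>1/q \<ge> 1/sqrt N\<close>, whereas membership in its arc
  would force \<open>1/q \<le> 5 * K/Q\<close>.\<close>

lemma near_zero_minor:
  assumes K: "0 < K" "0 < Q" "10 * K * sqrt (real N) \<le> Q" "K * Q0 \<le> sqrt (real N)" "1 \<le> N"
    and t: "2 * K / Q \<le> t" "t \<le> 4 * K / Q"
  shows "t \<in> minor_arcs K Q0 Q"
proof -
  have KQ: "0 < K / Q" using K by simp
  have s1: "1 \<le> sqrt (real N)" using K by simp
  have "False" if q: "0 < q" "real q \<le> K * Q0" and *: "\<bar>t - of_int a / real q\<bar> \<le> K / (real q * Q)"
    for q :: nat and a :: int
  proof -
    have "K / (real q * Q) = (K / Q) / real q" by simp
    also have "\<dots> \<le> (K / Q) / 1" using q KQ by (intro divide_left_mono) auto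
    finally have r: "K / (real q * Q) \<le> K / Q" by simp
    show False
    proof (cases "a \<le> 0")
      case True
      then have "of_int a / real q \<le> 0" by (simp add: divide_nonpos_nonneg)
      then show False using * r t KQ by (simp add: abs_le_iff)
    next
      case False
      then have "1 / real q \<le> of_int a / real q" by (intro divide_right_mono) auto
      then have "1 / real q \<le> 5 * K / Q" using * r t by (simp add: abs_le_iff)
      then have "Q \<le> 5 * K * real q" using q K by (simp add: field_simps)
      also have "\<dots> \<le> 5 * K * sqrt (real N)" using q K by (intro mult_left_mono) auto
      also have "\<dots> < 10 * K * sqrt (real N)" using K s1 by simp
      finally show False using K by simp
    qed
  qed
  then show ?thesis unfolding minor_arcs_def major_arcs_def by blast
qed

lemma (in prime_weights) circle_integral_ge_Q:
  assumes K: "1 \<le> K" "0 < Q" "10 * K * sqrt (real N) \<le> Q" "K * Q0 \<le> sqrt (real N)" "400 \<le> N" "Q \<le> real N"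
    and Z: "Z N - 1 \<le> 1/1000"
    and f: "\<And>n. 0 < n \<Longrightarrow> f n = of_real (\<Sum>d | d dvd n. h d)"
  shows "Q / (41472 * K) \<le> circle_integral (minor_arcs K Q0 Q) (\<lambda>\<theta>. (cmod (exp_sum f N \<theta>))\<^sup>2)"
proof -
  \<comment> \<open>With this choice \<open>Q \<ge> 10 * K * sqrt N \<ge> 200 * K\<close> gives
    \<open>b \<le> 1/100\<close>, and \<open>Q \<le> N\<close> gives
    \<open>2 \<le> b * N\<close>.\<close>
  define b where "b = 2 * K / Q"
  have "20 \<le> sqrt (real N)" using K(5) by (intro real_le_rsqrt) auto
  then have "10 * K * 20 \<le> 10 * K * sqrt (real N)" using K by (intro mult_left_mono) auto
  then have "200 * K \<le> Q" using K by linarith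
  then have b: "0 < b" "b \<le> 1/100" using K by (auto simp: b_def field_simps)
  have "2 * Q \<le> 2 * K * real N" using K by (intro mult_mono) auto
  then have bN: "2 \<le> b * real N" using K by (simp add: b_def field_simps)
  have "Q / (41472 * K) = 1 / (20736 * b)" using K by (simp add: b_def)
  also have "\<dots> \<le> integral {b..2*b} (\<lambda>\<theta>. (cmod (exp_sum f N \<theta>))\<^sup>2)"
    by (rule integral_near_zero_ge[OF b bN Z f])
  also have "\<dots> = (\<Sum>j\<in>{()}. integral {b..2*b} (\<lambda>\<theta>. (cmod (exp_sum f N \<theta>))\<^sup>2))" by simp
  also have "\<dots> \<le> circle_integral (minor_arcs K Q0 Q) (\<lambda>\<theta>. (cmod (exp_sum f N \<theta>))\<^sup>2)"
  proof (rule circle_integral_ge_sum)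
    show "continuous_on UNIV (\<lambda>\<theta>. (cmod (exp_sum f N \<theta>))\<^sup>2)" by (intro continuous_intros continuous_on_exp_sum)
    show "{b..2*b} \<subseteq> minor_arcs K Q0 Q \<inter> {0..<1}"
    proof
      fix t assume t: "t \<in> {b..2*b}"
      then have "t \<in> minor_arcs K Q0 Q" using K by (intro near_zero_minor[of K Q N]) (auto simp: b_def)
      then show "t \<in> minor_arcs K Q0 Q \<inter> {0..<1}" using t b by simp
    qed
  qed (auto simp: disjoint_family_on_def)
  finally show ?thesis .
qed

section \<open>Conclusion\<close>

text \<open>Each step raises the endpoint to the power \<open>1 + d\<close>. The condition on
  \<open>z\<close> bounds the Mertens error by a quarter of the gain \<open>d * ln x\<close>, so a
  block yields at least \<open>3/4 * d / (1 + d)\<close>, more than \<open>d/4\<close>.\<close>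

lemma sum_inverse_primes_tower_ge:
  assumes z: "1 < z" and d: "0 < d" "d \<le> 1" and M: "8 * mertens_const / d \<le> ln z"
  shows "real J * (d / 4) \<le> (\<Sum>p\<in>primes_upto (z powr ((1 + d) ^ J)) - primes_upto z. 1 / real p)"
proof (induction J)
  case (Suc J)
  define x where "x = z powr ((1 + d) ^ J)"
  define y where "y = z powr ((1 + d) ^ Suc J)"
  have e1: "1 \<le> (1 + d) ^ J" using d by simp
  have zx: "z \<le> x" using powr_mono[of 1 "(1 + d) ^ J" z] z e1 by (simp add: x_def)
  have xy: "x \<le> y" unfolding x_def y_def using z d by (intro powr_mono) (auto simp: mult_right_mono)
  have lx: "ln x = (1 + d) ^ J * ln z" "ln y = (1 + d) * ln x" using z by (auto simp: x_def y_def ln_powr)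
  have lnx: "ln z \<le> ln x" using zx z by simp
  have lz: "0 < ln z" using z by simp
  have split: "primes_upto y - primes_upto z = (primes_upto y - primes_upto x) \<union> (primes_upto x - primes_upto z)"
    using primes_upto_mono[OF xy] primes_upto_mono[OF zx] by blast
  have "d / 4 \<le> (ln (y / x) - 2 * mertens_const) / ln y"
  proof -
    have "ln (y / x) = d * ln x" using z zx xy lx by (simp add: ln_div algebra_simps)
    moreover have "8 * mertens_const \<le> d * ln x"
    proof -
      have "8 * mertens_const \<le> d * ln z" using M d by (simp add: field_simps)
      also have "\<dots> \<le> d * ln x" using lnx d by simp
      finally show ?thesis .
    qed
    moreover have "d / 4 * ((1 + d) * ln x) \<le> d / 4 * (2 * ln x)"
      using d lnx lz by (intro mult_left_mono mult_right_mono) auto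
    ultimately have "d / 4 * ln y \<le> ln (y / x) - 2 * mertens_const" unfolding lx(2) using mertens_const_ge_1 by linarith
    moreover have "0 < ln y" using lx d lnx lz by (simp add: add_pos_pos)
    ultimately show ?thesis by (simp add: pos_le_divide_eq)
  qed
  also have "\<dots> \<le> (\<Sum>p\<in>primes_upto y - primes_upto x. 1 / real p)"
    using z zx xy by (intro sum_inverse_primes_block_ge) auto
  finally have "real (Suc J) * (d / 4) \<le> (\<Sum>p\<in>primes_upto y - primes_upto x. 1 / real p)
      + (\<Sum>p\<in>primes_upto x - primes_upto z. 1 / real p)"
    using Suc by (simp add: x_def algebra_simps)
  also have "\<dots> = (\<Sum>p\<in>primes_upto y - primes_upto z. 1 / real p)"
    unfolding split by (intro sum.union_disjoint[symmetric]) auto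
  finally show ?case by (simp add: y_def)
qed (use z in simp)

text \<open>As many steps of the tower as fit below \<open>y\<close>. At least one fits, so rounding
  down costs at most a factor 2, and \<open>ln (1 + d) \<le> d\<close> removes \<open>d\<close> from
  the final constant.\<close>

lemma sum_inverse_primes_ge:
  assumes z: "1 < z" and d: "0 < d" "d \<le> 1" and M: "8 * mertens_const / d \<le> ln z"
    and y: "(1 + d) * ln z \<le> ln y" "0 < y"
  shows "ln (ln y / ln z) / 8 \<le> (\<Sum>p\<in>primes_upto y - primes_upto z. 1 / real p)"
proof -
  have lz: "0 < ln z" using z by simp
  define r where "r = ln y / ln z"
  have r: "1 + d \<le> r" using y lz by (simp add: r_def pos_le_divide_eq)
  have ld: "0 < ln (1 + d)" "ln (1 + d) \<le> d" using d ln_le_minus_one[of "1 + d"] by auto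
  have lr: "ln (1 + d) \<le> ln r" using r d by simp
  then have lr0: "0 \<le> ln r" using ld by linarith
  define J where "J = nat \<lfloor>ln r / ln (1 + d)\<rfloor>"
  have "1 \<le> ln r / ln (1 + d)" using lr ld by (simp add: pos_le_divide_eq)
  then have "1 \<le> \<lfloor>ln r / ln (1 + d)\<rfloor>" by (simp only: one_le_floor)
  then have J: "real J \<le> ln r / ln (1 + d)" "ln r / ln (1 + d) \<le> 2 * real J"
    using floor_correct[of "ln r / ln (1 + d)"] unfolding J_def by linarith+
  have "ln r / 8 = ln r / d * (d / 8)" using d by simp
  also have "\<dots> \<le> ln r / ln (1 + d) * (d / 8)"
    using ld lr0 d by (intro mult_right_mono divide_left_mono) auto
  also have "\<dots> \<le> 2 * real J * (d / 8)" using J d by (intro mult_right_mono) auto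
  also have "\<dots> = real J * (d / 4)" by simp
  also have "\<dots> \<le> (\<Sum>p\<in>primes_upto (z powr ((1 + d) ^ J)) - primes_upto z. 1 / real p)"
    by (rule sum_inverse_primes_tower_ge) fact+
  also have "\<dots> \<le> (\<Sum>p\<in>primes_upto y - primes_upto z. 1 / real p)"
  proof (intro sum_mono2 Diff_mono primes_upto_mono)
    have "ln ((1 + d) ^ J) = real J * ln (1 + d)" using d by (simp add: ln_realpow)
    also have "\<dots> \<le> ln r" using J ld by (simp add: pos_le_divide_eq)
    finally have "(1 + d) ^ J \<le> r" using r d by (subst (asm) ln_le_cancel_iff) auto
    then have "ln (z powr ((1 + d) ^ J)) \<le> ln y" using lz z by (simp add: ln_powr r_def pos_le_divide_eq)
    then show "z powr ((1 + d) ^ J) \<le> y" using z y by (subst (asm) ln_le_cancel_iff) auto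
  qed auto
  finally show ?thesis by (simp add: r_def)
qed

lemma (in prime_weights) circle_integral_ge_primes:
  assumes S: "\<And>A::nat set. finite A \<Longrightarrow> (\<Sum>m\<in>A. ln (real m) / (real m)\<^sup>2) \<le> S"
    and Z: "Z N - 1 \<le> 1/500" and L: "10000 * mertens_const \<le> ln (real N)" "10000 * S \<le> ln (real N)"
    and N: "real N powr (-1/4) \<le> \<rho> / 1000" "real N powr (-1/100) \<le> 1/1000" "0 < N"
    and K: "0 < K" "0 < Q" "K * sqrt (real N) \<le> Q" "K * Q0 \<le> sqrt (real N)"
    and z: "10000 \<le> z" "2000 * K * real N / Q \<le> z"
    and f: "\<And>n. 0 < n \<Longrightarrow> f n = of_real (\<Sum>d | d dvd n. h d)"
  shows "\<rho>\<^sup>2 * real N / 800000 * (\<Sum>p\<in>primes_upto (sqrt (real N) / 4) - primes_upto z. 1 / real p)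
    \<le> circle_integral (minor_arcs K Q0 Q) (\<lambda>\<theta>. (cmod (exp_sum f N \<theta>))\<^sup>2)"
proof -
  \<comment> \<open>The constant is \<open>20^2 * 2000\<close>, from the lower bound for the twisted
    sum and the length of the arcs.\<close>
  have "\<rho>\<^sup>2 * real N / 800000 = (\<rho> * real N / 20)\<^sup>2 / (2000 * real N)"
    using N by (simp add: power2_eq_square)
  moreover have "(\<rho> * real N / 20)\<^sup>2 / (2000 * real N) * (\<Sum>p\<in>primes_upto (sqrt (real N) / 4) - primes_upto z. 1 / real p)
    \<le> circle_integral (minor_arcs K Q0 Q) (\<lambda>\<theta>. (cmod (exp_sum f N \<theta>))\<^sup>2)"
  proof (rule integral_prime_arcs_ge)
    fix p assume p: "p \<in> primes_upto (sqrt (real N) / 4) - primes_upto z"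
    then have p': "prime p" "real p \<le> sqrt (real N) / 4" "z < real p" by (auto simp: primes_upto_def)
    then show "prime p \<and> 4 * real p \<le> sqrt (real N) \<and> 2000 * K * real N / Q < real p" using z by simp
    fix \<beta> :: real assume \<beta>: "0 \<le> \<beta>" "\<beta> * real N \<le> 1/1000"
    have "\<rho> * real N / 20 \<le> cmod (\<Sum>n=1..N. of_real (\<Sum>d | d dvd n. h d) * (of_real (ramanujan p n) * e (real n * \<beta>)))"
      using p' z by (intro twisted_sum_ge[OF _ _ _ \<beta> S Z L N(1,2)]) auto
    then show "\<rho> * real N / 20 \<le> cmod (\<Sum>n=1..N. f n * (of_real (ramanujan p n) * e (real n * \<beta>)))"
      by (simp add: f)
  qed (use K N rho_pos in auto)
  ultimately show ?thesis by simp
qed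

text \<open>The constant is \<open>8 * 5 * 2000\<close>, with 5 from
  \<open>2 * x + 3 \<le> 5 * x\<close> for \<open>x \<ge> 1\<close>. It yields
  \<open>Z N - 1 \<le> Z N / 2000\<close>, which is then solved for \<open>Z N\<close>.\<close>

lemma (in prime_weights) Z_minus_1_small:
  assumes N: "1 \<le> ln (ln (real N))" "2 \<le> N"
    and C: "80000 * (1 + 6 * mertens_const) * ln (ln (real N)) \<le> 1 / \<rho>"
  shows "Z N - 1 \<le> 1/1000"
proof -
  have m: "0 < 1 + 6 * mertens_const" using mertens_const_ge_1 by simp
  have Z1: "1 \<le> Z N" using N by (intro Z_ge_1) auto
  have C': "80000 * (1 + 6 * mertens_const) * ln (ln (real N)) * \<rho> \<le> 1" using C rho_pos by (simp add: field_simps)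
  have "8 * \<rho> * (\<Sum>q\<in>primes_upto (real N). 1 / real q) \<le> 8 * \<rho> * ((2 * ln (ln (real N)) + 3) * (1 + 6 * mertens_const))"
    using N rho_pos by (intro mult_left_mono sum_inverse_primes_le_lnln) auto
  also have "\<dots> \<le> 8 * \<rho> * ((5 * ln (ln (real N))) * (1 + 6 * mertens_const))"
    using N rho_pos m by (intro mult_left_mono mult_right_mono) auto
  also have "\<dots> = 80000 * (1 + 6 * mertens_const) * ln (ln (real N)) * \<rho> / 2000" by simp
  also have "\<dots> \<le> 1 / 2000" using C' by (intro divide_right_mono) auto
  finally have "8 * \<rho> * (\<Sum>q\<in>primes_upto (real N). 1 / real q) * Z N \<le> 1 / 2000 * Z N"
    using Z1 by (intro mult_right_mono) auto
  then show ?thesis using Z_minus_1_le[of N] N by simp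
qed

text \<open>The ratio \<open>ln N / ln (2N/Q)\<close> is compared with the one delimiting the range of primes, whose
  logarithm is bounded below by \<open>ln (1 + \<delta>)\<close>: this absorbs the constant factors.\<close>

lemma ln_ratio_le:
  fixes L u a \<delta> :: real
  assumes \<delta>: "0 < \<delta>" and a: "0 \<le> a" and L: "8 \<le> L" and u: "1/2 \<le> u" and v: "0 < v" "v \<le> u + a"
    and r: "1 + \<delta> \<le> (L / 2 - ln 4) / v"
  shows "ln (L / u) \<le> (1 + ln (4 * (1 + 2 * a)) / ln (1 + \<delta>)) * ln ((L / 2 - ln 4) / v)"
proof -
  define r where "r = (L / 2 - ln 4) / v"
  define B where "B = 4 * (1 + 2 * a)"
  have B: "4 \<le> B" using a by (simp add: B_def)
  have r1: "1 + \<delta> \<le> r" using assms by (simp add: r_def)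
  have ld: "0 < ln (1 + \<delta>)" "ln (1 + \<delta>) \<le> ln r" using r1 \<delta> by auto
  have "ln (4::real) = 2 * ln 2" using ln_realpow[of 2 2] by simp
  then have l4: "ln (4::real) \<le> 2" using ln_le_minus_one[of 2] by simp
  \<comment> \<open>The lower bound 1/2 for \<open>u\<close> turns the additive constant into a
    factor.\<close>
  have "u + a \<le> u * (1 + 2 * a)" using u a mult_right_mono[of 1 "2 * u" a] by (simp add: algebra_simps)
  then have "v * 4 \<le> u * (1 + 2 * a) * 4" using v by linarith
  then have "v * 4 \<le> u * B" by (simp add: B_def algebra_simps)
  then have "r * (v * 4) \<le> r * (u * B)" using r1 \<delta> by (intro mult_left_mono) auto
  moreover have "L / 4 \<le> L / 2 - ln 4" using L l4 by linarith
  then have "L \<le> r * (v * 4)" using v by (simp add: r_def)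
  ultimately have "L / u \<le> r * B" using u by (simp add: field_simps)
  then have "ln (L / u) \<le> ln (r * B)" using L u r1 \<delta> B by (subst ln_le_cancel_iff) (auto intro!: mult_pos_pos)
  also have "\<dots> = ln r + ln B" using r1 \<delta> B by (simp add: ln_mult)
  also have "ln B \<le> ln B / ln (1 + \<delta>) * ln r"
  proof -
    have "ln B * ln (1 + \<delta>) \<le> ln B * ln r" using ld B by (intro mult_left_mono) auto
    then show ?thesis using ld by (simp add: field_simps)
  qed
  finally show ?thesis by (simp add: r_def B_def algebra_simps)
qed

lemma sqrt_mult_le_of_ln:
  assumes "0 \<le> K" "100 \<le> ln x" "K * sqrt (x * ln x) \<le> Q" "0 \<le> x"
  shows "10 * K * sqrt x \<le> Q"
proof -
  have "10 \<le> sqrt (ln x)" using assms by (intro real_le_rsqrt) auto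
  then have "K * sqrt x * 10 \<le> K * sqrt x * sqrt (ln x)" using assms by (intro mult_left_mono) auto
  then show ?thesis using assms by (simp add: real_sqrt_mult)
qed

lemma powr_neg_le_of_ln:
  fixes x :: real
  assumes "10000 \<le> ln x" "1 \<le> x"
  shows "x powr (-1/100) \<le> 1/1000"
proof -
  have "0 < x" using assms by simp
  have "1000 \<le> 1 + ln x / 100 + (ln x / 100)\<^sup>2 / 2"
  proof -
    have "100\<^sup>2 \<le> (ln x / 100)\<^sup>2" using assms by (intro power_mono) auto
    then show ?thesis using assms by simp
  qed
  also have "\<dots> \<le> exp (ln x / 100)" using assms by (intro exp_lower_Taylor_quadratic) auto
  finally have "1 / exp (ln x / 100) \<le> 1 / 1000" by (intro divide_left_mono) auto
  moreover have "x powr (-1/100) = 1 / exp (ln x / 100)"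
    using \<open>0 < x\<close> by (simp add: powr_def exp_minus inverse_eq_divide)
  ultimately show ?thesis by simp
qed

text \<open>\<open>N\<close> large in terms of \<open>\<delta>\<close> need not be large in terms of \<open>K\<close>; for \<open>ln N < L1\<close> the bound \<open>Q/K\<close>
  alone suffices.\<close>

lemma minor_arc_bound:
  fixes K \<delta> S Q Q0 \<rho> :: real and N :: nat
  assumes pw: "prime_weights \<eta> \<rho>" and f: "\<And>n. 0 < n \<Longrightarrow> f n = of_real (\<Sum>d | d dvd n. mult_fun \<eta> d)"
    and S: "\<And>A::nat set. finite A \<Longrightarrow> (\<Sum>m\<in>A. ln (real m) / (real m)\<^sup>2) \<le> S"
    and \<delta>: "0 < \<delta>" "\<delta> \<le> 1/4" and K: "1 \<le> K"
    and L: "10000 * mertens_const \<le> ln (real N)" "10000 * S \<le> ln (real N)"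
    and C: "80000 * (1 + 6 * mertens_const) * ln (ln (real N)) \<le> 1 / \<rho>" "1 / \<rho> \<le> real N powr (\<delta> / 12)"
    and Q: "real N powr (1/2 + \<delta>) \<le> Q" "Q \<le> real N" "K * sqrt (real N * ln (real N)) \<le> Q"
    and Q0: "K * Q0 < real N powr (1/2 - \<delta>/2)"
    and a: "a = ln (2000 * K + 10000 + exp (8 * mertens_const / \<delta>))" and L1: "L1 = (8 + 4 * a) / \<delta>"
    and c: "c = 1 + ln (4 * (1 + 2 * a)) / ln (1 + \<delta>)"
  shows "min (1 / (41472 * K * (2 * L1 * exp L1 + 1))) (min (1 / (12800000 * c)) (1 / (82944 * K)))
      * (real N * \<rho>\<^sup>2 * ln (ln (real N) / ln (2 * real N / Q)) + Q)
    \<le> circle_integral (minor_arcs K Q0 Q) (\<lambda>\<theta>. (cmod (exp_sum f N \<theta>))\<^sup>2)" (is "min ?k1 (min ?k2 ?k3) * (?T + Q) \<le> ?I")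
proof -
  interpret prime_weights \<eta> \<rho> by fact
  define x where "x = real N"
  define l where "l = ln x"
  define u where "u = ln (2 * x / Q)"
  have l: "10000 \<le> l" using L mertens_const_ge_1 by (simp add: l_def x_def)
  have x1: "1 < x"
  proof (rule ccontr)
    assume "\<not> 1 < x"
    then have "l \<le> 0" unfolding l_def x_def by (cases "N = 0") auto
    then show False using l by simp
  qed
  have xl: "l \<le> x" using ln_le_minus_one[of x] x1 by (simp add: l_def)
  have Q1: "1 \<le> Q" using Q(1) ge_one_powr_ge_zero[of x "1/2 + \<delta>"] x1 \<delta> by (simp add: x_def)
  have KQ0: "K * Q0 \<le> sqrt x"
    using Q0 powr_mono[of "1/2 - \<delta>/2" "1/2" x] x1 \<delta> by (simp add: powr_half_sqrt x_def)
  have KQ: "10 * K * sqrt x \<le> Q"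
    using K l Q(3) x1 by (intro sqrt_mult_le_of_ln) (auto simp: l_def x_def)
  have "K * sqrt x \<le> 10 * K * sqrt x" using K x1 by (simp add: mult_right_mono)
  then have KQ': "K * sqrt x \<le> Q" using KQ by linarith
  have lll: "1 \<le> ln l"
  proof -
    have "exp 1 \<le> l" using l exp_le by linarith
    then have "ln (exp 1) \<le> ln l" using l by (subst ln_le_cancel_iff) auto
    then show ?thesis by simp
  qed
  have Z: "Z N - 1 \<le> 1/1000"
    using lll C x1 by (intro Z_minus_1_small) (auto simp: l_def x_def)
  have IQ: "Q / (41472 * K) \<le> ?I"
    using K Q1 KQ KQ0 xl l Q(2) f by (intro circle_integral_ge_Q Z) (auto simp: x_def)
  have A1: "1 \<le> 2000 * K + 10000 + exp (8 * mertens_const / \<delta>)" using K exp_gt_zero[of "8 * mertens_const / \<delta>"] by linarith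
  then have a0: "0 \<le> a" using a by simp
  have l20: "0 < l / u" "1/2 \<le> u"
  proof -
    have "2 \<le> 2 * x / Q" using Q Q1 by (simp add: x_def pos_le_divide_eq)
    then have "ln 2 \<le> u" unfolding u_def by (subst ln_le_cancel_iff) auto
    then show "1/2 \<le> u" using ln2_ge_two_thirds by linarith
    then show "0 < l / u" using l by simp
  qed
  have \<rho>2: "0 < \<rho>\<^sup>2" "\<rho>\<^sup>2 \<le> 1" using rho_pos rho_le by (auto simp: power_le_one)
  have c1: "1 \<le> c"
  proof -
    have "0 \<le> ln (4 * (1 + 2 * a)) / ln (1 + \<delta>)" using a0 \<delta> by (intro divide_nonneg_nonneg) auto
    then show ?thesis using c by simp
  qed
  have L10: "0 < L1" using L1 a0 \<delta> by (simp add: add_pos_nonneg)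
  have k0: "0 < ?k1" "0 < ?k2" "0 < ?k3" using K c1 L10 by (auto intro!: divide_pos_pos mult_pos_pos add_pos_pos)
  let ?\<kappa> = "min ?k1 (min ?k2 ?k3)"
  have \<kappa>: "0 < ?\<kappa>" "?\<kappa> \<le> ?k1" "?\<kappa> \<le> ?k2" "?\<kappa> \<le> ?k3" using k0 by auto
  have T: "?T = x * \<rho>\<^sup>2 * ln (l / u)" by (simp add: x_def l_def u_def)
  show ?thesis
  proof (cases "l < L1")
    case True
    \<comment> \<open>Since \<open>x < exp L1\<close> and \<open>Q \<ge> 1\<close>, the whole first
      term is at most a constant multiple of \<open>Q\<close>.\<close>
    have "ln (l / u) \<le> 2 * l"
    proof -
      have "ln (l / u) \<le> l / u" using ln_le_minus_one[of "l / u"] l20 by simp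
      also have "\<dots> \<le> l / (1/2)" using l l20 by (intro divide_left_mono) auto
      finally show ?thesis by simp
    qed
    then have "ln (l / u) \<le> 2 * L1" using True by simp
    then have "x * \<rho>\<^sup>2 * ln (l / u) \<le> x * \<rho>\<^sup>2 * (2 * L1)"
      using x1 \<rho>2 by (intro mult_left_mono) auto
    also have "\<dots> \<le> x * 1 * (2 * L1)"
      using x1 \<rho>2 L10 by (intro mult_right_mono mult_left_mono) auto
    finally have "?T \<le> x * 1 * (2 * L1)" unfolding T .
    also have "x * 1 * (2 * L1) \<le> exp L1 * (2 * L1)"
    proof -
      have "exp (ln x) \<le> exp L1" using True by (simp add: l_def)
      then show ?thesis using x1 L10 by (simp add: mult_right_mono)
    qed
    also have "\<dots> \<le> exp L1 * (2 * L1) * Q" using Q1 L10 mult_left_mono[of 1 Q "exp L1 * (2 * L1)"] by simp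
    finally have "?T + Q \<le> (2 * L1 * exp L1 + 1) * Q" by (simp add: algebra_simps)
    then have "?\<kappa> * (?T + Q) \<le> ?\<kappa> * ((2 * L1 * exp L1 + 1) * Q)"
      using \<kappa>(1) by (intro mult_left_mono) auto
    also have "\<dots> \<le> ?k1 * ((2 * L1 * exp L1 + 1) * Q)"
      using \<kappa>(2) L10 Q1 by (intro mult_right_mono) auto
    also have "\<dots> = Q / (41472 * K)"
    proof -
      have "0 < 2 * L1 * exp L1 + 1" using L10 by (intro add_pos_pos mult_pos_pos) auto
      then show ?thesis by simp
    qed
    finally show ?thesis using IQ by linarith
  next
    case False
    \<comment> \<open>The summands answer three demands on \<open>z\<close>: shifted points lie on
      the minor arcs, primes exceed 10000, and the Mertens error is dominated in each block.\<close>
    define A where "A = 2000 * K + 10000 + exp (8 * mertens_const / \<delta>)"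
    define z where "z = A * (x / Q)"
    have xQ: "1 \<le> x / Q" using Q Q1 by (simp add: x_def)
    have "A * 1 \<le> z" unfolding z_def using xQ A1 by (intro mult_left_mono) (auto simp: A_def)
    then have Az: "A \<le> z" by simp
    have z: "10000 \<le> z" "1 < z" using Az K exp_gt_zero[of "8 * mertens_const / \<delta>"] unfolding A_def by linarith+
    have z2: "2000 * K * x / Q \<le> z"
      using xQ K exp_gt_zero[of "8 * mertens_const / \<delta>"] mult_right_mono[of "2000 * K" A "x / Q"]
      by (simp add: z_def A_def)
    have zM: "8 * mertens_const / \<delta> \<le> ln z"
    proof -
      have "exp (8 * mertens_const / \<delta>) \<le> z" using Az K unfolding A_def by linarith
      then have "ln (exp (8 * mertens_const / \<delta>)) \<le> ln z" using z by (subst ln_le_cancel_iff) auto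
      then show ?thesis by simp
    qed
    have lz: "0 < ln z" using z by simp
    have "ln z = a + ln (x / Q)"
      unfolding z_def a A_def using A1 xQ by (subst ln_mult) auto
    moreover have u: "u = ln 2 + ln (x / Q)" unfolding u_def using ln_mult[of 2 "x / Q"] x1 Q1 by simp
    moreover have ln2: "0 \<le> ln (2::real)" "ln (2::real) \<le> 1" using ln_le_minus_one[of 2] by auto
    ultimately have lzu: "ln z \<le> u + a" by linarith
    have ly: "ln (sqrt x / 4) = l / 2 - ln 4" using x1 by (simp add: ln_div ln_sqrt l_def)
    \<comment> \<open>From \<open>Q \<ge> N powr (1/2 + \<delta>)\<close>. After multiplication by
      \<open>1 + \<delta>\<close> the coefficient is still below \<open>1/2 - \<delta>/2\<close>;
      the remaining \<open>\<delta> * l / 2\<close> absorbs \<open>2 * a + ln 4\<close> because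
      \<open>l \<ge> L1\<close>.\<close>
    have "ln (x / Q) \<le> (1/2 - \<delta>) * l"
    proof -
      have "ln (x powr (1/2 + \<delta>)) \<le> ln Q" using Q x1 Q1 by (subst ln_le_cancel_iff) (auto simp: x_def)
      then show ?thesis using x1 Q1 by (simp add: ln_div ln_powr l_def algebra_simps)
    qed
    then have "(1 + \<delta>) * ln z \<le> (1 + \<delta>) * (a + (1/2 - \<delta>) * l)"
      using \<open>ln z = a + ln (x / Q)\<close> \<delta> by (intro mult_left_mono) auto
    also have "\<dots> = (1 + \<delta>) * a + (1/2 - \<delta> / 2 - \<delta> * \<delta>) * l" by (simp add: algebra_simps)
    also have "\<dots> \<le> 2 * a + (1/2 - \<delta> / 2) * l"
      using \<delta> a0 l by (intro add_mono mult_right_mono) auto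
    also have "\<dots> \<le> l / 2 - ln 4"
    proof -
      have "8 + 4 * a \<le> \<delta> * l" using False \<delta> by (simp add: L1 field_simps)
      moreover have "ln (4::real) = 2 * ln 2" using ln_realpow[of 2 2] by simp
      ultimately show ?thesis using ln2 by (simp add: algebra_simps)
    qed
    finally have yz: "(1 + \<delta>) * ln z \<le> l / 2 - ln 4" .
    let ?P = "\<Sum>p\<in>primes_upto (sqrt x / 4) - primes_upto z. 1 / real p"
    have "ln (ln (sqrt x / 4) / ln z) / 8 \<le> ?P"
      using z \<delta> zM yz x1 ly by (intro sum_inverse_primes_ge[where d = \<delta>]) auto
    then have P: "ln ((l / 2 - ln 4) / ln z) \<le> 8 * ?P" unfolding ly by simp
    have "ln (l / u) \<le> c * ln ((l / 2 - ln 4) / ln z)"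
      unfolding c using \<delta> a0 l l20 lz lzu yz by (intro ln_ratio_le) (auto simp: pos_le_divide_eq)
    also have "\<dots> \<le> c * (8 * ?P)" using P c1 by (intro mult_left_mono) auto
    finally have lP: "ln (l / u) \<le> 8 * c * ?P" by simp
    have rho_ge: "x powr (-1/4) \<le> \<rho> / 1000"
    proof -
      have "1 / \<rho> \<le> x powr (\<delta> / 12)" using C by (simp add: x_def)
      also have "\<dots> \<le> x powr (24/100)" using x1 \<delta> by (intro powr_mono) auto
      finally have "1 / \<rho> * x powr (-1/4) \<le> x powr (24/100) * x powr (-1/4)" by (intro mult_right_mono) auto
      also have "\<dots> = x powr (-1/100)" by (simp flip: powr_add)
      also have "\<dots> \<le> 1/1000" using l x1 by (intro powr_neg_le_of_ln) (auto simp: l_def)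
      finally show ?thesis using rho_pos by (simp add: field_simps)
    qed
    have IP: "\<rho>\<^sup>2 * x / 800000 * ?P \<le> ?I"
      unfolding x_def
    proof (rule circle_integral_ge_primes[OF S])
      show "real N powr (-1/100) \<le> 1/1000" using powr_neg_le_of_ln[of x] l x1 by (simp add: l_def x_def)
    qed (use Z L rho_ge K Q1 KQ' KQ0 z z2 f x1 in \<open>auto simp: x_def\<close>)
    \<comment> \<open>Half of the integral pays for each term: 12800000 is
      \<open>2 * 8 * 800000\<close>, and 82944 is twice 41472.\<close>
    have "?k2 * ?T = \<rho>\<^sup>2 * x * ln (l / u) / (12800000 * c)" unfolding T by (simp add: mult_ac)
    also have "\<dots> \<le> \<rho>\<^sup>2 * x * (8 * c * ?P) / (12800000 * c)"
      using lP \<rho>2 x1 c1 by (intro divide_right_mono mult_left_mono) auto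
    also have "\<dots> = \<rho>\<^sup>2 * x / 800000 * ?P / 2" using c1 by simp
    also have "\<dots> \<le> ?I / 2" using IP by (intro divide_right_mono) auto
    finally have k2: "?k2 * ?T \<le> ?I / 2" .
    have k3: "?k3 * Q \<le> ?I / 2" using IQ by simp
    have "0 \<le> Q / (41472 * K)" using Q1 K by simp
    then have I0: "0 \<le> ?I" using IQ by linarith
    \<comment> \<open>The sign of the logarithm is not tracked; a negative first term only
      helps.\<close>
    have "?\<kappa> * ?T \<le> ?I / 2"
    proof (cases "0 \<le> ?T")
      case True
      then have "?\<kappa> * ?T \<le> ?k2 * ?T" using \<kappa> by (intro mult_right_mono) auto
      then show ?thesis using k2 by linarith
    next
      case False
      then have "?T \<le> 0" by linarith
      then have "?\<kappa> * ?T \<le> 0" by (rule mult_nonneg_nonpos[OF less_imp_le[OF \<kappa>(1)]])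
      then show ?thesis using I0 by linarith
    qed
    moreover have "?\<kappa> * Q \<le> ?k3 * Q" using \<kappa> Q1 by (intro mult_right_mono) auto
    ultimately show ?thesis using k3 unfolding distrib_left by linarith
  qed
qed

theorem proposition3p3:
  "\<exists>K0 > 0. \<exists>\<delta>0 > 0. \<forall>\<delta>::real. 0 < \<delta> \<and> \<delta> < \<delta>0 \<longrightarrow>
    (\<exists>C > 0. \<exists>N0::nat. \<forall>K::real. K \<ge> K0 \<longrightarrow>
      (\<exists>\<kappa>::real. \<kappa> > 0 \<and>
        (\<forall>R :: nat \<Rightarrow> real. (\<forall>n. R n \<noteq> 0) \<longrightarrow>
          (\<forall>(N::nat) (Q::real) (Q0::real).
            N \<ge> N0 \<and>
            real N powr (1/2 + \<delta>) \<le> Q \<and> Q \<le> real N \<and>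
            K * sqrt (real N * ln (real N)) \<le> Q \<and>
            real N * ln (real N) / Q \<le> Q0 \<and> Q0 \<le> Q / K\<^sup>2 \<and>
            K * Q0 < real N powr (1/2 - \<delta>/2) \<and>
            C * ln (ln (real N)) < \<bar>R N\<bar> \<and> \<bar>R N\<bar> \<le> real N powr (\<delta>/12) \<longrightarrow>
            (\<forall>w \<in> {little_omega, big_omega}.
              circle_integral (minor_arcs K Q0 Q)
                  (\<lambda>\<theta>. (cmod (exp_sum (d_alpha w (1 + 1 / R N)) N \<theta>))\<^sup>2)
                \<ge> \<kappa> * (real N / (R N)\<^sup>2 * ln (ln (real N) / ln (2 * real N / Q)) + Q))))))"
proof (rule exI[of _ 1], rule conjI, simp, rule exI[of _ "1/4"], rule conjI, simp, intro allI impI)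
  fix \<delta> :: real
  assume \<delta>: "0 < \<delta> \<and> \<delta> < 1/4"
  obtain S where S: "S \<ge> 0" "\<And>A::nat set. finite A \<Longrightarrow> (\<Sum>m\<in>A. ln (real m) / (real m)\<^sup>2) \<le> S"
    using sum_ln_over_square_bounded by blast
  \<comment> \<open>\<open>C\<close> and \<open>N0\<close> have to be fixed before \<open>K\<close>.
    All dependence on \<open>K\<close> goes into \<kappa>, through \<open>a\<close>,
    \<open>L1\<close> and \<open>c\<close>.\<close>
  define C where "C = 80000 * (1 + 6 * mertens_const)"
  define N0 where "N0 = nat \<lceil>exp (10000 * mertens_const + 10000 * S)\<rceil>"
  have C80: "80000 \<le> C" using mertens_const_ge_1 by (simp add: C_def)
  show "\<exists>C > 0. \<exists>N0::nat. \<forall>K::real. K \<ge> 1 \<longrightarrow>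
      (\<exists>\<kappa>::real. \<kappa> > 0 \<and>
        (\<forall>R :: nat \<Rightarrow> real. (\<forall>n. R n \<noteq> 0) \<longrightarrow>
          (\<forall>(N::nat) (Q::real) (Q0::real).
            N \<ge> N0 \<and>
            real N powr (1/2 + \<delta>) \<le> Q \<and> Q \<le> real N \<and>
            K * sqrt (real N * ln (real N)) \<le> Q \<and>
            real N * ln (real N) / Q \<le> Q0 \<and> Q0 \<le> Q / K\<^sup>2 \<and>
            K * Q0 < real N powr (1/2 - \<delta>/2) \<and>
            C * ln (ln (real N)) < \<bar>R N\<bar> \<and> \<bar>R N\<bar> \<le> real N powr (\<delta>/12) \<longrightarrow>
            (\<forall>w \<in> {little_omega, big_omega}.
              circle_integral (minor_arcs K Q0 Q)
                  (\<lambda>\<theta>. (cmod (exp_sum (d_alpha w (1 + 1 / R N)) N \<theta>))\<^sup>2)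
                \<ge> \<kappa> * (real N / (R N)\<^sup>2 * ln (ln (real N) / ln (2 * real N / Q)) + Q)))))"
  proof (rule exI[of _ C], rule conjI, use C80 in simp, rule exI[of _ N0], intro allI impI)
    fix K :: real
    assume K: "1 \<le> K"
    define a where "a = ln (2000 * K + 10000 + exp (8 * mertens_const / \<delta>))"
    define L1 where "L1 = (8 + 4 * a) / \<delta>"
    define c where "c = 1 + ln (4 * (1 + 2 * a)) / ln (1 + \<delta>)"
    define \<kappa> where "\<kappa> = min (1 / (41472 * K * (2 * L1 * exp L1 + 1))) (min (1 / (12800000 * c)) (1 / (82944 * K)))"
    have "1 \<le> 2000 * K + 10000 + exp (8 * mertens_const / \<delta>)"
      using K exp_gt_zero[of "8 * mertens_const / \<delta>"] by linarith
    then have a0: "0 \<le> a" by (simp add: a_def)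
    then have "0 < L1" using \<delta> by (simp add: L1_def add_pos_nonneg)
    moreover have "0 \<le> ln (4 * (1 + 2 * a)) / ln (1 + \<delta>)"
      using a0 \<delta> by (intro divide_nonneg_nonneg) auto
    ultimately have \<kappa>: "0 < \<kappa>"
      using K by (auto simp: \<kappa>_def c_def intro!: divide_pos_pos mult_pos_pos add_pos_pos add_pos_nonneg)
    show "\<exists>\<kappa>::real. \<kappa> > 0 \<and>
        (\<forall>R :: nat \<Rightarrow> real. (\<forall>n. R n \<noteq> 0) \<longrightarrow>
          (\<forall>(N::nat) (Q::real) (Q0::real).
            N \<ge> N0 \<and>
            real N powr (1/2 + \<delta>) \<le> Q \<and> Q \<le> real N \<and>
            K * sqrt (real N * ln (real N)) \<le> Q \<and>
            real N * ln (real N) / Q \<le> Q0 \<and> Q0 \<le> Q / K\<^sup>2 \<and>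
            K * Q0 < real N powr (1/2 - \<delta>/2) \<and>
            C * ln (ln (real N)) < \<bar>R N\<bar> \<and> \<bar>R N\<bar> \<le> real N powr (\<delta>/12) \<longrightarrow>
            (\<forall>w \<in> {little_omega, big_omega}.
              circle_integral (minor_arcs K Q0 Q)
                  (\<lambda>\<theta>. (cmod (exp_sum (d_alpha w (1 + 1 / R N)) N \<theta>))\<^sup>2)
                \<ge> \<kappa> * (real N / (R N)\<^sup>2 * ln (ln (real N) / ln (2 * real N / Q)) + Q))))"
    proof (intro exI[of _ \<kappa>] conjI \<kappa> allI impI ballI)
      fix R :: "nat \<Rightarrow> real" and N :: nat and Q Q0 :: real and w
      assume R: "\<forall>n. R n \<noteq> 0" and w: "w \<in> {little_omega, big_omega}"
      assume H: "N \<ge> N0 \<and>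
            real N powr (1/2 + \<delta>) \<le> Q \<and> Q \<le> real N \<and>
            K * sqrt (real N * ln (real N)) \<le> Q \<and>
            real N * ln (real N) / Q \<le> Q0 \<and> Q0 \<le> Q / K\<^sup>2 \<and>
            K * Q0 < real N powr (1/2 - \<delta>/2) \<and>
            C * ln (ln (real N)) < \<bar>R N\<bar> \<and> \<bar>R N\<bar> \<le> real N powr (\<delta>/12)"
      define \<alpha> where "\<alpha> = 1 + 1 / R N"
      have R0: "R N \<noteq> 0" using R by blast
      have \<rho>: "\<bar>\<alpha> - 1\<bar> = 1 / \<bar>R N\<bar>" by (simp add: \<alpha>_def)
      have "exp (10000 * mertens_const + 10000 * S) \<le> real N"
        using H unfolding N0_def by linarith
      then have "ln (exp (10000 * mertens_const + 10000 * S)) \<le> ln (real N)"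
        by (intro ln_mono) auto
      then have L: "10000 * mertens_const + 10000 * S \<le> ln (real N)" by simp
      then have "exp 1 \<le> ln (real N)" using exp_le mertens_const_ge_1 S(1) by linarith
      then have "ln (exp 1) \<le> ln (ln (real N))" by (intro ln_mono) auto
      then have "1 \<le> ln (ln (real N))" by simp
      then have "80000 * 1 \<le> C * ln (ln (real N))" using C80 by (intro mult_mono) auto
      then have R10: "10 \<le> \<bar>R N\<bar>" using H by linarith
      then have "0 < \<bar>\<alpha> - 1\<bar>" "\<bar>\<alpha> - 1\<bar> \<le> 1/10" unfolding \<rho> by (auto simp: field_simps)
      then obtain \<eta> where \<eta>: "prime_weights \<eta> \<bar>\<alpha> - 1\<bar>" "\<And>n. 0 < n \<Longrightarrow> \<alpha> ^ w n = (\<Sum>d | d dvd n. mult_fun \<eta> d)"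
        using prime_weights_omega[OF _ _ w] by blast
      have "\<kappa> * (real N * (1 / \<bar>R N\<bar>)\<^sup>2 * ln (ln (real N) / ln (2 * real N / Q)) + Q)
        \<le> circle_integral (minor_arcs K Q0 Q) (\<lambda>\<theta>. (cmod (exp_sum (d_alpha w \<alpha>) N \<theta>))\<^sup>2)"
        unfolding \<kappa>_def
      proof (rule minor_arc_bound[OF \<eta>(1)[unfolded \<rho>] _ S(2) _ _ K _ _ _ _ _ _ _ _ a_def L1_def c_def])
        show "d_alpha w \<alpha> n = of_real (\<Sum>d | d dvd n. mult_fun \<eta> d)" if "0 < n" for n
          using \<eta>(2)[OF that] by (simp add: d_alpha_def)
      qed (use \<delta> H L S(1) mertens_const_ge_1 in \<open>auto simp: C_def\<close>)
      then show "\<kappa> * (real N / (R N)\<^sup>2 * ln (ln (real N) / ln (2 * real N / Q)) + Q)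
        \<le> circle_integral (minor_arcs K Q0 Q) (\<lambda>\<theta>. (cmod (exp_sum (d_alpha w (1 + 1 / R N)) N \<theta>))\<^sup>2)"
        by (simp add: \<alpha>_def power_divide)
    qed
  qed
qed

end
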